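(* The existential theory ${\rm Th}_\exists(\mathbb{N}, +, n \mapsto p_n, n \mapsto r_n)$ is undecidable; that is, there is no algorithm which, given an existential first-order sentence in the language (with equality) consisting of a binary function symbol for $+$ and two unary function symbols for $n \mapsto p_n$ and $n \mapsto r_n$, decides whether this sentence is true in the structure $\langle \mathbb{N}, +, n \mapsto p_n, n \mapsto r_n\rangle$.
   Context: $\mathbb{N} = \{0,1,2,\dots\}$. For $n \in \mathbb{N}$, $p_n$ denotes the $(n+1)$-th prime number (so $p_0 = 2$, $p_1 = 3$, $p_2=5$, ...). For $n \ge 1$, $r_n$ denotes the remainder of $p_n$ in the Euclidean division by $n$. The value $r_0 \in \mathbb{N}$ is fixed arbitrarily. ${\rm Th}_\exists$ of a structure is the set of existential first-order sentences (of the form $\exists u_1 \cdots \exists u_s\, \psi$ with $\psi$ quantifier-free) true in it. *)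

theory Defs
  imports
    Main
    "HOL-Library.Infinite_Set"
    "HOL-Library.Nat_Bijection"
    "HOL-Computational_Algebra.Primes"
begin

definition nth_prime :: "nat \<Rightarrow> nat" where
  "nth_prime n = enumerate {p. prime p} n"

definition prime_rem :: "nat \<Rightarrow> nat \<Rightarrow> nat" where
  "prime_rem r0 n = (if n = 0 then r0 else nth_prime n mod n)"


text \<open>First-order formulas with equality over the signature with one binary function symbol
  and two unary function symbols (and no constants).\<close>

datatype tm = Var nat | Add tm tm | PrimeF tm | RemF tm

datatype fm =
    Eq tm tm
  | Neg fm
  | Conj fm fm
  | Disj fm fm
  | Imp fm fm
  | Ex nat fm
  | All nat fm

fun tm_vars :: "tm \<Rightarrow> nat set" where
  "tm_vars (Var x) = {x}"
| "tm_vars (Add s t) = tm_vars s \<union> tm_vars t"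
| "tm_vars (PrimeF t) = tm_vars t"
| "tm_vars (RemF t) = tm_vars t"

fun free_vars :: "fm \<Rightarrow> nat set" where
  "free_vars (Eq s t) = tm_vars s \<union> tm_vars t"
| "free_vars (Neg \<phi>) = free_vars \<phi>"
| "free_vars (Conj \<phi> \<psi>) = free_vars \<phi> \<union> free_vars \<psi>"
| "free_vars (Disj \<phi> \<psi>) = free_vars \<phi> \<union> free_vars \<psi>"
| "free_vars (Imp \<phi> \<psi>) = free_vars \<phi> \<union> free_vars \<psi>"
| "free_vars (Ex x \<phi>) = free_vars \<phi> - {x}"
| "free_vars (All x \<phi>) = free_vars \<phi> - {x}"

fun quantifier_free :: "fm \<Rightarrow> bool" where
  "quantifier_free (Eq s t) = True"
| "quantifier_free (Neg \<phi>) = quantifier_free \<phi>"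
| "quantifier_free (Conj \<phi> \<psi>) = (quantifier_free \<phi> \<and> quantifier_free \<psi>)"
| "quantifier_free (Disj \<phi> \<psi>) = (quantifier_free \<phi> \<and> quantifier_free \<psi>)"
| "quantifier_free (Imp \<phi> \<psi>) = (quantifier_free \<phi> \<and> quantifier_free \<psi>)"
| "quantifier_free (Ex x \<phi>) = False"
| "quantifier_free (All x \<phi>) = False"

inductive existential :: "fm \<Rightarrow> bool" where
  "quantifier_free \<psi> \<Longrightarrow> existential \<psi>"
| "existential \<phi> \<Longrightarrow> existential (Ex x \<phi>)"

definition existential_sentences :: "fm set" where
  "existential_sentences = {\<phi>. existential \<phi> \<and> free_vars \<phi> = {}}"

fun tm_val :: "nat \<Rightarrow> (nat \<Rightarrow> nat) \<Rightarrow> tm \<Rightarrow> nat" where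
  "tm_val r0 e (Var x) = e x"
| "tm_val r0 e (Add s t) = tm_val r0 e s + tm_val r0 e t"
| "tm_val r0 e (PrimeF t) = nth_prime (tm_val r0 e t)"
| "tm_val r0 e (RemF t) = prime_rem r0 (tm_val r0 e t)"

fun sat :: "nat \<Rightarrow> (nat \<Rightarrow> nat) \<Rightarrow> fm \<Rightarrow> bool" where
  "sat r0 e (Eq s t) = (tm_val r0 e s = tm_val r0 e t)"
| "sat r0 e (Neg \<phi>) = (\<not> sat r0 e \<phi>)"
| "sat r0 e (Conj \<phi> \<psi>) = (sat r0 e \<phi> \<and> sat r0 e \<psi>)"
| "sat r0 e (Disj \<phi> \<psi>) = (sat r0 e \<phi> \<or> sat r0 e \<psi>)"
| "sat r0 e (Imp \<phi> \<psi>) = (sat r0 e \<phi> \<longrightarrow> sat r0 e \<psi>)"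
| "sat r0 e (Ex x \<phi>) = (\<exists>n. sat r0 (e(x := n)) \<phi>)"
| "sat r0 e (All x \<phi>) = (\<forall>n. sat r0 (e(x := n)) \<phi>)"

definition Th_ex :: "nat \<Rightarrow> fm set" where
  "Th_ex r0 = {\<phi> \<in> existential_sentences. \<forall>e. sat r0 e \<phi>}"


text \<open>A Goedel numbering, so that formulas can be inputs of algorithms on natural numbers.\<close>

fun tm_code :: "tm \<Rightarrow> nat" where
  "tm_code (Var x) = prod_encode (0, x)"
| "tm_code (Add s t) = prod_encode (1, prod_encode (tm_code s, tm_code t))"
| "tm_code (PrimeF t) = prod_encode (2, tm_code t)"
| "tm_code (RemF t) = prod_encode (3, tm_code t)"

fun fm_code :: "fm \<Rightarrow> nat" where
  "fm_code (Eq s t) = prod_encode (0, prod_encode (tm_code s, tm_code t))"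
| "fm_code (Neg \<phi>) = prod_encode (1, fm_code \<phi>)"
| "fm_code (Conj \<phi> \<psi>) = prod_encode (2, prod_encode (fm_code \<phi>, fm_code \<psi>))"
| "fm_code (Disj \<phi> \<psi>) = prod_encode (3, prod_encode (fm_code \<phi>, fm_code \<psi>))"
| "fm_code (Imp \<phi> \<psi>) = prod_encode (4, prod_encode (fm_code \<phi>, fm_code \<psi>))"
| "fm_code (Ex x \<phi>) = prod_encode (5, prod_encode (x, fm_code \<phi>))"
| "fm_code (All x \<phi>) = prod_encode (6, prod_encode (x, fm_code \<phi>))"

lemma tm_code_inject: "tm_code s = tm_code t \<longleftrightarrow> s = t"
proof (induction s arbitrary: t)
  case (Var x) then show ?case by (cases t) (auto simp: prod_encode_eq)
next
  case (Add s1 s2) then show ?case by (cases t) (auto simp: prod_encode_eq)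
next
  case (PrimeF s) then show ?case by (cases t) (auto simp: prod_encode_eq)
next
  case (RemF s) then show ?case by (cases t) (auto simp: prod_encode_eq)
qed

lemma fm_code_inject: "fm_code \<phi> = fm_code \<psi> \<longleftrightarrow> \<phi> = \<psi>"
proof (induction \<phi> arbitrary: \<psi>)
  case (Eq s t) then show ?case by (cases \<psi>) (auto simp: prod_encode_eq tm_code_inject)
next
  case (Neg a) then show ?case by (cases \<psi>) (auto simp: prod_encode_eq)
next
  case (Conj a b) then show ?case by (cases \<psi>) (auto simp: prod_encode_eq)
next
  case (Disj a b) then show ?case by (cases \<psi>) (auto simp: prod_encode_eq)
next
  case (Imp a b) then show ?case by (cases \<psi>) (auto simp: prod_encode_eq)
next
  case (Ex x a) then show ?case by (cases \<psi>) (auto simp: prod_encode_eq)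
next
  case (All x a) then show ?case by (cases \<psi>) (auto simp: prod_encode_eq)
qed


text \<open>Algorithms are partial recursive functions: \<open>computes f xs y\<close> means that the program \<open>f\<close>
  halts on the arguments \<open>xs\<close> with result \<open>y\<close>. A program carries no arity: it
  has a value on every argument list for which a rule applies, and is undefined elsewhere. The recursion argument of
  \<open>PrimRec\<close> and the search argument of \<open>Mu\<close> come first.\<close>

datatype recf =
    Zero
  | Succ
  | Proj nat
  | Comp recf "recf list"
  | PrimRec recf recf
  | Mu recf

inductive computes :: "recf \<Rightarrow> nat list \<Rightarrow> nat \<Rightarrow> bool" where
  Zero: "computes Zero xs 0"
| Succ: "computes Succ [x] (Suc x)"
| Proj: "i < length xs \<Longrightarrow> computes (Proj i) xs (xs ! i)"
| Comp: "list_all2 (\<lambda>g y. computes g xs y) gs ys \<Longrightarrow> computes f ys z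
    \<Longrightarrow> computes (Comp f gs) xs z"
| PrimRec_0: "computes f xs z \<Longrightarrow> computes (PrimRec f g) (0 # xs) z"
| PrimRec_Suc: "computes (PrimRec f g) (n # xs) y \<Longrightarrow> computes g (n # y # xs) z
    \<Longrightarrow> computes (PrimRec f g) (Suc n # xs) z"
| Mu: "computes f (n # xs) 0 \<Longrightarrow> (\<forall>i<n. \<exists>y. computes f (i # xs) (Suc y))
    \<Longrightarrow> computes (Mu f) xs n"

lemma computes_unique: "computes f xs y \<Longrightarrow> computes f xs z \<Longrightarrow> y = z"
proof (induction arbitrary: z rule: computes.induct)
  case (Comp xs gs ys f w)
  from Comp.prems obtain ys' where ys': "list_all2 (\<lambda>g y. computes g xs y) gs ys'"
    and z: "computes f ys' z" by (auto elim: computes.cases)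
  have "ys = ys'"
    using Comp.IH(1) ys' by (auto simp: list_all2_conv_all_nth intro!: nth_equalityI)
  with Comp.IH z show ?case by blast
next
  case (PrimRec_0 f xs y g)
  from PrimRec_0.prems show ?case by cases (auto dest: PrimRec_0.IH)
next
  case (PrimRec_Suc f g n xs y w)
  from PrimRec_Suc.prems show ?case
    by cases (use PrimRec_Suc.IH in blast)
next
  case (Mu f n xs)
  from Mu.prems have z: "computes f (z # xs) 0" "\<forall>i<z. \<exists>y. computes f (i # xs) (Suc y)"
    by (auto elim: computes.cases)
  have "\<not> z < n" using Mu.IH(2) z(1) by force
  moreover have "\<not> n < z" using Mu.IH(1) z(2) by force
  ultimately show ?case by simp
qed (auto elim: computes.cases)


text \<open>An algorithm deciding membership in \<open>A\<close> for inputs from \<open>D\<close>; its behaviour on other inputs is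
  unconstrained.\<close>

definition decidable_among :: "fm set \<Rightarrow> fm set \<Rightarrow> bool" where
  "decidable_among D A \<longleftrightarrow>
    (\<exists>f. \<forall>\<phi>\<in>D. computes f [fm_code \<phi>] (if \<phi> \<in> A then 1 else 0))"

end

theory Submission
  imports Defs "HOL-Number_Theory.Cong" "HOL-Real_Asymp.Real_Asymp"
begin

text \<open>
  Since \<open>n * (p n div n) = p n - r n\<close>, differences of this quantity between two points with the same
  quotient \<open>k = p n div n\<close> exhibit multiples of \<open>k\<close>. By Chebyshev's bounds and Mertens' theorem every interval
  \<open>[X, X + C sqrt X]\<close> contains a number \<open>j\<close> such that the quotient takes only the values \<open>j - 1\<close> and
  \<open>j\<close> on a long interval, so that multiplication by \<open>j\<close> is existentially definable on a large domain. Two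
  such numbers \<open>d\<close> and \<open>k\<close> with \<open>k / d\<close> very close to \<open>z\<close> give \<open>z ^ 2\<close> as the integer part of \<open>z k / d\<close>,
  and squaring defines multiplication. This avoids any error term in the prime number theorem.

  The quotient grows like the logarithm, so its graph is a relation of roughly exponential growth; Julia
  Robinson's argument with Pell equations then defines exponentiation. By the method of Davis, Putnam and
  Robinson the graphs of all partial recursive functions are existentially definable, and a decision procedure
  is refuted by diagonalization.
\<close>

section \<open>Chebyshev and Mertens estimates\<close>

text \<open>Mertens' theorem fixes the sum of ln p / p only up to a bounded error. This is too weak
  to make the quotient monotone, or constant on long intervals, so two adjacent values have to be
  tolerated; a two-coloured 5 by 5 grid then finds points with equal quotients.

  The square root comes from a balance: blocks of indices of logarithmic length \<kappa> locate a
  quotient near X up to errors of order X / \<kappa> and \<kappa>, which agree for \<kappa> near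
  sqrt X. Such gaps do not hurt the squaring argument, because d may be a high power of z. The range
  \<open>x \<le> j ^ 10\<close> is cheap, since a window for j starts beyond exp (j / C - 1), which
  dominates every power of j.

  Bounded quantifiers are eliminated for polynomial equations only, because the argument passes to
  residues modulo primes; hence a separate Diophantine class beside the relations of the structure.
  The diagonal argument needs one formula for one fixed relation, so constants that are merely known
  to exist do no harm.\<close>

lemma prime_nth_prime: "prime (nth_prime n)"
  using enumerate_in_set[OF primes_infinite] unfolding nth_prime_def by auto

lemma nth_prime_less_iff [simp]: "nth_prime m < nth_prime n \<longleftrightarrow> m < n"
  unfolding nth_prime_def by (rule enumerate_mono_iff[OF primes_infinite])

lemma nth_prime_le_iff [simp]: "nth_prime m \<le> nth_prime n \<longleftrightarrow> m \<le> n"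
  unfolding nth_prime_def by (rule enumerate_mono_le_iff[OF primes_infinite])

lemma nth_prime_inj [simp]: "nth_prime m = nth_prime n \<longleftrightarrow> m = n"
  by (metis nth_prime_le_iff order_class.order_eq_iff)

lemma nth_prime_surj: "prime p \<Longrightarrow> \<exists>n. nth_prime n = p"
  using enumerate_Ex[of "{p. prime p}" p] primes_infinite unfolding nth_prime_def by auto

lemma nth_prime_ge: "n + 2 \<le> nth_prime n"
proof (induction n)
  case 0
  show ?case using prime_ge_2_nat[OF prime_nth_prime[of 0]] by simp
next
  case (Suc n)
  have "nth_prime n < nth_prime (Suc n)" by simp
  with Suc show ?case by linarith
qed

lemma nth_prime_0 [simp]: "nth_prime 0 = 2"
proof -
  obtain n where "nth_prime n = 2" using nth_prime_surj two_is_prime_nat by blast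
  with nth_prime_ge[of n] have "n = 0" by simp
  with \<open>nth_prime n = 2\<close> show ?thesis by simp
qed

lemma primes_upto_nth_prime: "{p. prime p \<and> p \<le> nth_prime n} = nth_prime ` {..n}"
proof (intro equalityI subsetI)
  fix p assume "p \<in> {p. prime p \<and> p \<le> nth_prime n}"
  then show "p \<in> nth_prime ` {..n}" using nth_prime_surj[of p] by auto
qed (auto simp: prime_nth_prime)

lemma inj_on_nth_prime: "inj_on nth_prime A"
  by (rule inj_onI) simp

lemma prod_coprime_dvd:
  fixes f :: "'a \<Rightarrow> nat"
  assumes "finite A" "\<And>i. i \<in> A \<Longrightarrow> f i dvd n"
    and "\<And>i j. i \<in> A \<Longrightarrow> j \<in> A \<Longrightarrow> i \<noteq> j \<Longrightarrow> coprime (f i) (f j)"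
  shows "prod f A dvd n"
  using assms
proof (induction A rule: finite_induct)
  case (insert a A)
  have "coprime (f a) (prod f A)"
    using insert.hyps(2) by (intro prod_coprime_right) (auto intro!: insert.prems)
  moreover have "f a dvd n" "prod f A dvd n"
    using insert.prems insert.IH by blast+
  ultimately show ?case using insert.hyps by (simp add: divides_mult)
qed simp

text \<open>Erdos's argument: for n = 2 m + 1 every prime in (m + 1, n] divides
  \<open>n choose m\<close>, which is at most 4 ^ m; the primes up to m + 1 are covered by
  induction.\<close>

lemma primorial_le: "(\<Prod>p | prime p \<and> p \<le> n. p) \<le> (4::nat) ^ n"
proof (induction n rule: less_induct)
  case (less n)
  have fin: "finite {p::nat. prime p \<and> p \<le> k}" for k
    by (rule finite_subset[of _ "{..k}"]) auto
  show ?case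
  proof (cases "n \<le> 2")
    case True
    have "{p::nat. prime p \<and> p \<le> n} \<subseteq> {2}"
      using True by (auto dest: prime_ge_2_nat)
    then have "{p::nat. prime p \<and> p \<le> n} = {} \<or> {p::nat. prime p \<and> p \<le> n} = {2}" by blast
    then show ?thesis
    proof
      assume A: "{p::nat. prime p \<and> p \<le> n} = {2}"
      then have "2 \<in> {p::nat. prime p \<and> p \<le> n}" by simp
      with True have "n = 2" by simp
      then show ?thesis unfolding A by simp
    qed (simp del: Collect_empty_eq)
  next
    case False
    show ?thesis
    proof (cases "even n")
      case True
      have "\<not> prime n" using False True prime_odd_nat[of n] by auto
      then have "{p::nat. prime p \<and> p \<le> n} = {p. prime p \<and> p \<le> n - 1}"
        using False by (auto simp: le_less)
      then have "(\<Prod>p | prime p \<and> p \<le> n. p) \<le> (4::nat) ^ (n - 1)"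
        using less.IH[of "n - 1"] False by simp
      also have "\<dots> \<le> 4 ^ n" by (rule power_increasing) auto
      finally show ?thesis .
    next
      case odd: False
      then obtain m where m: "n = 2 * m + 1" by (elim oddE)
      with False have "m \<ge> 1" by simp
      let ?A = "{p. prime p \<and> p \<le> m + 1}" and ?B = "{p. prime p \<and> m + 1 < p \<and> p \<le> n}"
      have split: "{p. prime p \<and> p \<le> n} = ?A \<union> ?B" using m \<open>m \<ge> 1\<close> by auto
      have finB: "finite ?B" by (rule finite_subset[OF _ fin[of n]]) auto
      have "p dvd (n choose m)" if p: "p \<in> ?B" for p
      proof -
        have "fact n = fact m * fact (n - m) * (n choose m)"
          using binomial_fact_lemma[of m n] m by simp
        moreover have "p dvd (fact n :: nat)" using p prime_dvd_fact_iff[of p n] by simp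
        moreover have "\<not> p dvd (fact m :: nat)" "\<not> p dvd (fact (n - m) :: nat)"
          using p m prime_dvd_fact_iff[of p m] prime_dvd_fact_iff[of p "n - m"] by auto
        ultimately show ?thesis using p
          by (metis (no_types, lifting) mem_Collect_eq prime_dvd_mult_iff)
      qed
      then have "(\<Prod>p\<in>?B. p) dvd (n choose m)"
        using finB by (intro prod_coprime_dvd) (auto simp: primes_coprime)
      then have B: "(\<Prod>p\<in>?B. p) \<le> (n choose m)"
        using m by (intro dvd_imp_le) (auto)
      \<comment> \<open>The two middle coefficients are equal and both occur in the row sum 2 * 4 ^
        m.\<close>
      have "2 * (n choose m) = (n choose m) + (n choose (m+1))"
        using binomial_symmetric[of m n] m by simp
      also have "\<dots> = (\<Sum>k\<in>{m, m+1}. n choose k)" by simp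
      also have "\<dots> \<le> (\<Sum>k\<le>n. n choose k)"
        using m by (intro sum_mono2) auto
      also have "\<dots> = 2 * 4 ^ m"
        unfolding choose_row_sum m by (simp add: power_mult)
      finally have C: "(n choose m) \<le> 4 ^ m" by simp
      have "(\<Prod>p | prime p \<and> p \<le> n. p) = (\<Prod>p\<in>?A. p) * (\<Prod>p\<in>?B. p)"
        unfolding split using fin finB by (intro prod.union_disjoint) auto
      also have "\<dots> \<le> 4 ^ (m + 1) * 4 ^ m"
        using less.IH[of "m + 1"] B C m \<open>m \<ge> 1\<close> by (intro mult_mono) auto
      also have "\<dots> = 4 ^ n" by (simp add: m power_add mult_2)
      finally show ?thesis .
    qed
  qed
qed


section \<open>Logarithms of factorials and Chebyshev's lower bound\<close>

lemma ln_fact_ge: "n \<ge> 1 \<Longrightarrow> real n * ln (real n) - real n \<le> ln (fact n)"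
proof (induction n rule: nat_induct_at_least)
  case (Suc n)
  have "ln (real (Suc n)) - ln (real n) \<le> (real (Suc n) - real n) / real n"
    using Suc.hyps by (intro ln_diff_le) auto
  then have "real n * (ln (real (Suc n)) - ln (real n)) \<le> real n * (1 / real n)"
    by (intro mult_left_mono) simp_all
  also have "\<dots> = 1" using Suc.hyps by simp
  finally have "real n * ln (real (Suc n)) \<le> real n * ln (real n) + 1"
    by (simp add: algebra_simps)
  moreover have "ln (fact (Suc n) :: real) = ln (real (Suc n)) + ln (fact n)"
    unfolding fact_Suc by (subst ln_mult) auto
  ultimately show ?case using Suc.IH by (simp add: algebra_simps del: fact_Suc)
qed simp

lemma ln_fact_le: "n \<ge> 1 \<Longrightarrow> ln (fact n :: real) \<le> real n * ln (real n)"
proof -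
  assume n: "n \<ge> 1"
  have "(fact n :: real) \<le> real n ^ n" using fact_le_power[of n, where 'a=real] by simp
  then have "ln (fact n :: real) \<le> ln (real n ^ n)" using n by (subst ln_le_cancel_iff) auto
  also have "\<dots> = real n * ln (real n)" using n by (simp add: ln_realpow)
  finally show ?thesis .
qed

lemma nth_prime_ge_2 [simp]: "2 \<le> nth_prime n" "Suc 0 \<le> nth_prime n" "Suc 0 < nth_prime n"
  "0 < nth_prime n" "nth_prime n \<noteq> 0"
  using nth_prime_ge[of n] by linarith+

lemma real_nth_prime_gt_1 [simp]: "1 < real (nth_prime n)"
  using nth_prime_ge[of n] by linarith

lemma prod_nth_prime_le: "(\<Prod>i\<le>n. nth_prime i) \<le> 4 ^ nth_prime n"
proof -
  have "(\<Prod>i\<le>n. nth_prime i) = (\<Prod>p | prime p \<and> p \<le> nth_prime n. p)"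
    unfolding primes_upto_nth_prime by (subst prod.reindex) (auto simp: inj_on_nth_prime)
  then show ?thesis using primorial_le by simp
qed

lemma sum_ln_nth_prime_le: "(\<Sum>i\<le>n. ln (real (nth_prime i))) \<le> real (nth_prime n) * ln 4"
proof -
  have "(\<Sum>i\<le>n. ln (real (nth_prime i))) = ln (real (\<Prod>i\<le>n. nth_prime i))"
    by (subst of_nat_prod, subst ln_prod) auto
  also have "\<dots> \<le> ln (real (4 ^ nth_prime n))"
    using prod_nth_prime_le[of n] by (subst ln_le_cancel_iff) (auto intro!: prod_pos simp del: of_nat_prod)
  also have "\<dots> = real (nth_prime n) * ln 4" by (simp add: ln_realpow)
  finally show ?thesis .
qed

text \<open>Since \<open>nth_prime i\<close> exceeds i, the factorial of n is at most the product of
  the primes up to \<open>nth_prime n\<close>; the primorial bound and ln n! finish.\<close>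

lemma nth_prime_lower:
  assumes "n \<ge> 1"
  shows "real n * ln (real n) - real n \<le> real (nth_prime n) * ln 4"
proof -
  have fact: "fact n \<le> (\<Prod>i\<le>n. nth_prime i)"
  proof -
    have "fact n \<le> (\<Prod>i<n. nth_prime i)"
    proof (induction n)
      case (Suc n)
      have "fact (Suc n) = Suc n * fact n" by simp
      also have "\<dots> \<le> nth_prime n * (\<Prod>i<n. nth_prime i)"
        using nth_prime_ge[of n] by (intro mult_mono Suc) auto
      finally show ?case by (simp add: mult.commute)
    qed simp
    also have "\<dots> \<le> (\<Prod>i<n. nth_prime i) * nth_prime n" by simp
    finally show ?thesis by (simp add: lessThan_Suc_atMost[symmetric])
  qed
  have "real n * ln (real n) - real n \<le> ln (real (fact n))"
    using ln_fact_ge[OF assms] by simp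
  also have "\<dots> \<le> ln (real (\<Prod>i\<le>n. nth_prime i))"
  proof (rule ln_mono)
    show "real (fact n) \<le> real (\<Prod>i\<le>n. nth_prime i)"
      using fact by (rule of_nat_mono)
  qed simp_all
  also have "\<dots> = (\<Sum>i\<le>n. ln (real (nth_prime i)))"
    by (subst of_nat_prod, subst ln_prod) auto
  also have "\<dots> \<le> real (nth_prime n) * ln 4" by (rule sum_ln_nth_prime_le)
  finally show ?thesis .
qed

text \<open>Legendre's formula as a recursion: only the multiples of p contribute, and cancelling
  one p from each leaves (n div p)!. The recursive form avoids sums over powers of p.\<close>

lemma multiplicity_fact_rec:
  assumes "prime (p::nat)"
  shows "multiplicity p (fact n) = n div p + multiplicity p (fact (n div p))"
proof -
  have M: "multiplicity p (fact m :: nat) = (\<Sum>i\<in>{1..m}. multiplicity p i)" for m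
    using assms unfolding fact_prod of_nat_id
    by (subst prime_elem_multiplicity_prod_distrib) auto
  have p: "p > 0" using assms by (simp add: prime_gt_0_nat)
  have "(\<Sum>i\<in>{1..n}. multiplicity p i) = (\<Sum>i\<in>(*) p ` {1..n div p}. multiplicity p i)"
  proof (rule sum.mono_neutral_right)
    show "(*) p ` {1..n div p} \<subseteq> {1..n}"
    proof (clarify)
      fix j assume "j \<in> {1..n div p}"
      then have "1 \<le> j" "p * j \<le> p * (n div p)" by auto
      moreover have "p * (n div p) \<le> n" by simp
      ultimately have "p * j \<le> n" "1 \<le> p * j" using p by (linarith, simp)
      then show "p * j \<in> {1..n}" by simp
    qed
    show "\<forall>i\<in>{1..n} - (*) p ` {1..n div p}. multiplicity p i = 0"
    proof
      fix i assume i: "i \<in> {1..n} - (*) p ` {1..n div p}"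
      have "\<not> p dvd i"
      proof
        assume "p dvd i"
        then obtain j where j: "i = p * j" by blast
        with i p have "j \<ge> 1" "j \<le> n div p" by (auto simp: less_eq_div_iff_mult_less_eq mult.commute)
        with i j show False by auto
      qed
      then show "multiplicity p i = 0" by (rule not_dvd_imp_multiplicity_0)
    qed
  qed auto
  also have "\<dots> = (\<Sum>j\<in>{1..n div p}. multiplicity p (p * j))"
    using p by (subst sum.reindex) (auto simp: inj_on_def)
  also have "\<dots> = (\<Sum>j\<in>{1..n div p}. 1 + multiplicity p j)"
    using assms p by (intro sum.cong refl) (subst prime_elem_multiplicity_mult_distrib, auto)
  also have "\<dots> = n div p + multiplicity p (fact (n div p))"
    unfolding M by (subst sum.distrib) simp
  finally show ?thesis unfolding M .
qed

lemma multiplicity_fact_upper: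
  assumes "prime (p::nat)"
  shows "multiplicity p (fact n) * (p - 1) \<le> n"
proof (induction n rule: less_induct)
  case (less n)
  show ?case
  proof (cases "n = 0")
    case False
    have p: "p \<ge> 2" using assms by (rule prime_ge_2_nat)
    with False have "n div p < n" by simp
    from less.IH[OF this] have "multiplicity p (fact (n div p)) * (p - 1) \<le> n div p" .
    then have "multiplicity p (fact n) * (p - 1) \<le> (n div p) * (p - 1) + n div p"
      by (subst multiplicity_fact_rec[OF assms]) (simp add: add_mult_distrib)
    also have "\<dots> = (n div p) * (p - 1 + 1)" by (simp add: algebra_simps)
    also have "\<dots> = (n div p) * p" using p by simp
    also have "\<dots> \<le> n" by simp
    finally show ?thesis .
  qed simp
qed

lemma ln_fact_nth_prime:
  "ln (fact (nth_prime n)) =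
    (\<Sum>i\<le>n. real (multiplicity (nth_prime i) (fact (nth_prime n))) * ln (real (nth_prime i)))"
proof -
  let ?N = "nth_prime n"
  have "fact ?N = (\<Prod>p\<in>prime_factors (fact ?N). p ^ multiplicity p (fact ?N :: nat))"
    by (rule prime_factorization_nat) simp
  also have "prime_factors (fact ?N :: nat) = {p. prime p \<and> p \<le> ?N}"
    unfolding prime_factors_fact by (auto dest: prime_ge_2_nat)
  also have "\<dots> = nth_prime ` {..n}" by (rule primes_upto_nth_prime)
  finally have *: "fact ?N = (\<Prod>i\<le>n. nth_prime i ^ multiplicity (nth_prime i) (fact ?N :: nat))"
    by (subst (asm) prod.reindex) (auto simp: inj_on_nth_prime)
  have "ln (fact ?N :: real) = ln (real (fact ?N))" by simp
  also have "\<dots> = ln (\<Prod>i\<le>n. real (nth_prime i) ^ multiplicity (nth_prime i) (fact ?N :: nat))"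
    by (subst *) (simp del: of_nat_fact)
  also have "\<dots> = (\<Sum>i\<le>n. real (multiplicity (nth_prime i) (fact ?N :: nat)) * ln (real (nth_prime i)))"
    by (subst ln_prod) (auto simp: ln_realpow)
  finally show ?thesis .
qed


text \<open>The sum of Mertens' first theorem, cut off at the prime with index n.\<close>

definition ln_sum :: "nat \<Rightarrow> real" where
  "ln_sum n = (\<Sum>i\<le>n. ln (real (nth_prime i)) / real (nth_prime i))"

text \<open>With N = p_n, each prime p has multiplicity at least N div p > N / p - 1 in N!. Summing
  against ln p compares \<open>N * ln_sum n\<close> with ln N! plus Chebyshev's theta function, at
  most N ln 4.\<close>

lemma ln_sum_upper: "ln_sum n \<le> ln (real (nth_prime n)) + ln 4"
proof -
  let ?N = "nth_prime n"
  have "real ?N * (ln (real (nth_prime i)) / real (nth_prime i)) \<le>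
      real (multiplicity (nth_prime i) (fact ?N :: nat)) * ln (real (nth_prime i)) + ln (real (nth_prime i))" for i
  proof -
    let ?p = "nth_prime i"
    have "?N < ?p * (?N div ?p + 1)"
      using dividend_less_times_div[of ?p ?N] by simp
    then have "real ?N \<le> real (?p * (?N div ?p + 1))" by (intro of_nat_mono) simp
    also have "\<dots> = real ?p * real (?N div ?p + 1)" by (rule of_nat_mult)
    finally have "real ?N / real ?p \<le> real (?N div ?p + 1)"
      by (simp add: divide_le_eq mult.commute del: of_nat_add of_nat_Suc)
    also have "?N div ?p \<le> multiplicity ?p (fact ?N)"
      by (subst multiplicity_fact_rec[OF prime_nth_prime]) simp
    then have "real (?N div ?p + 1) \<le> real (multiplicity ?p (fact ?N :: nat)) + 1" by simp
    finally have "(real ?N / real ?p) * ln (real ?p) \<le> (real (multiplicity ?p (fact ?N :: nat)) + 1) * ln (real ?p)"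
      by (rule mult_right_mono) simp
    then show ?thesis by (simp add: algebra_simps)
  qed
  then have "(\<Sum>i\<le>n. real ?N * (ln (real (nth_prime i)) / real (nth_prime i))) \<le>
      (\<Sum>i\<le>n. real (multiplicity (nth_prime i) (fact ?N :: nat)) * ln (real (nth_prime i)) + ln (real (nth_prime i)))"
    by (intro sum_mono)
  then have "real ?N * ln_sum n \<le> ln (fact ?N) + (\<Sum>i\<le>n. ln (real (nth_prime i)))"
    unfolding ln_sum_def ln_fact_nth_prime sum.distrib sum_distrib_left .
  also have "\<dots> \<le> real ?N * ln (real ?N) + real ?N * ln 4"
    using ln_fact_le[of ?N] sum_ln_nth_prime_le[of n] by (intro add_mono) auto
  finally have "real ?N * ln_sum n \<le> real ?N * (ln (real ?N) + ln 4)" by (simp add: distrib_left)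
  then show ?thesis by simp
qed

text \<open>The derivative of \<open>- (ln x + 1) / x\<close> is \<open>ln x / x ^ 2\<close>; the constant 2 instead of 1 absorbs the
  discretisation error.\<close>

lemma ln_over_telescope:
  assumes "m \<ge> 2"
  shows "ln (real m) / (real m * (real m - 1)) \<le>
    (ln (real m - 1) + 2) / (real m - 1) - (ln (real m) + 2) / real m"
proof -
  define x where "x = real m"
  have x: "x \<ge> 2" using assms by (simp add: x_def)
  have "ln x - ln (x - 1) \<le> (x - (x - 1)) / (x - 1)"
    using x by (intro ln_diff_le) auto
  then have "x * (ln x - ln (x - 1)) \<le> x * (1 / (x - 1))" using x by (intro mult_left_mono) auto
  also have "\<dots> \<le> 2" using x by (simp add: field_simps)
  finally have *: "x * ln x \<le> x * ln (x - 1) + 2" by (simp add: algebra_simps)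
  have "(ln (x - 1) + 2) / (x - 1) - (ln x + 2) / x =
      (x * (ln (x - 1) + 2) - (x - 1) * (ln x + 2)) / (x * (x - 1))"
    using x by (simp add: field_simps)
  also have "x * (ln (x - 1) + 2) - (x - 1) * (ln x + 2) = ln x + (x * ln (x - 1) + 2 - x * ln x)"
    by (simp add: algebra_simps)
  also have "ln x / (x * (x - 1)) \<le> (ln x + (x * ln (x - 1) + 2 - x * ln x)) / (x * (x - 1))"
    using * x by (intro divide_right_mono) auto
  finally show ?thesis unfolding x_def .
qed

lemma sum_ln_over_square_le:
  "(\<Sum>i\<le>n. ln (real (nth_prime i)) / (real (nth_prime i) * (real (nth_prime i) - 1))) \<le> 2"
proof -
  let ?g = "\<lambda>m. ln (real m) / (real m * (real m - 1))"
  have tel: "(\<Sum>m\<in>{2..N}. ?g m) \<le> 2 - (ln (real N) + 2) / real N" if "N \<ge> 1" for N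
    using that
  proof (induction N rule: nat_induct_at_least)
    case (Suc N)
    have "(\<Sum>m\<in>{2..Suc N}. ?g m) = (\<Sum>m\<in>{2..N}. ?g m) + ?g (Suc N)"
      using Suc.hyps by simp
    also have "\<dots> \<le> 2 - (ln (real N) + 2) / real N +
        ((ln (real (Suc N) - 1) + 2) / (real (Suc N) - 1) - (ln (real (Suc N)) + 2) / real (Suc N))"
      using Suc by (intro add_mono ln_over_telescope) auto
    finally show ?case by simp
  qed simp
  have "(\<Sum>i\<le>n. ?g (nth_prime i)) = (\<Sum>p\<in>nth_prime ` {..n}. ?g p)"
    by (subst sum.reindex) (auto simp: inj_on_nth_prime)
  also have "\<dots> \<le> (\<Sum>m\<in>{2..nth_prime n}. ?g m)"
  proof (rule sum_mono2)
    show "nth_prime ` {..n} \<subseteq> {2..nth_prime n}"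
      by auto
  qed auto
  also have "\<dots> \<le> 2 - (ln (real (nth_prime n)) + 2) / real (nth_prime n)"
    by (rule tel) simp
  also have "\<dots> \<le> 2"
    using ln_gt_zero[OF real_nth_prime_gt_1, of n] by simp
  finally show ?thesis .
qed

text \<open>Multiplicities in N! are at most N / (p - 1) = N / p + N / (p (p - 1)). The second terms
  cost 2 in total and Stirling's bound costs 1, hence the 3.\<close>

lemma ln_sum_lower: "ln (real (nth_prime n)) - 3 \<le> ln_sum n"
proof -
  let ?N = "nth_prime n"
  have "real (multiplicity (nth_prime i) (fact ?N :: nat)) * ln (real (nth_prime i)) \<le>
      real ?N * (ln (real (nth_prime i)) / real (nth_prime i) +
        ln (real (nth_prime i)) / (real (nth_prime i) * (real (nth_prime i) - 1)))" for i
  proof -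
    let ?p = "nth_prime i"
    have "real (multiplicity ?p (fact ?N :: nat) * (?p - 1)) \<le> real ?N"
      using multiplicity_fact_upper[OF prime_nth_prime] by (rule of_nat_mono)
    moreover have "real (?p - 1) = real ?p - 1" by (simp add: of_nat_diff)
    ultimately have "real (multiplicity ?p (fact ?N :: nat)) \<le> real ?N / (real ?p - 1)"
      using real_nth_prime_gt_1[of i] by (simp add: pos_le_divide_eq del: real_nth_prime_gt_1)
    also have "\<dots> = real ?N * (1 / real ?p + 1 / (real ?p * (real ?p - 1)))"
    proof -
      have "1 / (x - 1) = 1 / x + 1 / (x * (x - 1))" if "x > 1" for x :: real
        using that by (simp add: divide_simps)
      from this[of "real ?p"] have "1 / (real ?p - 1) = 1 / real ?p + 1 / (real ?p * (real ?p - 1))" by simp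
      from this[symmetric] show ?thesis by simp
    qed
    finally have "real (multiplicity ?p (fact ?N :: nat)) * ln (real ?p) \<le>
        (real ?N * (1 / real ?p + 1 / (real ?p * (real ?p - 1)))) * ln (real ?p)"
      by (rule mult_right_mono) simp
    also have "\<dots> = real ?N * (ln (real ?p) / real ?p + ln (real ?p) / (real ?p * (real ?p - 1)))"
      by (simp add: distrib_left distrib_right)
    finally show ?thesis .
  qed
  then have "ln (fact ?N) \<le> (\<Sum>i\<le>n. real ?N * (ln (real (nth_prime i)) / real (nth_prime i) +
        ln (real (nth_prime i)) / (real (nth_prime i) * (real (nth_prime i) - 1))))"
    unfolding ln_fact_nth_prime by (intro sum_mono)
  also have "\<dots> = real ?N * (ln_sum n + (\<Sum>i\<le>n. ln (real (nth_prime i)) / (real (nth_prime i) * (real (nth_prime i) - 1))))"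
    unfolding ln_sum_def sum.distrib[symmetric] sum_distrib_left ..
  also have "\<dots> \<le> real ?N * (ln_sum n + 2)"
    using sum_ln_over_square_le[of n] by (intro mult_left_mono) auto
  finally have "real ?N * ln (real ?N) - real ?N \<le> real ?N * (ln_sum n + 2)"
    using ln_fact_ge[of ?N] by simp
  then have "real ?N * (ln (real ?N) - 1) \<le> real ?N * (ln_sum n + 2)" by (simp add: algebra_simps)
  then show ?thesis by simp
qed


text \<open>The primes in (N / e^8, N] contribute at least 1 to the Mertens sum, each at most e^8 ln
  N / N, so there are at least N / (e^8 ln N) of them. Small N are handled directly.\<close>

lemma nth_prime_le_ln:
  assumes "n \<ge> 1"
  shows "real (nth_prime n) \<le> 4 * exp 8 * real n * ln (real (nth_prime n))"
proof (cases "real (nth_prime n) < 2 * exp 8")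
  case True
  have "ln 2 \<le> ln (real (nth_prime n))" by (rule ln_mono) simp_all
  moreover have "ln (2::real) \<ge> 1/2" using ln_le_minus_one[of "1/2::real"] by (simp add: ln_div)
  ultimately have "1 \<le> 2 * ln (real (nth_prime n))" by linarith
  moreover have "real n \<ge> 1" using assms by simp
  ultimately have "1 * 1 \<le> real n * (2 * ln (real (nth_prime n)))" by (intro mult_mono) auto
  then have "2 * exp 8 * 1 \<le> 2 * exp 8 * (real n * (2 * ln (real (nth_prime n))))"
    by (intro mult_left_mono) auto
  also have "\<dots> = 4 * exp 8 * real n * ln (real (nth_prime n))" by simp
  finally show ?thesis using True by linarith
next
  case False
  let ?N = "real (nth_prime n)"
  let ?A = "{i. i \<le> n \<and> real (nth_prime i) \<le> ?N / exp 8}"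
  define a where "a = Max ?A"
  have "finite ?A" by (rule finite_subset[of _ "{..n}"]) auto
  moreover have "0 \<in> ?A" using False by (simp add: field_simps)
  ultimately have "a \<in> ?A" and amax: "\<And>i. i \<in> ?A \<Longrightarrow> i \<le> a"
    unfolding a_def using Max_in[of ?A] Max_ge[of ?A] by blast+
  then have a: "a \<le> n" "real (nth_prime a) \<le> ?N / exp 8" by auto
  have "ln (real (nth_prime a)) \<le> ln (?N / exp 8)" using a by (intro ln_mono) auto
  also have "\<dots> = ln ?N - 8" by (subst ln_div) auto
  finally have la: "ln (real (nth_prime a)) \<le> ln ?N - 8" .
  have "ln (4::real) = 2 * ln 2" using ln_realpow[of "2::real" 2] by simp
  then have ln4: "ln (4::real) \<le> 2" using ln_le_minus_one[of "2::real"] by simp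
  \<comment> \<open>The 8 absorbs both Mertens errors: 8 - 3 - ln 4 is at least 1.\<close>
  have "1 \<le> ln_sum n - ln_sum a"
    using ln_sum_lower[of n] ln_sum_upper[of a] la ln4 by linarith
  also have "\<dots> = (\<Sum>i\<in>{a<..n}. ln (real (nth_prime i)) / real (nth_prime i))"
  proof -
    have "{..n} = {..a} \<union> {a<..n}" using a by auto
    then have "ln_sum n = ln_sum a + (\<Sum>i\<in>{a<..n}. ln (real (nth_prime i)) / real (nth_prime i))"
      unfolding ln_sum_def by (simp add: sum.union_disjoint ivl_disj_int)
    then show ?thesis by simp
  qed
  also have "\<dots> \<le> (\<Sum>i\<in>{a<..n}. ln ?N / (?N / exp 8))"
  proof (rule sum_mono)
    fix i assume i: "i \<in> {a<..n}"
    then have "i \<notin> ?A" using amax by force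
    with i have "real (nth_prime i) \<ge> ?N / exp 8" by auto
    moreover have "ln (real (nth_prime i)) \<le> ln ?N" using i by (intro ln_mono) auto
    ultimately show "ln (real (nth_prime i)) / real (nth_prime i) \<le> ln ?N / (?N / exp 8)"
      by (intro frac_le) auto
  qed
  also have "\<dots> = real (n - a) * (ln ?N / (?N / exp 8))" by simp
  also have "\<dots> \<le> real n * (ln ?N / (?N / exp 8))" by (intro mult_right_mono) auto
  finally have "?N * 1 \<le> ?N * (real n * (ln ?N / (?N / exp 8)))" by (intro mult_left_mono) auto
  also have "\<dots> = real n * ln ?N * exp 8" by simp
  also have "\<dots> \<le> 4 * exp 8 * real n * ln ?N" by simp
  finally show ?thesis by simp
qed

lemma ln_le_2_sqrt: "x > 0 \<Longrightarrow> ln x \<le> 2 * sqrt (x::real)"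
proof -
  assume x: "x > 0"
  have "ln x = 2 * ln (sqrt x)" using x by (simp add: ln_sqrt)
  also have "ln (sqrt x) \<le> sqrt x" using ln_le_minus_one[of "sqrt x"] x by simp
  finally show ?thesis by simp
qed

text \<open>A crude bound free of logarithms. It turns ln p_n into ln n in
  \<open>nth_prime_upper\<close>, and iterates to a polynomial bound for primes with prime
  index.\<close>

lemma nth_prime_le_square:
  obtains C :: nat where "C > 0" "\<And>n. n \<ge> 1 \<Longrightarrow> nth_prime n \<le> C * n ^ 2"
proof -
  define c :: real where "c = 8 * exp 8"
  have "real (nth_prime n) \<le> c ^ 2 * real n ^ 2" if "n \<ge> 1" for n
  proof -
    let ?N = "real (nth_prime n)"
    have "?N \<le> 4 * exp 8 * real n * ln ?N" by (rule nth_prime_le_ln[OF that])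
    also have "\<dots> \<le> 4 * exp 8 * real n * (2 * sqrt ?N)"
      by (intro mult_left_mono ln_le_2_sqrt) auto
    finally have "sqrt ?N * sqrt ?N \<le> c * real n * sqrt ?N" by (simp add: c_def)
    then have "sqrt ?N \<le> c * real n" by (rule mult_right_le_imp_le) simp
    then have "sqrt ?N ^ 2 \<le> (c * real n) ^ 2" by (rule power_mono) simp
    then show ?thesis by (simp add: power_mult_distrib)
  qed
  note * = this
  have c2: "c ^ 2 \<le> real (nat \<lceil>c ^ 2\<rceil>)" by (rule real_nat_ceiling_ge)
  have "c > 0" by (simp add: c_def)
  then have "c ^ 2 > 0" by simp
  with c2 have "nat \<lceil>c ^ 2\<rceil> > 0" by linarith
  moreover have "nth_prime n \<le> nat \<lceil>c ^ 2\<rceil> * n ^ 2" if "n \<ge> 1" for n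
  proof -
    have "real (nth_prime n) \<le> c ^ 2 * real n ^ 2" by (rule *[OF that])
    also have "\<dots> \<le> real (nat \<lceil>c ^ 2\<rceil>) * real n ^ 2" using c2 by (rule mult_right_mono) simp
    also have "\<dots> = real (nat \<lceil>c ^ 2\<rceil> * n ^ 2)" by simp
    finally show ?thesis by (rule of_nat_le_iff[THEN iffD1])
  qed
  ultimately show ?thesis by (rule that)
qed

text \<open>The form \<open>1 + ln n\<close> keeps the bound positive at n = 1.\<close>

lemma nth_prime_upper:
  obtains C :: real where "C \<ge> 1" "\<And>n. n \<ge> 1 \<Longrightarrow> real (nth_prime n) \<le> C * real n * (1 + ln (real n))"
proof -
  obtain D :: nat where D: "D > 0" "\<And>n. n \<ge> 1 \<Longrightarrow> nth_prime n \<le> D * n ^ 2"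
    using nth_prime_le_square by blast
  define C where "C = 4 * exp 8 * (ln (real D) + 2)"
  have lD: "ln (real D) \<ge> 0" using D by (intro ln_ge_zero) simp
  have "1 * 1 \<le> exp 8 * (ln (real D) + 2)" using lD by (intro mult_mono) auto
  then have "C \<ge> 1" unfolding C_def by simp
  moreover have "real (nth_prime n) \<le> C * real n * (1 + ln (real n))" if n: "n \<ge> 1" for n
  proof -
    let ?N = "real (nth_prime n)"
    have ln: "ln (real n) \<ge> 0" using n by (intro ln_ge_zero) simp
    have "?N \<le> real (D * n ^ 2)" using D(2)[OF n] by (rule of_nat_mono)
    then have "ln ?N \<le> ln (real (D * n ^ 2))" by (intro ln_mono) auto
    also have "\<dots> = ln (real D) + 2 * ln (real n)"
      using D n by (simp add: ln_mult ln_realpow)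
    also have "\<dots> \<le> (ln (real D) + 2) * (1 + ln (real n))"
      using lD ln by (simp add: algebra_simps)
    finally have "4 * exp 8 * real n * ln ?N \<le> 4 * exp 8 * real n * ((ln (real D) + 2) * (1 + ln (real n)))"
      by (intro mult_left_mono) auto
    with nth_prime_le_ln[OF n] show ?thesis unfolding C_def by (simp add: mult_ac)
  qed
  ultimately show ?thesis by (rule that)
qed

section \<open>Windows of almost constant quotients\<close>

lemma harmonic_lower:
  assumes "a \<ge> 1" "a \<le> b"
  shows "ln (real (b + 1) / real (a + 1)) \<le> (\<Sum>m\<in>{a<..b}. 1 / real m)"
  using assms(2)
proof (induction b rule: dec_induct)
  case (step b)
  have "ln (real (Suc b + 1)) - ln (real (b + 1)) \<le> (real (Suc b + 1) - real (b + 1)) / real (b + 1)"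
    by (intro ln_diff_le) auto
  then have "ln (real (Suc b + 1) / real (a + 1)) \<le> ln (real (b + 1) / real (a + 1)) + 1 / real (Suc b)"
    by (simp add: ln_div)
  moreover have "{a<..Suc b} = insert (Suc b) {a<..b}" using step by auto
  ultimately show ?case using step by simp
qed simp

lemma harmonic_upper:
  assumes "a \<ge> 1" "a \<le> b"
  shows "(\<Sum>m\<in>{a<..b}. 1 / real m) \<le> ln (real b / real a)"
  using assms(2)
proof (induction b rule: dec_induct)
  case base
  then show ?case using assms by simp
next
  case (step b)
  have "ln (real b) - ln (real (Suc b)) \<le> (real b - real (Suc b)) / real (Suc b)"
    using step assms by (intro ln_diff_le) auto
  then have "ln (real b / real a) + 1 / real (Suc b) \<le> ln (real (Suc b) / real a)"
    using step assms by (simp add: ln_div del: of_nat_Suc) (simp add: minus_divide_left[symmetric])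
  moreover have "{a<..Suc b} = insert (Suc b) {a<..b}" using step by auto
  ultimately show ?case using step by simp
qed

lemma ln_2_le_1: "ln (2::real) \<le> 1"
  using ln_le_minus_one[of "2::real"] by simp

lemma ln_4_le_2: "ln (4::real) \<le> 2"
  using ln_realpow[of "2::real" 2] ln_2_le_1 by simp

lemma ln_sum_diff:
  assumes "a \<le> b"
  shows "ln_sum b - ln_sum a = (\<Sum>i\<in>{a<..b}. ln (real (nth_prime i)) / real (nth_prime i))"
proof -
  have "{..b} = {..a} \<union> {a<..b}" using assms by auto
  then have "ln_sum b = ln_sum a + (\<Sum>i\<in>{a<..b}. ln (real (nth_prime i)) / real (nth_prime i))"
    unfolding ln_sum_def by (simp add: sum.union_disjoint ivl_disj_int)
  then show ?thesis by simp
qed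

text \<open>In the next two lemmas Mertens' theorem bounds the location of an index before which, respectively
  after which, the quotients of the \<open>n\<close>-th prime by \<open>n\<close> stay on one side of a given value.\<close>

lemma dense_below:
  fixes x \<kappa> C :: real
  assumes C: "C \<ge> 1" "\<And>n. n \<ge> 1 \<Longrightarrow> real (nth_prime n) \<le> C * real n * (1 + ln (real n))"
    and K: "K \<ge> 1" "ln (real K) = \<kappa>"
    and x: "x \<ge> 1" and A: "A \<ge> 1" "x * real A \<le> real (nth_prime A)"
    and below: "\<And>m. 1 \<le> m \<Longrightarrow> m < A \<Longrightarrow> real (nth_prime m) \<le> x * real m"
    and large: "2 * \<kappa> + 6 \<le> ln (real A)" and \<kappa>: "\<kappa> \<ge> 1"
  shows "(\<kappa> - 1) * (ln (real A) - \<kappa> - 1) \<le> x * (\<kappa> + (ln (16 * C) + 6))"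
proof -
  \<comment> \<open>The indices between a and A form a block of logarithmic length about
    \<kappa>.\<close>
  define a where "a = A div K"
  have K0: "real K > 0" using K by simp
  have KA: "2 * real K \<le> real A"
  proof -
    have "ln (2 * real K) \<le> ln (real A)"
      using K large \<kappa> ln_2_le_1 by (simp add: ln_mult)
    then show ?thesis using K A by (subst (asm) ln_le_cancel_iff) auto
  qed
  have aK: "real a \<le> real A / real K" unfolding a_def by (rule of_nat_div_le_of_nat)
  have "A < K * (A div K + 1)" using K dividend_less_times_div[of K A] by simp
  then have "A \<le> K * (a + 1)" unfolding a_def by simp
  then have "real A \<le> real (K * (a + 1))" by (rule of_nat_mono)
  then have "real A / real K \<le> real a + 1" using K0 by (simp add: divide_le_eq algebra_simps)
  moreover have "real A / real K \<ge> 2" using KA K0 by (simp add: le_divide_eq)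
  ultimately have a_lower: "real a \<ge> real A / (2 * real K)" and a1: "a \<ge> 1" by simp_all
  have "ln (real A / (2 * real K)) \<le> ln (real a)" using a_lower A K0 by (intro ln_mono) auto
  then have la: "ln (real a) \<ge> ln (real A) - \<kappa> - 1"
    using A K ln_2_le_1 by (simp add: ln_div ln_mult)
  with large \<kappa> have la2: "ln (real a) \<ge> ln (real A) / 2" and la3: "ln (real a) \<ge> 2" by simp_all
  have a2: "real a > 1" using a1 la3 by (cases "a = 1") auto
  have aA: "a \<le> A - 1"
  proof -
    have "a < A"
    proof (rule ccontr)
      assume "\<not> a < A"
      then have "real A \<le> real a" by simp
      also note aK
      also have "real A / real K \<le> real A / 2" 
      proof (rule divide_left_mono)
        have "K \<noteq> 1" using K \<kappa> by auto
        with K show "2 \<le> real K" by simp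
      qed (use K0 in auto)
      finally show False using A by simp
    qed
    then show ?thesis by simp
  qed
  have Pa: "real (nth_prime a) \<ge> real a * ln (real a) / 4"
  proof -
    have "real a * ln (real a) - real a \<ge> real a * (ln (real a) / 2)"
      using mult_left_mono[OF la3, of "real a"] by (simp add: algebra_simps)
    moreover have "real a * ln (real a) - real a \<le> real (nth_prime a) * 2"
      by (rule order_trans[OF nth_prime_lower[OF a1] mult_left_mono[OF ln_4_le_2]]) simp
    ultimately show ?thesis by simp
  qed
  \<comment> \<open>On the block \<open>nth_prime m \<le> x * m\<close> makes each Mertens term at
    least ln a / (x m). The sum is thus at least about \<kappa> ln a / x, whereas Mertens' theorem
    allows only about \<kappa>; hence ln a is at most about x.\<close>
  have "ln (real a) / x * (\<kappa> - 1) \<le> ln (real a) / x * ln (real A / real (a + 1))"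
  proof (intro mult_left_mono)
    have "real (a + 1) \<le> 2 * real A / real K"
      using aK \<open>real A / real K \<ge> 2\<close> by simp
    then have "real K / 2 \<le> real A / real (a + 1)"
      using K0 by (simp add: field_simps)
    then have "ln (real K / 2) \<le> ln (real A / real (a + 1))" using K0 by (intro ln_mono) auto
    then show "\<kappa> - 1 \<le> ln (real A / real (a + 1))" using K ln_2_le_1 by (simp add: ln_div)
  qed (use la3 x in auto)
  also have "\<dots> \<le> ln (real a) / x * (\<Sum>m\<in>{a<..A - 1}. 1 / real m)"
    using harmonic_lower[OF a1 aA] la3 x A by (intro mult_left_mono) auto
  also have "\<dots> \<le> (\<Sum>m\<in>{a<..A - 1}. ln (real (nth_prime m)) / real (nth_prime m))"
    unfolding sum_distrib_left
  proof (rule sum_mono)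
    fix m assume m: "m \<in> {a<..A - 1}"
    have "real (nth_prime m) \<le> x * real m" using m a1 by (intro below) auto
    moreover have "a \<le> nth_prime m" using m nth_prime_ge[of m] by simp
    then have "ln (real a) \<le> ln (real (nth_prime m))" using a1 by (intro ln_mono) auto
    ultimately have "ln (real a) / (x * real m) \<le> ln (real (nth_prime m)) / real (nth_prime m)"
      using la3 by (intro frac_le) auto
    then show "ln (real a) / x * (1 / real m) \<le> ln (real (nth_prime m)) / real (nth_prime m)"
      by simp
  qed
  also have "\<dots> = ln_sum (A - 1) - ln_sum a" using aA by (simp add: ln_sum_diff)
  also have "\<dots> \<le> ln (real (nth_prime (A - 1))) - ln (real (nth_prime a)) + 5"
    using ln_sum_upper[of "A - 1"] ln_sum_lower[of a] ln_4_le_2 by simp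
  also have "ln (real (nth_prime (A - 1))) \<le> ln (x * real A)"
  proof (rule ln_mono)
    have "real (nth_prime (A - 1)) \<le> x * real (A - 1)" using aA a1 A by (intro below) auto
    also have "\<dots> \<le> x * real A" using x by (intro mult_left_mono) auto
    finally show "real (nth_prime (A - 1)) \<le> x * real A" .
  qed (use A x in auto)
  finally have bd: "ln (real a) / x * (\<kappa> - 1) \<le> ln (x * real A) - ln (real (nth_prime a)) + 5" by simp
  have Pa': "ln (real a * ln (real a) / 4) \<le> ln (real (nth_prime a))"
    using Pa a2 la3 by (intro ln_mono) auto
  have "ln (x * real A) - ln (real a * ln (real a) / 4) = ln (real A) - ln (real a) + ln (4 * x / ln (real a))"
    using x A(1) a2 la3 by (simp add: ln_mult ln_div)
  also have "\<dots> \<le> (\<kappa> + 1) + ln (16 * C)"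
  proof (intro add_mono ln_mono)
    \<comment> \<open>Chebyshev's upper bound at A gives x = O(ln a), so replacing p_a by a ln a / 4
      loses only a constant.\<close>
    show "4 * x / ln (real a) \<le> 16 * C"
    proof -
      have "x * real A \<le> C * real A * (1 + ln (real A))"
        using A(2) C(2)[OF A(1)] by linarith
      then have "x * real A \<le> (C * (1 + ln (real A))) * real A" by (simp add: mult_ac)
      then have "x \<le> C * (1 + ln (real A))" using A by simp
      also have "\<dots> \<le> C * (2 * ln (real A))" using C large \<kappa> by (intro mult_left_mono) auto
      also have "\<dots> \<le> C * (4 * ln (real a))" using C la2 by (intro mult_left_mono) auto
      finally show ?thesis using la3 by (simp add: divide_le_eq)
    qed
  qed (use la x la3 in auto)
  finally have "ln (real a) / x * (\<kappa> - 1) \<le> \<kappa> + (ln (16 * C) + 6)"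
    using bd Pa' by linarith
  then have "x * (ln (real a) / x * (\<kappa> - 1)) \<le> x * (\<kappa> + (ln (16 * C) + 6))"
    using x by (intro mult_left_mono) auto
  then have "(\<kappa> - 1) * ln (real a) \<le> x * (\<kappa> + (ln (16 * C) + 6))" using x by (simp add: mult.commute)
  moreover have "(\<kappa> - 1) * (ln (real A) - \<kappa> - 1) \<le> (\<kappa> - 1) * ln (real a)"
    using la \<kappa> by (intro mult_left_mono) auto
  ultimately show ?thesis by linarith
qed


lemma sparse_above:
  fixes y \<kappa> :: real
  assumes K: "K \<ge> 1" "ln (real K) = \<kappa>" and y: "y \<ge> 1" and B: "B \<ge> 2"
    and above: "\<And>m. B \<le> m \<Longrightarrow> y * real m \<le> real (nth_prime m)"
    and below: "real (nth_prime (B - 1)) \<le> (y + 1) * real (B - 1)"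
  shows "(\<kappa> - 6) * y \<le> (\<kappa> + 1) * ln (real (nth_prime (K * B)))"
proof -
  let ?N = "real (nth_prime (K * B))"
  have KB: "B \<le> K * B" using K by simp
  then have B1: "B - 1 \<le> K * B" by linarith
  have \<kappa>: "\<kappa> \<ge> 0" using K by auto
  have "ln (y * real (K * B)) \<le> ln ?N"
    using above[OF KB] y B K by (intro ln_mono) auto
  moreover have "ln (real (nth_prime (B - 1))) \<le> ln (2 * y * real B)"
  proof (rule ln_mono)
    note below
    also have "(y + 1) * real (B - 1) \<le> 2 * y * real B" using y by (intro mult_mono) auto
    finally show "real (nth_prime (B - 1)) \<le> 2 * y * real B" .
  qed (use y B in auto)
  \<comment> \<open>The mirror image: on the block from B to K * B Mertens' theorem forces a sum of
    at least \<kappa> - 6, while each term is at most ln N / (y m).\<close>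
  ultimately have "\<kappa> - 6 \<le> ln_sum (K * B) - ln_sum (B - 1)"
    using ln_sum_upper[of "B - 1"] ln_sum_lower[of "K * B"] ln_4_le_2 ln_2_le_1 y B K
    by (simp add: ln_mult)
  also have "\<dots> = (\<Sum>m\<in>{B - 1<..K * B}. ln (real (nth_prime m)) / real (nth_prime m))"
    by (rule ln_sum_diff[OF B1])
  also have "\<dots> \<le> (\<Sum>m\<in>{B - 1<..K * B}. ln ?N / y * (1 / real m))"
  proof (rule sum_mono)
    fix m assume m: "m \<in> {B - 1<..K * B}"
    then have "y * real m \<le> real (nth_prime m)" using B by (intro above) auto
    moreover have "ln (real (nth_prime m)) \<le> ln ?N" using m by (intro ln_mono) auto
    ultimately have "ln (real (nth_prime m)) / real (nth_prime m) \<le> ln ?N / (y * real m)"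
      using y m by (intro frac_le) auto
    then show "ln (real (nth_prime m)) / real (nth_prime m) \<le> ln ?N / y * (1 / real m)" by simp
  qed
  also have "\<dots> = ln ?N / y * (\<Sum>m\<in>{B - 1<..K * B}. 1 / real m)"
    by (simp add: sum_distrib_left)
  also have "\<dots> \<le> ln ?N / y * (\<kappa> + 1)"
  proof (rule mult_left_mono)
    have "{B - 1<..K * B} = insert B {B<..K * B}" using B KB by auto
    then have "(\<Sum>m\<in>{B - 1<..K * B}. 1 / real m) = 1 / real B + (\<Sum>m\<in>{B<..K * B}. 1 / real m)" by simp
    also have "\<dots> \<le> 1 + ln (real (K * B) / real B)"
      using B KB by (intro add_mono harmonic_upper) auto
    also have "ln (real (K * B) / real B) = \<kappa>" using B K by simp
    finally show "(\<Sum>m\<in>{B - 1<..K * B}. 1 / real m) \<le> \<kappa> + 1" by simp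
  qed (use y in auto)
  finally have "(\<kappa> - 6) * y \<le> ln ?N / y * (\<kappa> + 1) * y" using y by (intro mult_right_mono) auto
  also have "\<dots> = (\<kappa> + 1) * ln ?N" using y by simp
  finally show ?thesis .
qed

text \<open>The quotient on [a, a + w) is j - 1 or j, written without division. The side condition
  \<open>a \<le> j * (w + 1)\<close> used with it makes the relative length at least about 1 /
  j.\<close>

definition window :: "nat \<Rightarrow> nat \<Rightarrow> nat \<Rightarrow> bool" where
  "window j a w \<longleftrightarrow> (\<forall>m\<in>{a..<a + w}. (j - 1) * m \<le> nth_prime m \<and> nth_prime m < (j + 1) * m)"

text \<open>Let m be the last index up to m2 with quotient at least j + 1 and m' the first later one
  with quotient below j. Primes increase, so (j + 1) m < j m', that is m < j (m' - m): the stretch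
  in between, where the quotient equals j, is long. The last conclusion serves to bound the start of
  the window from below.\<close>

lemma window_of_descent:
  assumes "1 \<le> m1" "m1 < m2" "(j + 1) * m1 \<le> nth_prime m1" "nth_prime m2 < j * m2"
  obtains a w where "a \<le> j * (w + 1)" "window j a w" "m1 < a"
    "\<exists>m. 1 \<le> m \<and> m \<le> a \<and> j * m \<le> nth_prime m"
proof -
  let ?M = "{i. m1 \<le> i \<and> i \<le> m2 \<and> (j + 1) * i \<le> nth_prime i}"
  define m where "m = Max ?M"
  have "finite ?M" by (rule finite_subset[of _ "{..m2}"]) auto
  moreover have "m1 \<in> ?M" using assms by simp
  ultimately have "m \<in> ?M" and mmax: "\<And>i. i \<in> ?M \<Longrightarrow> i \<le> m"
    unfolding m_def using Max_in[of ?M] Max_ge[of ?M] by blast+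
  then have m: "m1 \<le> m" "m \<le> m2" "(j + 1) * m \<le> nth_prime m" by auto
  have "m \<noteq> m2" using m(3) assms(4) by auto
  with m have "m < m2" by simp
  define m' where "m' = (LEAST i. m < i \<and> nth_prime i < j * i)"
  have m': "m < m'" "nth_prime m' < j * m'" and m'min: "\<And>i. m < i \<Longrightarrow> nth_prime i < j * i \<Longrightarrow> m' \<le> i"
    unfolding m'_def using LeastI[of "\<lambda>i. m < i \<and> nth_prime i < j * i" m2] \<open>m < m2\<close> assms(4)
    by (auto intro: Least_le)
  have "m' \<le> m2" using \<open>m < m2\<close> assms(4) by (rule m'min)
  have "(j + 1) * m < j * m'"
  proof -
    have "nth_prime m < nth_prime m'" using m' by simp
    with m(3) m'(2) show ?thesis by linarith
  qed
  then have "m < j * (m' - m)" by (simp add: diff_mult_distrib2)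
  show ?thesis
  proof (rule that[of "m + 1" "m' - m - 1"])
    have "m' - m - 1 + 1 = m' - m" using m' by simp
    then show "m + 1 \<le> j * (m' - m - 1 + 1)" using \<open>m < j * (m' - m)\<close> by simp
    show "m1 < m + 1" using m by simp
    have "j * m \<le> nth_prime m" using m(3) by simp
    then show "\<exists>n. 1 \<le> n \<and> n \<le> m + 1 \<and> j * n \<le> nth_prime n"
      using m(1) assms(1) by (intro exI[of _ m]) auto
    show "window j (m + 1) (m' - m - 1)"
      unfolding window_def
    proof (intro ballI conjI)
      fix i assume "i \<in> {m + 1..<m + 1 + (m' - m - 1)}"
      then have i: "m < i" "i < m'" by auto
      then have "\<not> nth_prime i < j * i" using m'min by (meson not_le)
      moreover have "(j - 1) * i \<le> j * i" by simp
      ultimately show "(j - 1) * i \<le> nth_prime i" by linarith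
      have "i \<notin> ?M" using mmax i by (meson not_le)
      then show "nth_prime i < (j + 1) * i" using i m \<open>m' \<le> m2\<close> by auto
    qed
  qed
qed


text \<open>The first inequality bounds l by X + O(\<kappa>); inserted into the second, it leaves L
  = O(X / \<kappa> + \<kappa>). With \<open>X \<le> \<kappa> ^ 2\<close> this is O(\<kappa>), the
  origin of the square root gaps.\<close>

lemma density_estimate:
  fixes \<kappa> X l c d L :: real
  assumes \<kappa>: "\<kappa> \<ge> 12" and X: "0 \<le> X" "X \<le> \<kappa> ^ 2" and c: "c \<ge> 0" and d: "d \<ge> 0" and l: "l \<ge> 0"
    and 1: "(\<kappa> - 1) * (l - \<kappa> - 1) \<le> (X + 1) * (\<kappa> + c)"
    and 2: "(\<kappa> - 6) * (X + L - 1) \<le> (\<kappa> + 1) * (d + \<kappa> + l + 1 + ln (\<kappa> + l + 2))"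
  shows "L \<le> (4 * (d + 4 * c + 10 + ln (4 * c + 10)) + 32) * \<kappa>"
proof -
  define c2 where "c2 = 4 * c + 6"
  define c3 where "c3 = d + c2 + 4 + ln (c2 + 4)"
  have c2: "c2 \<ge> 6" using c by (simp add: c2_def)
  have c3: "c3 \<ge> 0" using c2 d by (simp add: c3_def)
  have k2: "\<kappa> * 12 \<le> \<kappa> * \<kappa>" using \<kappa> by (intro mult_left_mono) auto
  have l_le: "l \<le> X + c2 * \<kappa>"
  proof -
    have "(\<kappa> - 1) * (l - \<kappa> - 1) \<le> (X + 1) * (\<kappa> - 1) + (X + 1) * (c + 1)"
      using 1 by (simp add: algebra_simps)
    also have "(X + 1) * (c + 1) \<le> (2 * \<kappa> ^ 2) * (c + 1)"
    proof (rule mult_right_mono)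
      show "X + 1 \<le> 2 * \<kappa> ^ 2" using X(2) k2 \<kappa> unfolding power2_eq_square by linarith
    qed (use c in simp)
    also have "\<dots> = (\<kappa> / 2) * (4 * \<kappa> * (c + 1))" by (simp add: power2_eq_square)
    also have "\<dots> \<le> (\<kappa> - 1) * (4 * \<kappa> * (c + 1))" using \<kappa> c by (intro mult_right_mono) auto
    finally have "(\<kappa> - 1) * (l - \<kappa> - 1) \<le> (\<kappa> - 1) * (X + 1 + 4 * \<kappa> * (c + 1))"
      by (simp add: algebra_simps)
    then have "l - \<kappa> - 1 \<le> X + 1 + 4 * \<kappa> * (c + 1)" using \<kappa> by simp
    then show ?thesis using \<kappa> by (simp add: c2_def algebra_simps)
  qed
  have "ln (\<kappa> + l + 2) \<le> ln ((c2 + 4) * \<kappa> ^ 2)"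
  proof (rule ln_mono)
    have "c2 * (\<kappa> * 1) \<le> c2 * (\<kappa> * \<kappa>)" using c2 \<kappa> by (intro mult_left_mono) auto
    then have "\<kappa> + l + 2 \<le> c2 * (\<kappa> * \<kappa>) + 4 * (\<kappa> * \<kappa>)"
      using l_le X(2) k2 \<kappa> unfolding power2_eq_square by linarith
    then show "\<kappa> + l + 2 \<le> (c2 + 4) * \<kappa> ^ 2" by (simp add: algebra_simps power2_eq_square)
  qed (use l \<kappa> c2 in auto)
  also have "\<dots> = ln (c2 + 4) + 2 * ln \<kappa>" using c2 \<kappa> by (simp add: ln_mult ln_realpow)
  also have "\<dots> \<le> ln (c2 + 4) + 2 * \<kappa>" using ln_le_minus_one[of \<kappa>] \<kappa> by simp
  finally have ln_le: "ln (\<kappa> + l + 2) \<le> ln (c2 + 4) + 2 * \<kappa>" .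
  have "d + \<kappa> + l + 1 + ln (\<kappa> + l + 2) \<le> X + c3 * \<kappa>"
  proof -
    have "(d + 1 + ln (c2 + 4)) * 1 \<le> (d + 1 + ln (c2 + 4)) * \<kappa>"
      using d c2 \<kappa> by (intro mult_left_mono) auto
    then show ?thesis using l_le ln_le unfolding c3_def by (simp add: algebra_simps)
  qed
  then have "(\<kappa> + 1) * (d + \<kappa> + l + 1 + ln (\<kappa> + l + 2)) \<le> (\<kappa> + 1) * (X + c3 * \<kappa>)"
    using \<kappa> by (intro mult_left_mono) auto
  with 2 have "(\<kappa> - 6) * (L - 1) \<le> 7 * X + c3 * (\<kappa> * \<kappa> + \<kappa>)"
    by (simp add: algebra_simps)
  also have "\<dots> \<le> 7 * (\<kappa> * \<kappa>) + c3 * (2 * (\<kappa> * \<kappa>))"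
    using X c3 k2 \<kappa> by (intro add_mono mult_left_mono) (auto simp: power2_eq_square)
  finally have *: "(\<kappa> - 6) * (L - 1) \<le> (7 + 2 * c3) * \<kappa> * \<kappa>" by (simp add: algebra_simps)
  have "L - 1 \<le> (14 + 4 * c3) * \<kappa>"
  proof (rule ccontr)
    assume "\<not> ?thesis"
    then have "(14 + 4 * c3) * \<kappa> < L - 1" by simp
    then have "(\<kappa> - 6) * ((14 + 4 * c3) * \<kappa>) < (\<kappa> - 6) * (L - 1)" using \<kappa> by simp
    moreover have "(\<kappa> / 2) * ((14 + 4 * c3) * \<kappa>) \<le> (\<kappa> - 6) * ((14 + 4 * c3) * \<kappa>)"
      using \<kappa> c3 by (intro mult_right_mono) auto
    ultimately show False using * by (simp add: algebra_simps)
  qed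
  then have "L \<le> (15 + 4 * c3) * \<kappa>" using \<kappa> by (simp add: algebra_simps)
  also have "\<dots> \<le> (4 * (d + 4 * c + 10 + ln (4 * c + 10)) + 32) * \<kappa>"
    using \<kappa> unfolding c3_def c2_def by (intro mult_right_mono) (simp_all add: algebra_simps)
  finally show ?thesis .
qed

lemma nth_prime_superlinear: "\<exists>n\<ge>1. j * n \<le> nth_prime n"
proof -
  define n where "n = nat \<lceil>exp (2 * real j + 1)\<rceil>"
  have n: "exp (2 * real j + 1) \<le> real n" unfolding n_def by (rule real_nat_ceiling_ge)
  have "real n > 0" using n exp_gt_zero[of "2 * real j + 1"] by linarith
  then have n1: "n \<ge> 1" by simp
  have "2 * real j + 1 \<le> ln (real n)" using n \<open>real n > 0\<close> by (simp add: ln_ge_iff)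
  then have "real n * (2 * real j) \<le> real n * (ln (real n) - 1)" by (intro mult_left_mono) auto
  also have "\<dots> \<le> real (nth_prime n) * ln 4" using nth_prime_lower[OF n1] by (simp add: algebra_simps)
  also have "\<dots> \<le> real (nth_prime n) * 2" using ln_4_le_2 by (intro mult_left_mono) auto
  finally have "real (j * n) \<le> real (nth_prime n)" by (simp add: mult.commute)
  then have "j * n \<le> nth_prime n" by (rule of_nat_le_iff[THEN iffD1])
  with n1 show ?thesis by blast
qed


text \<open>Multiplies n / n0 \<le> u / v by n' / n \<le> (u + 1) / u without dividing.\<close>

lemma ratio_chain:
  fixes u v n n' n0 :: nat
  assumes "u > 0" "v * n \<le> u * n0" "u * n' \<le> (u + 1) * n"
  shows "v * n' \<le> (u + 1) * n0"
proof -
  have "u * (v * n') = v * (u * n')" by (rule mult.left_commute)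
  also have "\<dots> \<le> v * ((u + 1) * n)" by (rule mult_le_mono2[OF assms(3)])
  also have "\<dots> = (u + 1) * (v * n)" by (rule mult.left_commute)
  also have "\<dots> \<le> (u + 1) * (u * n0)" by (rule mult_le_mono2[OF assms(2)])
  also have "\<dots> = u * ((u + 1) * n0)" by (rule mult.left_commute)
  finally have "u * (v * n') \<le> u * ((u + 1) * n0)" .
  then show ?thesis using assms(1) by (rule mult_left_le_imp_le)
qed

text \<open>Suppose that \<open>j\<close> in \<open>[X, X + L]\<close> never has a window. Then the quotients never descend through such a
  level \<open>j\<close>, since a descent is slow and leaves a window behind. The first indices \<open>N j\<close> at which the
  quotient reaches \<open>j\<close> satisfy \<open>N (j + 1) / N j \<le> (j + 1) / j\<close>, because \<open>[N j, N (j + 1))\<close> would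
  otherwise be a window. Hence the quotient rises from \<open>X\<close> to \<open>X + L\<close> while the index at most doubles, and
  Mertens' theorem on both sides of this rise bounds \<open>L\<close> by a multiple of \<open>sqrt X\<close>.\<close>

theorem window_exists:
  obtains C :: real and X0 :: nat where "C \<ge> 1"
    "\<And>X. X \<ge> X0 \<Longrightarrow> \<exists>j a w. X \<le> j \<and> real (j - X) \<le> C * sqrt (real X) \<and> 1 \<le> a \<and>
       a \<le> j * (w + 1) \<and> window j a w \<and> real j \<le> C * (1 + ln (real a))"
proof -
  obtain C0 :: real where C0: "C0 \<ge> 1"
    and upper: "\<And>n. n \<ge> 1 \<Longrightarrow> real (nth_prime n) \<le> C0 * real n * (1 + ln (real n))"
    using nth_prime_upper by blast
  define c where "c = ln (16 * C0) + 6"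
  define c' where "c' = 4 * (ln C0 + 4 * c + 10 + ln (4 * c + 10)) + 32"
  define C where "C = 2 * c' + 5 + C0"
  have c: "c \<ge> 0" using C0 by (simp add: c_def)
  have lC0: "ln C0 \<ge> 0" using C0 by simp
  have c': "c' \<ge> 1" using c lC0 by (simp add: c'_def)
  \<comment> \<open>By Chebyshev's upper bound a quotient j cannot be reached before an index
    exponential in j. This later makes the windows exponentially long.\<close>
  have slow: "real j \<le> C * (1 + ln (real a))" if "1 \<le> m" "m \<le> a" "j * m \<le> nth_prime m" for j m a
  proof -
    have "real (j * m) \<le> real (nth_prime m)" using that(3) by (rule of_nat_mono)
    also have "\<dots> \<le> C0 * real m * (1 + ln (real m))" by (rule upper[OF that(1)])
    finally have "real j * real m \<le> (C0 * (1 + ln (real m))) * real m" by (simp add: mult_ac)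
    then have "real j \<le> C0 * (1 + ln (real m))" using that(1) by simp
    also have "\<dots> \<le> C * (1 + ln (real a))"
      using that C0 c' by (intro mult_mono add_left_mono ln_mono) (auto simp: C_def)
    finally show ?thesis .
  qed
  have "\<exists>j a w. X \<le> j \<and> real (j - X) \<le> C * sqrt (real X) \<and> 1 \<le> a \<and>
       a \<le> j * (w + 1) \<and> window j a w \<and> real j \<le> C * (1 + ln (real a))"
    if X0: "sqrt (real X) \<ge> 12 * C" for X
  proof (rule ccontr)
    assume neg: "\<not> ?thesis"
    have none: False if "X \<le> j" "real (j - X) \<le> C * sqrt (real X)" "1 \<le> a"
       "a \<le> j * (w + 1)" "window j a w" "1 \<le> m" "m \<le> a" "j * m \<le> nth_prime m" for j a w m
      using neg that slow[of m a j] by blast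
    define s where "s = sqrt (real X)"
    have s: "s \<ge> 12 * C" "s * s = real X" using X0 by (simp_all add: s_def)
    have C17: "C \<ge> 8" using c' C0 by (simp add: C_def)
    have s96: "s \<ge> 96" using s C17 by simp
    \<comment> \<open>This makes \<kappa> = ln K agree with sqrt X up to 1, the balanced block
      length.\<close>
    define K where "K = nat \<lceil>exp s\<rceil>"
    define \<kappa> where "\<kappa> = ln (real K)"
    have K: "exp s \<le> real K" "real K \<le> exp s + 1"
      unfolding K_def using real_nat_ceiling_ge[of "exp s"] of_nat_ceiling[of "exp s"] 
      by (auto simp: of_nat_nat intro!: order.strict_implies_order ceiling_less_iff)
    have K1: "K \<ge> 1" using K(1) exp_gt_zero[of s] by linarith
    have \<kappa>1: "s \<le> \<kappa>"
      unfolding \<kappa>_def using K(1) K1 by (subst ln_ge_iff) auto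
    have \<kappa>2: "\<kappa> \<le> s + 1"
    proof -
      have "1 \<le> exp s" using s96 by simp
      then have "real K \<le> 2 * exp s" using K(2) by linarith
      also have "\<dots> \<le> exp 1 * exp s" using exp_ge_add_one_self[of 1] by (intro mult_right_mono) auto
      also have "\<dots> = exp (s + 1)" by (simp add: exp_add)
      finally have "ln (real K) \<le> ln (exp (s + 1))" using K1 by (intro ln_mono) auto
      then show ?thesis by (simp add: \<kappa>_def)
    qed
    \<comment> \<open>\<open>density_estimate\<close> will bound L by \<open>c' * \<kappa>\<close>;
      the added 2 contradicts it.\<close>
    define L where "L = nat \<lceil>c' * \<kappa>\<rceil> + 2"
    have "c' * \<kappa> \<ge> 0" using c' \<kappa>1 s96 by simp
    then have L: "c' * \<kappa> + 2 \<le> real L" "real L \<le> c' * \<kappa> + 3"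
      unfolding L_def by linarith+
    have L_le: "real L \<le> C * s"
    proof -
      have "c' * \<kappa> \<le> c' * (s + 1)" using \<kappa>2 c' by (intro mult_left_mono) auto
      moreover have "(c' + 3) * 1 \<le> (c' + 3) * s" using c' s96 by (intro mult_left_mono) auto
      moreover have "(2 * c' + 3) * s \<le> C * s" using C0 s96 by (intro mult_right_mono) (auto simp: C_def)
      ultimately show ?thesis using L(2) by (simp add: algebra_simps)
    qed
    have sX: "12 * C * s \<le> real X"
      using s mult_right_mono[OF s(1), of s] s96 by simp
    have "real L \<le> real X" using L_le sX mult_nonneg_nonneg[of C s] C17 s96 by linarith
    then have LX: "L \<le> X" by simp
    have L2: "L \<ge> 2" by (simp add: L_def)
    have X96: "X \<ge> 96"
    proof -
      have "96 * 96 \<le> s * s" using s96 by (intro mult_mono) auto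
      then show ?thesis using s(2) by simp
    qed
    have none': False if "X \<le> j" "j \<le> X + L" "1 \<le> a"
       "a \<le> j * (w + 1)" "window j a w" "1 \<le> m" "m \<le> a" "j * m \<le> nth_prime m" for j m a w
    proof (rule none[of j a w m])
      have "real (j - X) \<le> real L" using that(1,2) by simp
      with L_le show "real (j - X) \<le> C * sqrt (real X)" by (simp add: s_def)
    qed (use that in auto)
    have no_descent: "j * m2 \<le> nth_prime m2"
      if "X \<le> j" "j \<le> X + L" "1 \<le> m1" "m1 < m2" "(j + 1) * m1 \<le> nth_prime m1" for j m1 m2
    proof (rule ccontr)
      assume "\<not> ?thesis"
      then have "nth_prime m2 < j * m2" by simp
      from window_of_descent[OF that(3-5) this] obtain a w m where
        "a \<le> j * (w + 1)" "window j a w" "m1 < a" "1 \<le> m" "m \<le> a" "j * m \<le> nth_prime m"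
        by metis
      with none'[of j a w m] that show False by simp
    qed
    define N where "N j = (LEAST n. 1 \<le> n \<and> j * n \<le> nth_prime n)" for j
    have N: "1 \<le> N j" "j * N j \<le> nth_prime (N j)" for j
      using LeastI_ex[of "\<lambda>n. 1 \<le> n \<and> j * n \<le> nth_prime n"] nth_prime_superlinear[of j]
      unfolding N_def by auto
    have N_min: "nth_prime m < j * m" if "1 \<le> m" "m < N j" for j m
      using not_less_Least[of m "\<lambda>n. 1 \<le> n \<and> j * n \<le> nth_prime n"] that unfolding N_def by auto
    have N_above: "j * m \<le> nth_prime m" if "X \<le> j" "j \<le> X + L" "N (j + 1) \<le> m" for j m
    proof (cases "m = N (j + 1)")
      case True
      then show ?thesis using N(2)[of "j + 1"] by simp
    next
      case False
      with that no_descent[of j "N (j + 1)" m] N[of "j + 1"] show ?thesis by simp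
    qed
    \<comment> \<open>On [N j, N (j + 1)) the quotient is at most j by minimality, and at least j -
      1 because a descent through level j - 1 after N j is excluded. If the ratio were too large,
      this would be a window for j.\<close>
    have N_step: "j * N (j + 1) \<le> (j + 1) * N j" if j: "X + 1 \<le> j" "j \<le> X + L" for j
    proof (rule ccontr)
      assume neg: "\<not> ?thesis"
      define w where "w = N (j + 1) - N j"
      show False
      proof (rule none'[of j "N j" w "N j"])
        have "j * N j + N j < j * N (j + 1)" using neg by simp
        then have "N j \<le> j * w" unfolding w_def diff_mult_distrib2 by linarith
        then show "N j \<le> j * (w + 1)" by simp
        show "window j (N j) w"
          unfolding window_def
        proof (intro ballI conjI)
          fix m assume "m \<in> {N j..<N j + w}"
          then have m: "N j \<le> m" "m < N (j + 1)" by (auto simp: w_def)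
          have "1 \<le> m" using m(1) N(1)[of j] by linarith
          then show "nth_prime m < (j + 1) * m" using m(2) by (rule N_min)
          show "(j - 1) * m \<le> nth_prime m"
            using N_above[of "j - 1" m] m j by simp
        qed
      qed (use j N in auto)
    qed
    have N_tele: "(X + 1) * N (X + 1 + i) \<le> (X + 1 + i) * N (X + 1)" if "i < L" for i
      using that
    proof (induction i)
      case (Suc i)
      have step: "(X + 1 + i) * N (X + 1 + i + 1) \<le> (X + 1 + i + 1) * N (X + 1 + i)"
        using Suc.prems by (intro N_step) auto
      have IH: "(X + 1) * N (X + 1 + i) \<le> (X + 1 + i) * N (X + 1)"
        by (rule Suc.IH) (use Suc.prems in simp)
      have "(X + 1) * N (X + 1 + i + 1) \<le> (X + 1 + i + 1) * N (X + 1)"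
        by (rule ratio_chain[OF _ IH step]) simp
      moreover have "X + 1 + Suc i = X + 1 + i + 1" by simp
      ultimately show ?case by (simp only:)
    qed (simp only: add_0_right le_refl)
    define A where "A = N (X + 1)"
    define B where "B = N (X + L)"
    have BA: "B \<le> 2 * A"
    proof -
      have "(X + 1) * B \<le> (X + L) * A"
        using N_tele[of "L - 1"] L2 by (simp add: A_def B_def)
      also have "\<dots> \<le> (2 * (X + 1)) * A" using LX by (intro mult_right_mono) auto
      finally have "(X + 1) * B \<le> (X + 1) * (2 * A)" by (simp only: mult_ac)
      then show ?thesis by (simp only: mult_le_cancel1)
    qed
    have A1: "A \<ge> 1" and A2: "(X + 1) * A \<le> nth_prime A" unfolding A_def using N[of "X + 1"] by (simp_all only:)
    have B2: "B \<ge> 2"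
    proof (rule ccontr)
      assume "\<not> ?thesis"
      moreover have "B \<ge> 1" unfolding B_def using N by auto
      ultimately have "B = 1" by simp
      then have "(X + L) * 1 \<le> nth_prime 1" using N(2)[of "X + L"] unfolding B_def by (simp only:)
      then have "real (X + L) \<le> C * (1 + ln (real 1))" by (rule slow[OF order_refl order_refl])
      moreover have "C * 1 \<le> C * (12 * s)" using C17 s96 by (intro mult_left_mono) auto
      ultimately show False using sX L2 by simp
    qed
    define l where "l = ln (real A)"
    have l0: "l \<ge> 0" using A1 by (simp add: l_def)
    have lX: "real (X + 1) \<le> C * (1 + l)"
      unfolding l_def by (rule slow[of A]) (use A1 A2 in auto)
    have large: "2 * \<kappa> + 6 \<le> l"
    proof -
      have "C * (12 * s) \<le> C * (1 + l)" using lX sX by (simp add: mult_ac)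
      then have "12 * s \<le> 1 + l" using C17 by simp
      then show ?thesis using \<kappa>2 s96 by linarith
    qed
    \<comment> \<open>The rise is met from both sides: before A the quotients are bounded by X + 1,
      from B on they are at least X + L - 1, and \<open>B \<le> 2 * A\<close> expresses both bounds
      through l = ln A.\<close>
    have 1: "(\<kappa> - 1) * (l - \<kappa> - 1) \<le> (real X + 1) * (\<kappa> + c)"
      unfolding l_def c_def
    proof (rule dense_below[OF C0 upper K1 \<kappa>_def[symmetric] _ A1])
      show "(real X + 1) * real A \<le> real (nth_prime A)"
        using of_nat_mono[OF A2, where 'a = real] by (simp add: algebra_simps)
      show "real (nth_prime m) \<le> (real X + 1) * real m" if "1 \<le> m" "m < A" for m
        using of_nat_mono[OF less_imp_le[OF N_min[of m "X + 1"]], where 'a = real] that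
        by (simp add: A_def algebra_simps)
    qed (use large \<kappa>1 s96 in \<open>auto simp: l_def\<close>)
    have "(\<kappa> - 6) * real (X + L - 1) \<le> (\<kappa> + 1) * ln (real (nth_prime (K * B)))"
    proof (rule sparse_above[OF K1 \<kappa>_def[symmetric] _ B2])
      show "1 \<le> real (X + L - 1)" using X96 by simp
      show "real (X + L - 1) * real m \<le> real (nth_prime m)" if "B \<le> m" for m
        using of_nat_mono[OF N_above[of "X + L - 1" m], where 'a = real] that L2 by (simp add: B_def)
      have "nth_prime (B - 1) < (X + L) * (B - 1)" using B2 unfolding B_def by (intro N_min) auto
      then have "real (nth_prime (B - 1)) \<le> real ((X + L) * (B - 1))" by (intro of_nat_mono) auto
      then show "real (nth_prime (B - 1)) \<le> (real (X + L - 1) + 1) * real (B - 1)"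
        using L2 by (simp add: of_nat_diff)
    qed
    also have "ln (real (nth_prime (K * B))) \<le> ln C0 + \<kappa> + l + 1 + ln (\<kappa> + l + 2)"
    proof -
      have "ln (real B) \<le> ln (2 * real A)" using BA B2 by (intro ln_mono) auto
      also have "\<dots> \<le> l + 1" using A1 ln_2_le_1 by (simp add: l_def ln_mult)
      finally have lKB: "ln (real (K * B)) \<le> \<kappa> + l + 1"
        using K1 B2 by (simp add: ln_mult \<kappa>_def)
      have "1 * 1 \<le> K * B" using K1 B2 by (intro mult_le_mono) auto
      then have "real (1 * 1) \<le> real (K * B)" by (rule of_nat_mono)
      then have "1 \<le> real (K * B)" by (simp only: mult_1 of_nat_1)
      then have lKB0: "ln (real (K * B)) \<ge> 0" by (rule ln_ge_zero)
      then have "1 + ln (real (K * B)) > 0" by linarith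
      have "ln (real (nth_prime (K * B))) \<le> ln (C0 * real (K * B) * (1 + ln (real (K * B))))"
        using K1 B2 by (intro ln_mono upper) auto
      also have "\<dots> = ln C0 + ln (real (K * B)) + ln (1 + ln (real (K * B)))"
        using C0 \<open>1 \<le> real (K * B)\<close> \<open>1 + ln (real (K * B)) > 0\<close>
        by (simp add: ln_mult_pos del: of_nat_mult)
      also have "ln (1 + ln (real (K * B))) \<le> ln (\<kappa> + l + 2)"
        using lKB lKB0 by (intro ln_mono) auto
      finally show ?thesis using lKB by linarith
    qed
    then have "(\<kappa> + 1) * ln (real (nth_prime (K * B))) \<le> (\<kappa> + 1) * (ln C0 + \<kappa> + l + 1 + ln (\<kappa> + l + 2))"
      using \<kappa>1 s96 by (intro mult_left_mono) auto
    finally have 2: "(\<kappa> - 6) * (real X + real L - 1) \<le> (\<kappa> + 1) * (ln C0 + \<kappa> + l + 1 + ln (\<kappa> + l + 2))"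
      using L2 by (simp add: of_nat_diff)
    have "real L \<le> c' * \<kappa>"
      unfolding c'_def
    proof (rule density_estimate[OF _ _ _ c lC0 l0 1 2])
      have "s * s \<le> \<kappa> * \<kappa>" using \<kappa>1 s96 by (intro mult_mono) auto
      then show "real X \<le> \<kappa>\<^sup>2" using s(2) by (simp add: power2_eq_square)
    qed (use \<kappa>1 s96 in auto)
    then show False using L(1) by simp
  qed
  note * = this
  show ?thesis
  proof (rule that[of C "nat \<lceil>(12 * C)\<^sup>2\<rceil>"])
    show "C \<ge> 1" using c' C0 by (simp add: C_def)
    fix X assume "nat \<lceil>(12 * C)\<^sup>2\<rceil> \<le> X"
    then have "(12 * C)\<^sup>2 \<le> real X" by linarith
    then have "12 * C \<le> sqrt (real X)" by (rule real_le_rsqrt)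
    from *[OF this] show "\<exists>j a w. X \<le> j \<and> real (j - X) \<le> C * sqrt (real X) \<and> 1 \<le> a \<and>
       a \<le> j * (w + 1) \<and> window j a w \<and> real j \<le> C * (1 + ln (real a))" .
  qed
qed

section \<open>Multiplication from quotients of primes\<close>

abbreviation quot :: "nat \<Rightarrow> nat" where
  "quot n \<equiv> nth_prime n div n"

text \<open>The equation says that \<open>n * quot n\<close> grows by \<open>y\<close> from \<open>m\<close> to \<open>m + t\<close>, with the remainders moved
  so that no subtraction occurs. The bound on the iterated prime is an additive certificate for
  \<open>t * quot m < m\<close>, which excludes that \<open>quot\<close> changes between the two points.\<close>

definition same_quot :: "nat \<Rightarrow> nat \<Rightarrow> nat \<Rightarrow> nat \<Rightarrow> bool" where
  "same_quot m0 m t y \<longleftrightarrow> m0 \<le> m \<and> 1 \<le> m \<and> nth_prime (nth_prime t) \<le> m \<and> y < m \<and>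
    nth_prime (m + t) + nth_prime m mod m = nth_prime m + nth_prime (m + t) mod (m + t) + y"

lemma quot_le_ln:
  obtains C :: real where "C \<ge> 1" "\<And>m. m \<ge> 1 \<Longrightarrow> real (quot m) \<le> C * (1 + ln (real m))"
proof -
  obtain C :: real where C: "C \<ge> 1"
    and upper: "\<And>n. n \<ge> 1 \<Longrightarrow> real (nth_prime n) \<le> C * real n * (1 + ln (real n))"
    using nth_prime_upper by blast
  show ?thesis
  proof (rule that[OF C])
    fix m :: nat assume m: "m \<ge> 1"
    have "real (quot m) \<le> real (nth_prime m) / real m" by (rule of_nat_div_le_of_nat)
    also have "\<dots> \<le> C * (1 + ln (real m))"
      using upper[OF m] m by (simp add: divide_le_eq mult_ac)
    finally show "real (quot m) \<le> C * (1 + ln (real m))" .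
  qed
qed

text \<open>If t \<le> sqrt m the claim is clear, as the quotient is O(ln m). Otherwise two
  applications of Chebyshev's lower bound give t = O(m / (ln m)^2). A single prime would only yield
  t = O(m / ln m), which the factor ln m of the quotient consumes; hence the iterated prime.\<close>

lemma quot_mult_less:
  obtains m0 :: nat where "\<And>m t. m \<ge> m0 \<Longrightarrow> nth_prime (nth_prime t) \<le> m \<Longrightarrow> quot m * t < m"
proof -
  obtain C :: real where C: "C \<ge> 1"
    and quot: "\<And>m. m \<ge> 1 \<Longrightarrow> real (quot m) \<le> C * (1 + ln (real m))"
    using quot_le_ln by blast
  have "eventually (\<lambda>x::real. C * (1 + ln x) * sqrt x < x) at_top"
    using C by real_asymp
  moreover have "eventually (\<lambda>x::real. C * (1 + ln x) * (64 * x / (ln x)\<^sup>2) < x) at_top"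
    using C by real_asymp
  moreover have "eventually (\<lambda>x::real. ln x \<ge> 4) at_top"
    by real_asymp
  moreover have "eventually (\<lambda>x::real. x \<ge> 1) at_top"
    by real_asymp
  ultimately have "eventually (\<lambda>x::real. C * (1 + ln x) * sqrt x < x \<and>
    C * (1 + ln x) * (64 * x / (ln x)\<^sup>2) < x \<and> ln x \<ge> 4 \<and> x \<ge> 1) at_top"
    by eventually_elim blast
  then obtain x0 where x0: "\<And>x. x \<ge> x0 \<Longrightarrow> C * (1 + ln x) * sqrt x < x \<and>
    C * (1 + ln x) * (64 * x / (ln x)\<^sup>2) < x \<and> ln x \<ge> 4 \<and> x \<ge> 1"
    unfolding eventually_at_top_linorder by blast
  show ?thesis
  proof (rule that[of "nat \<lceil>x0\<rceil>"])
    fix m t assume m: "nat \<lceil>x0\<rceil> \<le> m" and t: "nth_prime (nth_prime t) \<le> m"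
    define L where "L = ln (real m)"
    have "x0 \<le> real m" using m by linarith
    from x0[OF this] have small: "C * (1 + L) * sqrt (real m) < real m"
      "C * (1 + L) * (64 * real m / L\<^sup>2) < real m" and L4: "L \<ge> 4" and m1: "m \<ge> 1"
      by (auto simp: L_def)
    have "real (quot m * t) \<le> C * (1 + L) * real t"
      using quot[OF m1] by (simp add: L_def mult_right_mono)
    also have "\<dots> < real m"
    proof (cases "real t \<le> sqrt (real m)")
      case True
      then have "C * (1 + L) * real t \<le> C * (1 + L) * sqrt (real m)"
        using C L4 by (intro mult_left_mono) auto
      then show ?thesis using small(1) by linarith
    next
      case False
      then have "ln (sqrt (real m)) \<le> ln (real t)" using m1 by (intro ln_mono) auto
      then have lt: "ln (real t) \<ge> L / 2" using m1 by (simp add: ln_sqrt L_def)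
      have lower: "real n * (L / 8) \<le> real (nth_prime n)" if "ln (real n) \<ge> L / 2" "n \<ge> 1" for n
      proof -
        have "real n * (L / 4) \<le> real n * (ln (real n) - 1)"
          using that L4 by (intro mult_left_mono) auto
        also have "\<dots> \<le> real (nth_prime n) * ln 4"
          using nth_prime_lower[OF that(2)] by (simp add: algebra_simps)
        also have "\<dots> \<le> real (nth_prime n) * 2" using ln_4_le_2 by (intro mult_left_mono) auto
        finally show ?thesis by simp
      qed
      have t1: "t \<ge> 1" using False m1 by (cases t) auto
      have "ln (real t) \<le> ln (real (nth_prime t))"
        using t1 nth_prime_ge[of t] by (intro ln_mono) auto
      then have "real (nth_prime t) * (L / 8) \<le> real (nth_prime (nth_prime t))"
        using lt by (intro lower) auto
      moreover have "real t * (L / 8) * (L / 8) \<le> real (nth_prime t) * (L / 8)"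
        using lower[OF lt t1] L4 by (intro mult_right_mono) auto
      moreover have "real (nth_prime (nth_prime t)) \<le> real m" using t by simp
      ultimately have "real t * (L / 8) * (L / 8) \<le> real m" by linarith
      then have "real t * L\<^sup>2 \<le> 64 * real m" by (simp add: power2_eq_square)
      then have "real t \<le> 64 * real m / L\<^sup>2" using L4 by (simp add: le_divide_eq)
      then have "C * (1 + L) * real t \<le> C * (1 + L) * (64 * real m / L\<^sup>2)"
        using C L4 by (intro mult_left_mono) auto
      then show ?thesis using small(2) by linarith
    qed
    finally show "quot m * t < m" by (rule of_nat_less_imp_less)
  qed
qed

text \<open>A larger quotient at m + t would increase n * quot n by at least m > y. A smaller one
  would decrease it, because \<open>quot m * t < m\<close>.\<close>

lemma same_quot_sound:
  assumes "\<And>m t. m \<ge> m0 \<Longrightarrow> nth_prime (nth_prime t) \<le> m \<Longrightarrow> quot m * t < m"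
    and "same_quot m0 m t y"
  shows "y = t * quot m"
proof -
  define f f' where "f = quot m" and "f' = quot (m + t)"
  have m: "m0 \<le> m" "1 \<le> m" "nth_prime (nth_prime t) \<le> m" "y < m"
    and eq: "nth_prime (m + t) + nth_prime m mod m = nth_prime m + nth_prime (m + t) mod (m + t) + y"
    using assms(2) unfolding same_quot_def by auto
  have ft: "f * t < m" unfolding f_def using m by (intro assms(1)) auto
  have 1: "nth_prime m = f * m + nth_prime m mod m"
    unfolding f_def by (rule div_mult_mod_eq[symmetric])
  have 2: "nth_prime (m + t) = f' * (m + t) + nth_prime (m + t) mod (m + t)"
    unfolding f'_def by (rule div_mult_mod_eq[symmetric])
  have eq': "f' * (m + t) = f * m + y"
    using eq 1 2 by linarith
  have "f' = f"
  proof (rule ccontr)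
    assume "f' \<noteq> f"
    then consider "f + 1 \<le> f'" | "f' + 1 \<le> f" by linarith
    then show False
    proof cases
      case 1
      then have "(f + 1) * (m + t) \<le> f' * (m + t)" by (rule mult_le_mono1)
      moreover have "(f + 1) * (m + t) \<ge> f * m + m" by (simp add: algebra_simps)
      ultimately show False using eq' m(4) by linarith
    next
      case 2
      then have "(f' + 1) * (m + t) \<le> f * (m + t)" by (rule mult_le_mono1)
      then have "f' * (m + t) + m \<le> f * m + f * t" by (simp add: algebra_simps)
      then show False using eq' ft by linarith
    qed
  qed
  with eq' show ?thesis unfolding f_def by (simp add: algebra_simps)
qed

lemma same_quotI:
  assumes "m0 \<le> m" "1 \<le> m" "nth_prime (nth_prime t) \<le> m" "t * k < m" "quot m = k" "quot (m + t) = k"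
  shows "same_quot m0 m t (t * k)"
proof -
  have "nth_prime m = k * m + nth_prime m mod m"
    using div_mult_mod_eq[of "nth_prime m" m] assms(5) by simp
  moreover have "nth_prime (m + t) = k * (m + t) + nth_prime (m + t) mod (m + t)"
    using div_mult_mod_eq[of "nth_prime (m + t)" "m + t"] assms(6) by simp
  ultimately have "nth_prime (m + t) + nth_prime m mod m = nth_prime m + nth_prime (m + t) mod (m + t) + t * k"
    by (simp add: algebra_simps)
  then show ?thesis unfolding same_quot_def using assms by simp
qed

text \<open>With two colours, each line of five points has at most two points without a later point
  of the same colour. Rows and columns together exclude at most 10 + 10 of the 25 points.\<close>

lemma grid_coloring:
  fixes col :: "nat \<Rightarrow> nat \<Rightarrow> bool"
  obtains u v b c where "1 \<le> b" "u + b \<le> 4" "1 \<le> c" "v + c \<le> 4"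
    "col (u + b) v = col u v" "col u (v + c) = col u v"
proof -
  have bad: "card {u. u \<le> 4 \<and> (\<forall>b\<ge>1. u + b \<le> 4 \<longrightarrow> f (u + b) \<noteq> f u)} \<le> 2" for f :: "nat \<Rightarrow> bool"
  proof -
    let ?S = "{u. u \<le> 4 \<and> (\<forall>b\<ge>1. u + b \<le> 4 \<longrightarrow> f (u + b) \<noteq> f u)}"
    have "inj_on f ?S"
    proof (rule linorder_inj_onI)
      fix x y assume "x < y" "x \<in> ?S" "y \<in> ?S"
      then have "1 \<le> y - x" "x + (y - x) \<le> 4" "x + (y - x) = y" by auto
      with \<open>x \<in> ?S\<close> show "f x \<noteq> f y" by (metis (mono_tags, lifting) mem_Collect_eq)
    qed auto
    then have "card ?S \<le> card (UNIV :: bool set)" by (intro card_inj_on_le) auto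
    then show ?thesis by (simp add: card_UNIV_bool)
  qed
  let ?U = "\<lambda>v. {u. u \<le> 4 \<and> (\<forall>b\<ge>1. u + b \<le> 4 \<longrightarrow> col (u + b) v \<noteq> col u v)}"
  let ?V = "\<lambda>u. {v. v \<le> 4 \<and> (\<forall>c\<ge>1. v + c \<le> 4 \<longrightarrow> col u (v + c) \<noteq> col u v)}"
  let ?A = "SIGMA v:{..4::nat}. ?U v" and ?B = "SIGMA u:{..4::nat}. ?V u"
  have "card ?A = (\<Sum>v\<le>4. card (?U v))" by (rule card_SigmaI) auto
  also have "\<dots> \<le> (\<Sum>v\<le>(4::nat). 2)" by (intro sum_mono bad)
  finally have A: "card ?A \<le> 10" by simp
  have "card ?B = (\<Sum>u\<le>4. card (?V u))" by (rule card_SigmaI) auto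
  also have "\<dots> \<le> (\<Sum>u\<le>(4::nat). 2)" by (intro sum_mono bad)
  finally have B: "card ?B \<le> 10" by simp
  have "\<not> {..4::nat} \<times> {..4::nat} \<subseteq> prod.swap ` ?A \<union> ?B"
  proof
    assume sub: "{..4::nat} \<times> {..4::nat} \<subseteq> prod.swap ` ?A \<union> ?B"
    have fin: "finite ?A" "finite ?B" by (auto intro!: finite_SigmaI)
    have "card ({..4::nat} \<times> {..4::nat}) \<le> card (prod.swap ` ?A \<union> ?B)"
      using sub fin by (intro card_mono) auto
    also have "\<dots> \<le> card (prod.swap ` ?A) + card ?B" by (rule card_Un_le)
    also have "\<dots> \<le> card ?A + card ?B" using fin by (intro add_right_mono card_image_le)
    finally show False using A B by (simp add: card_cartesian_product)
  qed
  then obtain q where q: "q \<in> {..4::nat} \<times> {..4::nat}" "q \<notin> prod.swap ` ?A" "q \<notin> ?B" by blast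
  obtain u v where uv: "q = (u, v)" by (cases q)
  have u: "u \<le> 4" and v: "v \<le> 4" using q(1) uv by auto
  have "u \<notin> ?U v"
  proof
    assume "u \<in> ?U v"
    with v have "(v, u) \<in> ?A" by blast
    then have "prod.swap (v, u) \<in> prod.swap ` ?A" by (rule imageI)
    moreover have "prod.swap (v, u) = q" using uv by simp
    ultimately show False using q(2) by (simp only:)
  qed
  with u obtain b where b: "b \<ge> 1" "u + b \<le> 4" "col (u + b) v = col u v" by blast
  have "v \<notin> ?V u" using q(3) u unfolding uv by blast
  with v obtain c where c: "c \<ge> 1" "v + c \<le> 4" "col u (v + c) = col u v" by blast
  show ?thesis by (rule that[OF b(1,2) c(1,2) b(3) c(3)])
qed

text \<open>In a window two quotients \<open>j - 1\<close> and \<open>j\<close> occur. By the colouring lemma some point \<open>m\<close> has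
  the same quotient as \<open>m + b\<close>, which reveals the quotient itself, and as \<open>m + c * x\<close>, which reveals
  its product with \<open>x\<close>.\<close>

definition quot_times :: "nat \<Rightarrow> nat \<Rightarrow> nat \<Rightarrow> nat \<Rightarrow> bool" where
  "quot_times m0 k x y \<longleftrightarrow> (\<exists>m. \<exists>b\<in>{1..4}. \<exists>c\<in>{1..4}.
     same_quot m0 m b (b * k) \<and> same_quot m0 m (c * x) (c * y))"

text \<open>A window for j does not tell whether j or j - 1 is the quotient that gets certified; in
  the second case one more x is added.\<close>

definition weak_times :: "nat \<Rightarrow> nat \<Rightarrow> nat \<Rightarrow> nat \<Rightarrow> bool" where
  "weak_times m0 k x y \<longleftrightarrow> quot_times m0 k x y \<or>
     (\<exists>k' y'. k = k' + 1 \<and> y = y' + x \<and> quot_times m0 k' x y')"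

text \<open>A one-sided version of the graph of \<open>quot\<close>: sound, and satisfied for
  arbitrarily large k, though not by every m. It becomes the relation of roughly exponential
  growth.\<close>

definition has_quot :: "nat \<Rightarrow> nat \<Rightarrow> nat \<Rightarrow> bool" where
  "has_quot m0 m k \<longleftrightarrow> (\<exists>b\<in>{1..4}. same_quot m0 m b (b * k))"

text \<open>With \<open>k = d * z + s\<close> and \<open>s * z < d\<close> the square of \<open>z\<close> is the integer part of \<open>k * z / d\<close>. All
  multiplications have a left factor from the sparse set of numbers whose multiples are available;
  the factor \<open>b \<ge> z\<close> only certifies \<open>s * z < d\<close>.\<close>

definition large_square :: "nat \<Rightarrow> nat \<Rightarrow> nat \<Rightarrow> bool" where
  "large_square m0 z y \<longleftrightarrow> (\<exists>d k b s u v w w'. weak_times m0 d z u \<and> k = u + s \<and> z \<le> b \<and>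
     weak_times m0 b s v \<and> v < d \<and> weak_times m0 k z w \<and> weak_times m0 d y w' \<and> w' \<le> w \<and> w < w' + d)"

locale quot_bound =
  fixes m0 :: nat
  assumes quot_bound: "\<And>m t. m \<ge> m0 \<Longrightarrow> nth_prime (nth_prime t) \<le> m \<Longrightarrow> quot m * t < m"
begin

lemma has_quot_sound:
  assumes "has_quot m0 m k"
  shows "k = quot m"
proof -
  obtain b where b: "b \<in> {1..4}" "same_quot m0 m b (b * k)"
    using assms unfolding has_quot_def by blast
  have "b * k = b * quot m" by (rule same_quot_sound[OF quot_bound b(2)])
  with b(1) show ?thesis by simp
qed

lemma has_quot_pos: "has_quot m0 m k \<Longrightarrow> m \<ge> 1"
  unfolding has_quot_def same_quot_def by auto

lemma quot_times_sound:
  assumes "quot_times m0 k x y"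
  shows "y = k * x"
proof -
  obtain m b c where "b \<in> {1..4}" and c: "c \<in> {1..4}" and 1: "same_quot m0 m b (b * k)"
    and 2: "same_quot m0 m (c * x) (c * y)" using assms unfolding quot_times_def by blast
  then have "k = quot m" by (intro has_quot_sound) (auto simp: has_quot_def)
  moreover have "c * y = c * x * quot m" by (rule same_quot_sound[OF quot_bound 2])
  ultimately show ?thesis using c by simp
qed

lemma weak_times_sound: "weak_times m0 k x y \<Longrightarrow> y = k * x"
  unfolding weak_times_def using quot_times_sound by auto

lemma quot_times_window:
  assumes w: "window j a w" "a \<le> j * (w + 1)" and j: "1 \<le> j" and x: "x \<le> j ^ 10"
    and a: "m0 \<le> a" "1 \<le> a" "nth_prime (nth_prime 4) \<le> a" "nth_prime (nth_prime (4 * j ^ 10)) \<le> a"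
      "4 * j ^ 11 < a" "4 * j < a" "j * (4 * j ^ 10 + 6) < a"
  shows "weak_times m0 j x (j * x)"
proof -
  have "j * (4 * j ^ 10 + 6) < j * (w + 1)" using w(2) a(7) by linarith
  then have wx: "4 * j ^ 10 + 6 < w + 1" by (simp only: mult_less_cancel1)
  have in_w: "u + v * x < w" if "u \<le> 4" "v \<le> 4" for u v
  proof -
    have "u + v * x \<le> 4 + 4 * j ^ 10" using that x by (intro add_mono mult_le_mono) auto
    with wx show ?thesis by linarith
  qed
  have two: "quot m = j - 1 \<or> quot m = j" if "a \<le> m" "m < a + w" for m
  proof -
    have m: "m > 0" using that a by linarith
    have "(j - 1) * m \<le> nth_prime m" "nth_prime m < (j + 1) * m"
      using w(1) that unfolding window_def by auto
    then have "j - 1 \<le> quot m" "quot m < j + 1"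
      using m by (auto simp: less_eq_div_iff_mult_less_eq div_less_iff_less_mult)
    then show ?thesis by linarith
  qed
  \<comment> \<open>The grid consists of the points a + u + v x, coloured by whether the quotient is
    j; the length of the window keeps the whole grid inside it.\<close>
  obtain u v b c where bc: "1 \<le> b" "u + b \<le> 4" "1 \<le> c" "v + c \<le> 4"
    and col: "(quot (a + (u + b) + v * x) = j) = (quot (a + u + v * x) = j)"
      "(quot (a + u + (v + c) * x) = j) = (quot (a + u + v * x) = j)"
    by (rule grid_coloring[of "\<lambda>u v. quot (a + u + v * x) = j"])
  define m where "m = a + u + v * x"
  define k where "k = quot m"
  have m1: "a + (u + b) + v * x = m + b" and m2: "a + u + (v + c) * x = m + c * x"
    by (simp_all add: m_def algebra_simps)
  have col': "(quot (m + b) = j) = (quot m = j)" "(quot (m + c * x) = j) = (quot m = j)"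
    using col unfolding m1 m2 m_def[symmetric] by simp_all
  have k: "k = j - 1 \<or> k = j"
    unfolding k_def by (rule two) (use in_w[of u v] bc in \<open>simp_all add: m_def\<close>)
  have "quot (m + b) = j - 1 \<or> quot (m + b) = j"
    unfolding m1[symmetric] by (rule two) (use in_w[of "u + b" v] bc in simp_all)
  then have k1: "quot (m + b) = k" using col'(1) k unfolding k_def by metis
  have "quot (m + c * x) = j - 1 \<or> quot (m + c * x) = j"
    unfolding m2[symmetric] by (rule two) (use in_w[of u "v + c"] bc in simp_all)
  then have k2: "quot (m + c * x) = k" using col'(2) k unfolding k_def by metis
  have am: "a \<le> m" by (simp add: m_def)
  have kj: "k \<le> j" using k by auto
  have "same_quot m0 m b (b * k)"
  proof (rule same_quotI)
    have "nth_prime (nth_prime b) \<le> nth_prime (nth_prime 4)" using bc by simp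
    with a(3) am show "nth_prime (nth_prime b) \<le> m" by linarith
    have "b * k \<le> 4 * j" using bc kj by (intro mult_le_mono) auto
    with a(6) am show "b * k < m" by linarith
    show "quot m = k" by (rule k_def[symmetric])
    show "quot (m + b) = k" by (rule k1)
  qed (rule order_trans[OF a(1) am] order_trans[OF a(2) am])+
  moreover have "same_quot m0 m (c * x) (c * (k * x))"
  proof -
    have cx: "c * x \<le> 4 * j ^ 10" using bc x by (intro mult_le_mono) auto
    have "same_quot m0 m (c * x) (c * x * k)"
    proof (rule same_quotI)
      have "nth_prime (nth_prime (c * x)) \<le> nth_prime (nth_prime (4 * j ^ 10))" using cx by simp
      with a(4) am show "nth_prime (nth_prime (c * x)) \<le> m" by linarith
      have "c * x * k \<le> 4 * j ^ 10 * j" using cx kj by (rule mult_le_mono)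
      also have "\<dots> = 4 * j ^ 11" using power_add[of j 10 1] by simp
      finally show "c * x * k < m" using a(5) am by linarith
      show "quot m = k" by (rule k_def[symmetric])
      show "quot (m + c * x) = k" by (rule k2)
    qed (rule order_trans[OF a(1) am] order_trans[OF a(2) am])+
    moreover have "c * x * k = c * (k * x)" by (simp only: mult.assoc mult.commute[of k x])
    ultimately show ?thesis by (simp only:)
  qed
  ultimately have *: "quot_times m0 k x (k * x)"
    unfolding quot_times_def using bc by (intro exI[of _ m] bexI[of _ b] bexI[of _ c]) auto
  show ?thesis
  proof (cases "k = j")
    case True
    with * show ?thesis by (simp add: weak_times_def)
  next
    case False
    with k j have "j = k + 1" by simp
    with * show ?thesis unfolding weak_times_def by (intro disjI2 exI[of _ k] exI[of _ "k * x"]) simp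
  qed
qed


text \<open>The bound \<open>j \<le> C * (1 + ln a)\<close> puts a beyond exp (j / C - 1), so every
  size condition of \<open>quot_times_window\<close>, being polynomial in j, holds
  eventually.\<close>

lemma weak_times_exists:
  obtains C :: real and X0 :: nat where "C \<ge> 1"
    "\<And>X. X \<ge> X0 \<Longrightarrow> \<exists>j\<ge>X. real (j - X) \<le> C * sqrt (real X) \<and> (\<forall>x\<le>j ^ 10. weak_times m0 j x (j * x))"
proof -
  obtain C :: real and X0 :: nat where C: "C \<ge> 1"
    and win: "\<And>X. X \<ge> X0 \<Longrightarrow> \<exists>j a w. X \<le> j \<and> real (j - X) \<le> C * sqrt (real X) \<and> 1 \<le> a \<and>
       a \<le> j * (w + 1) \<and> window j a w \<and> real j \<le> C * (1 + ln (real a))"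
    using window_exists by blast
  obtain D where D: "D > 0" "\<And>n. n \<ge> 1 \<Longrightarrow> nth_prime n \<le> D * n ^ 2"
    using nth_prime_le_square by blast
  \<comment> \<open>E dominates all coefficients that occur. The largest term is the iterated prime
    of 4 j^10, at most 256 D^3 j^40 by applying the square bound twice; this fixes the exponent
    40.\<close>
  define E where "E = 256 * D ^ 3 + m0 + nth_prime (nth_prime 4) + 11"
  have E_ge: "256 * D ^ 3 \<le> E" "m0 \<le> E" "nth_prime (nth_prime 4) \<le> E" "11 \<le> E"
    unfolding E_def by linarith+
  have E0: "real E > 0" using E_ge(4) by linarith
  have ev: "eventually (\<lambda>x::real. e * x ^ 40 < exp (x / C - 1)) at_top" if "e > 0" for e :: real
    using C that by real_asymp
  have "\<exists>x0. \<forall>x\<ge>x0. real E * x ^ 40 < exp (x / C - 1)"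
    using ev[OF E0] unfolding eventually_at_top_linorder .
  then obtain x0 where x0: "\<forall>x\<ge>x0. real E * x ^ 40 < exp (x / C - 1)" ..
  show ?thesis
  proof (rule that[OF C])
    fix X assume X: "X0 + nat \<lceil>x0\<rceil> + 1 \<le> X"
    then have "X0 \<le> X" by linarith
    from win[OF this] obtain j a w where j: "X \<le> j" "real (j - X) \<le> C * sqrt (real X)" and a: "1 \<le> a"
      and w: "a \<le> j * (w + 1)" "window j a w" and ja: "real j \<le> C * (1 + ln (real a))"
      by blast
    have j1: "1 \<le> j" using j X by linarith
    have "x0 \<le> real j" using j X by linarith
    then have "real E * real j ^ 40 < exp (real j / C - 1)" by (rule x0[rule_format])
    also have "\<dots> \<le> exp (ln (real a))"
    proof -
      have "real j / C \<le> 1 + ln (real a)" using ja C by (simp add: divide_le_eq mult.commute)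
      then show ?thesis by simp
    qed
    also have "\<dots> = real a" using a by simp
    finally have "real (E * j ^ 40) < real a" by simp
    then have Ea: "E * j ^ 40 < a" by (rule of_nat_less_imp_less)
    have le: "c * j ^ i \<le> a" if "c \<le> E" "i \<le> 40" for c i
    proof -
      have "c * j ^ i \<le> E * j ^ 40" using that j1 by (intro mult_le_mono power_increasing) auto
      with Ea show ?thesis by simp
    qed
    have lt: "c * j ^ i < a" if "c \<le> E" "i \<le> 40" for c i
    proof -
      have "c * j ^ i \<le> E * j ^ 40" using that j1 by (intro mult_le_mono power_increasing) auto
      with Ea show ?thesis by simp
    qed
    have "nth_prime (nth_prime (4 * j ^ 10)) \<le> D * (nth_prime (4 * j ^ 10)) ^ 2"
      by (intro D) simp
    also have "\<dots> \<le> D * (D * (4 * j ^ 10) ^ 2) ^ 2"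
      using j1 by (intro mult_le_mono2 power_mono D) (auto simp: Suc_le_eq)
    also have "\<dots> = (256 * D ^ 3) * j ^ 40"
    proof -
      have "D * (D * (4 * y) ^ 2) ^ 2 = (256 * D ^ 3) * y ^ 4" for y :: nat
        by (simp add: power_mult_distrib power2_eq_square power3_eq_cube power4_eq_xxxx)
      from this[of "j ^ 10"] show ?thesis by (simp add: power_mult[symmetric])
    qed
    also have "\<dots> \<le> a" by (rule le[OF E_ge(1)]) simp
    finally have 4: "nth_prime (nth_prime (4 * j ^ 10)) \<le> a" .
    have "j * (4 * j ^ 10 + 6) \<le> 10 * j ^ 11"
    proof -
      have "j * (4 * j ^ 10 + 6) = 4 * j ^ 11 + 6 * j ^ 1"
        using power_add[of j 1 10] by (simp add: algebra_simps)
      also have "j ^ 1 \<le> j ^ 11" using j1 by (intro power_increasing) auto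
      finally show ?thesis by simp
    qed
    also have "\<dots> < a" by (rule lt) (use E_ge(4) in simp_all)
    finally have 7: "j * (4 * j ^ 10 + 6) < a" .
    have "weak_times m0 j x (j * x)" if "x \<le> j ^ 10" for x
    proof (rule quot_times_window[OF w(2,1) j1 that _ a _ 4 _ _ 7])
      show "m0 \<le> a" using le[OF E_ge(2), of 0] by simp
      show "nth_prime (nth_prime 4) \<le> a" using le[OF E_ge(3), of 0] by simp
      show "4 * j ^ 11 < a" by (rule lt) (use E_ge(4) in simp_all)
      show "4 * j < a" using lt[of 4 1] E_ge(4) by simp
    qed
    with j show "\<exists>j\<ge>X. real (j - X) \<le> C * sqrt (real X) \<and> (\<forall>x\<le>j ^ 10. weak_times m0 j x (j * x))"
      by blast
  qed
qed

lemma large_square_sound: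
  assumes "large_square m0 z y"
  shows "y = z * z"
proof -
  obtain d k b s u v w w' where 1: "weak_times m0 d z u" "k = u + s" "z \<le> b" "weak_times m0 b s v" "v < d"
    "weak_times m0 k z w" "weak_times m0 d y w'" "w' \<le> w" "w < w' + d"
    using assms unfolding large_square_def by blast
  note 2 = weak_times_sound[OF 1(1)] weak_times_sound[OF 1(4)] weak_times_sound[OF 1(6)] weak_times_sound[OF 1(7)]
  have k: "k = d * z + s" and zb: "z \<le> b" and bs: "b * s < d"
    and le: "d * y \<le> k * z" and less: "k * z < d * y + d"
    using 1 unfolding 2 by (simp_all only:)
  have "z * s \<le> b * s" using zb by (rule mult_le_mono1)
  then have sz: "s * z < d" using bs by (subst mult.commute) linarith
  have kz: "k * z = d * (z * z) + s * z" unfolding k by (simp add: algebra_simps)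
  have "d * y < d * (z * z + 1)" using le kz sz by (simp add: algebra_simps)
  then have 1: "y < z * z + 1" by (simp only: mult_less_cancel1)
  have "d * (z * z) < d * (y + 1)" using less kz by (simp add: algebra_simps)
  then have 2: "z * z < y + 1" by (simp only: mult_less_cancel1)
  from 1 2 show ?thesis by linarith
qed

text \<open>Take b near z, d near z^6 and k near d z, each up to a square root error. Then s^2 = O(d
  z) and b = O(z), so (b s)^2 = O(d z^3), less than d^2 once d outgrows z^3; z^6 is ample.\<close>

lemma large_square_complete:
  obtains z0 :: nat where "\<And>z. z \<ge> z0 \<Longrightarrow> large_square m0 z (z * z)"
proof -
  obtain C :: real and X0 :: nat where C: "C \<ge> 1"
    and ex: "\<And>X. X \<ge> X0 \<Longrightarrow> \<exists>j\<ge>X. real (j - X) \<le> C * sqrt (real X) \<and> (\<forall>x\<le>j ^ 10. weak_times m0 j x (j * x))"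
    using weak_times_exists by blast
  define c where "c = nat \<lceil>2 * C\<^sup>2\<rceil>"
  have c: "2 * C\<^sup>2 \<le> real c" unfolding c_def by (rule real_nat_ceiling_ge)
  \<comment> \<open>Squaring turns the real bound with a root into one between natural
    numbers.\<close>
  have gap: "2 * (j - X) ^ 2 \<le> c * X" if "real (j - X) \<le> C * sqrt (real X)" for j X :: nat
  proof -
    have "real (j - X) ^ 2 \<le> (C * sqrt (real X)) ^ 2" using that by (intro power_mono) auto
    also have "\<dots> = C\<^sup>2 * real X" by (simp add: power_mult_distrib)
    finally have "2 * real (j - X) ^ 2 \<le> 2 * C\<^sup>2 * real X" by simp
    also have "\<dots> \<le> real c * real X" using c by (rule mult_right_mono) simp
    finally have "real (2 * (j - X) ^ 2) \<le> real (c * X)" by simp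
    then show ?thesis by (rule of_nat_le_iff[THEN iffD1])
  qed
  have near: "\<exists>j\<ge>X. 2 * (j - X) ^ 2 \<le> c * X \<and> (\<forall>x\<le>j ^ 10. weak_times m0 j x (j * x))"
    if "X0 \<le> X" for X
    using ex[OF that] gap by blast
  show ?thesis
  proof (rule that[of "X0 + 4 * c + 4"])
    fix z assume "X0 + 4 * c + 4 \<le> z"
    then have zX: "X0 \<le> z" and zc: "4 * c < z" and z4: "4 \<le> z" by auto
    have close: "j \<le> 2 * X" if "2 * (j - X) ^ 2 \<le> c * X" "z \<le> X" for j X
    proof (rule ccontr)
      assume "\<not> ?thesis"
      then have "X < j - X" by linarith
      then have "X ^ 2 \<le> (j - X) ^ 2" by (intro power_mono) auto
      with that(1) have "X ^ 2 \<le> c * X" by linarith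
      then have "X * X \<le> c * X" unfolding power2_eq_square .
      moreover have "c * X < X * X" using zc that(2) z4 by (intro mult_strict_right_mono) auto
      ultimately show False by simp
    qed
    have X_le: "z \<le> z ^ 6" using z4 by (intro self_le_power) auto
    from near[OF zX] obtain b where b: "z \<le> b" "2 * (b - z) ^ 2 \<le> c * z"
      and bM: "\<And>x. x \<le> b ^ 10 \<Longrightarrow> weak_times m0 b x (b * x)"
      by blast
    have "X0 \<le> z ^ 6" using zX X_le by (rule order_trans)
    from near[OF this] obtain d where d: "z ^ 6 \<le> d" "2 * (d - z ^ 6) ^ 2 \<le> c * z ^ 6"
      and dM: "\<And>x. x \<le> d ^ 10 \<Longrightarrow> weak_times m0 d x (d * x)"
      by blast
    have zd: "z \<le> d" using d X_le by linarith
    have z_dz: "z \<le> d * z" using zd z4 by simp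
    have "X0 \<le> d * z" using zX z_dz by (rule order_trans)
    from near[OF this] obtain k where k: "d * z \<le> k" "2 * (k - d * z) ^ 2 \<le> c * (d * z)"
      and kM: "\<And>x. x \<le> k ^ 10 \<Longrightarrow> weak_times m0 k x (k * x)"
      by blast
    define s where "s = k - d * z"
    have b2: "b \<le> 2 * z" by (rule close[OF b(2) order_refl])
    have d2: "d \<le> 2 * z ^ 6" by (rule close[OF d(2) X_le])
    have "(b * s) ^ 2 \<le> (2 * z * s) ^ 2" using b2 by (intro power_mono mult_le_mono1) simp_all
    also have "\<dots> = 2 * z ^ 2 * (2 * s ^ 2)" by (simp add: power_mult_distrib)
    also have "\<dots> \<le> 2 * z ^ 2 * (c * (d * z))" using k(2) unfolding s_def by (rule mult_le_mono2)
    also have "\<dots> \<le> 2 * z ^ 2 * (c * (2 * z ^ 6 * z))" using d2 by simp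
    also have "\<dots> = 4 * c * z ^ 9"
    proof -
      have "z ^ 9 = z ^ (2 + (6 + 1))" by simp
      also have "\<dots> = z ^ 2 * (z ^ 6 * z)" by (simp only: power_add power_one_right)
      finally have "z ^ 9 = z ^ 2 * (z ^ 6 * z)" .
      then show ?thesis by simp
    qed
    also have "\<dots> < z * z ^ 9" using zc z4 by (intro mult_strict_right_mono) auto
    also have "\<dots> = z ^ 10" using power_add[of z 1 9] by simp
    also have "\<dots> \<le> z ^ 12" using z4 by (intro power_increasing) auto
    also have "\<dots> = (z ^ 6) ^ 2" by (simp flip: power_mult)
    also have "\<dots> \<le> d ^ 2" using d(1) by (intro power_mono) auto
    finally have bs: "b * s < d" by (rule power_less_imp_less_base) simp
    \<comment> \<open>Here s may exceed b, so the polynomial range of multiples matters: s \<le> b s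
      < d \<le> 2 z^6 stays below b^10.\<close>
    have 4: "weak_times m0 b s (b * s)"
    proof (rule bM)
      have "s \<le> b * s" using b(1) z4 by simp
      with bs have "s \<le> 2 * z ^ 6" using d2 by linarith
      also have "\<dots> \<le> z * z ^ 6" using z4 by (intro mult_le_mono1) auto
      also have "\<dots> = z ^ 7" using power_add[of z 1 6] by simp
      also have "\<dots> \<le> z ^ 10" using z4 by (intro power_increasing) auto
      also have "\<dots> \<le> b ^ 10" using b(1) by (intro power_mono) auto
      finally show "s \<le> b ^ 10" .
    qed
    have 1: "weak_times m0 d z (d * z)"
    proof (rule dM)
      have "d \<le> d ^ 10" using zd z4 by (intro self_le_power) auto
      with zd show "z \<le> d ^ 10" by linarith
    qed
    have 6: "weak_times m0 k z (k * z)"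
    proof (rule kM)
      have "1 \<le> k" using k(1) z_dz z4 by linarith
      then have "k \<le> k ^ 10" by (intro self_le_power) auto
      with k(1) z_dz show "z \<le> k ^ 10" by linarith
    qed
    have 7: "weak_times m0 d (z * z) (d * (z * z))"
    proof (rule dM)
      have "z * z \<le> d ^ 2" unfolding power2_eq_square using zd by (intro mult_le_mono) auto
      also have "\<dots> \<le> d ^ 10" using zd z4 by (intro power_increasing) auto
      finally show "z * z \<le> d ^ 10" .
    qed
    have k_eq: "k = d * z + s" using k(1) by (simp add: s_def)
    have kz: "k * z = d * (z * z) + s * z" unfolding k_eq by (simp add: algebra_simps)
    have "z * s \<le> b * s" using b(1) by (rule mult_le_mono1)
    then have sz: "s * z < d" using bs by (subst mult.commute) linarith
    have "d * (z * z) \<le> k * z" "k * z < d * (z * z) + d" using kz sz by linarith+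
    with 1 k_eq b(1) 4 bs 6 7 show "large_square m0 z (z * z)"
      unfolding large_square_def by (intro exI conjI)
  qed
qed


text \<open>Even the product with 0 contains a certificate for the quotient. The certified value may
  be j - 1, hence the additional 1 in the choice of X.\<close>

lemma has_quot_exists: "\<exists>m k. B \<le> k \<and> has_quot m0 m k"
proof -
  obtain C :: real and X0 :: nat where "C \<ge> 1"
    and ex: "\<And>X. X \<ge> X0 \<Longrightarrow> \<exists>j\<ge>X. real (j - X) \<le> C * sqrt (real X) \<and> (\<forall>x\<le>j ^ 10. weak_times m0 j x (j * x))"
    using weak_times_exists by blast
  have "X0 \<le> X0 + B + 1" by simp
  from ex[OF this] obtain j where j: "j \<ge> X0 + B + 1" "weak_times m0 j 0 (j * 0)"
    by blast
  have "quot_times m0 j 0 (j * 0) \<or> (\<exists>k' y'. j = k' + 1 \<and> j * 0 = y' + 0 \<and> quot_times m0 k' 0 y')"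
    using j(2) unfolding weak_times_def .
  then have "\<exists>k y. j \<le> k + 1 \<and> quot_times m0 k 0 y"
    by (elim disjE exE conjE) (rule exI[of _ j], rule exI[of _ "j * 0"], simp, fastforce)
  then obtain k y where k: "j \<le> k + 1" "quot_times m0 k 0 y" by (elim exE conjE)
  then obtain m b where "b \<in> {1..4}" "same_quot m0 m b (b * k)"
    unfolding quot_times_def by (elim exE bexE conjE)
  then have "has_quot m0 m k" unfolding has_quot_def by (rule bexI[rotated])
  moreover have "B \<le> k" using j(1) k(1) by linarith
  ultimately show ?thesis by (intro exI conjI)
qed

text \<open>Chebyshev's bounds say that the quotient at m is of the order of ln m. With
  \<open>has_quot_lower\<close> this traps m between two exponentials of k.\<close>

lemma has_quot_upper:
  assumes "has_quot m0 m k"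
  shows "m \<le> 4 ^ (k + 2)"
proof -
  have m: "m \<ge> 1" and k: "k = quot m"
    using assms by (rule has_quot_pos, rule has_quot_sound)
  have "nth_prime m = quot m * m + nth_prime m mod m" by (rule div_mult_mod_eq[symmetric])
  moreover have "nth_prime m mod m < m" using m by (intro mod_less_divisor) linarith
  moreover have "(k + 1) * m = quot m * m + m" unfolding k by (simp only: add_mult_distrib mult_1)
  ultimately have "nth_prime m \<le> (k + 1) * m" by linarith
  then have "real (nth_prime m) \<le> real ((k + 1) * m)" by (rule of_nat_mono)
  also have "\<dots> = real m * real (k + 1)" by (simp only: of_nat_mult mult.commute)
  finally have "real (nth_prime m) * ln 4 \<le> real m * real (k + 1) * ln 4" by (rule mult_right_mono) simp
  with nth_prime_lower[OF m] have "real m * ln (real m) \<le> real m + real m * real (k + 1) * ln 4"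
    by linarith
  also have "\<dots> = real m * (1 + real (k + 1) * ln 4)" by (simp only: distrib_left mult_1_right mult.assoc)
  finally have "ln (real m) \<le> 1 + real (k + 1) * ln 4"
    by (rule mult_left_le_imp_le) (use m in linarith)
  also have "\<dots> \<le> real (k + 2) * ln (4::real)"
  proof -
    have "ln (4::real) = 2 * ln 2" using ln_realpow[of "2::real" 2] by simp
    moreover have "ln (2::real) \<ge> 1/2" using ln_le_minus_one[of "1/2::real"] by (simp add: ln_div)
    moreover have "real (k + 2) * ln (4::real) = real (k + 1) * ln 4 + ln 4"
      by (simp add: distrib_right)
    ultimately show ?thesis by linarith
  qed
  also have "\<dots> = ln ((4::real) ^ (k + 2))" by (rule ln_realpow[symmetric])
  finally have "ln (real m) \<le> ln ((4::real) ^ (k + 2))" .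
  then have "real m \<le> 4 ^ (k + 2)"
    using m by (subst (asm) ln_le_cancel_iff) simp_all
  then have "real m \<le> real (4 ^ (k + 2))" by simp
  then show ?thesis by (rule of_nat_le_iff[THEN iffD1])
qed

lemma has_quot_lower:
  obtains c :: nat where "c \<ge> 1" "\<And>m k q. has_quot m0 m k \<Longrightarrow> c * q \<le> k \<Longrightarrow> 2 ^ q \<le> 3 * m"
proof -
  obtain C :: real where C: "C \<ge> 1"
    and quot: "\<And>m. m \<ge> 1 \<Longrightarrow> real (quot m) \<le> C * (1 + ln (real m))"
    using quot_le_ln by blast
  have cC: "C \<le> real (nat \<lceil>C\<rceil>)" by (rule real_nat_ceiling_ge)
  show ?thesis
  proof (rule that[of "nat \<lceil>C\<rceil>"])
    show "1 \<le> nat \<lceil>C\<rceil>" using C by linarith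
    fix m k q assume h: "has_quot m0 m k" and q: "nat \<lceil>C\<rceil> * q \<le> k"
    have m: "m \<ge> 1" and k: "k = quot m"
      using h by (rule has_quot_pos, rule has_quot_sound)
    have "C * real q \<le> real (nat \<lceil>C\<rceil>) * real q" using cC by (rule mult_right_mono) simp
    also have "\<dots> = real (nat \<lceil>C\<rceil> * q)" by simp
    also have "\<dots> \<le> real k" using q by (rule of_nat_mono)
    also have "\<dots> \<le> C * (1 + ln (real m))" unfolding k by (rule quot[OF m])
    finally have "real q \<le> 1 + ln (real m)" using C by simp
    then have "exp (real q) \<le> exp (1 + ln (real m))" by simp
    also have "\<dots> = exp 1 * real m" using m by (simp add: exp_add)
    also have "\<dots> \<le> 3 * real m" using exp_le by (intro mult_right_mono) auto
    finally have "exp (real q) \<le> 3 * real m" .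
    moreover have "2 ^ q \<le> exp (1::real) ^ q"
      using exp_ge_add_one_self[of "1::real"] by (intro power_mono) auto
    then have "2 ^ q \<le> exp (real q)" by (simp add: exp_of_nat_mult[symmetric])
    ultimately have "real (2 ^ q) \<le> real (3 * m)" by simp
    then show "2 ^ q \<le> 3 * m" by (rule of_nat_le_iff[THEN iffD1])
  qed
qed

end

section \<open>Existentially definable relations\<close>

definition mix :: "(nat \<Rightarrow> nat) \<Rightarrow> (nat \<Rightarrow> nat) \<Rightarrow> nat \<Rightarrow> nat" where
  "mix e u i = (if even i then e (i div 2) else u (i div 2))"

lemma mix_simps [simp]: "mix e u (2 * i) = e i" "mix e u (Suc (2 * i)) = u i" "mix e u 0 = e 0"
  unfolding mix_def by simp_all

lemma mix_comp: "(\<lambda>i. mix e u (mix s t i)) = mix (\<lambda>i. mix e u (s i)) (\<lambda>i. mix e u (t i))"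
  by (rule ext) (simp add: mix_def)

lemma mix_collapse: "mix (\<lambda>i. v (2 * i)) (\<lambda>i. v (Suc (2 * i))) = v"
proof
  fix i
  show "mix (\<lambda>i. v (2 * i)) (\<lambda>i. v (Suc (2 * i))) i = v i"
  proof (cases "even i")
    case True
    then obtain j where "i = 2 * j" by (rule evenE)
    then show ?thesis by (simp only: mix_simps)
  next
    case False
    then obtain j where "i = 2 * j + 1" by (rule oddE)
    then show ?thesis by (simp only: mix_simps Suc_eq_plus1[symmetric])
  qed
qed

text \<open>Infinitely many existentially quantified variables, interleaved with the free ones, avoid any
  bookkeeping about arities.\<close>

locale ex_class =
  fixes B :: "((nat \<Rightarrow> nat) \<Rightarrow> bool) set"
  assumes B_rename: "b \<in> B \<Longrightarrow> (\<lambda>e. b (\<lambda>i. e (\<sigma> i))) \<in> B"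
    and B_conj: "b \<in> B \<Longrightarrow> c \<in> B \<Longrightarrow> (\<lambda>e. b e \<and> c e) \<in> B"
    and B_disj: "b \<in> B \<Longrightarrow> c \<in> B \<Longrightarrow> (\<lambda>e. b e \<or> c e) \<in> B"
    and B_eq: "(\<lambda>e. e 0 = e 1) \<in> B"
    and B_plus: "(\<lambda>e. e 0 = e 1 + e 2) \<in> B"
begin

definition D :: "((nat \<Rightarrow> nat) \<Rightarrow> bool) \<Rightarrow> bool" where
  "D R \<longleftrightarrow> (\<exists>b\<in>B. \<forall>e. R e \<longleftrightarrow> (\<exists>u. b (mix e u)))"

lemma D_I:
  assumes "c \<in> B" "\<And>e. R e \<Longrightarrow> \<exists>u. c (mix e u)" "\<And>e u. c (mix e u) \<Longrightarrow> R e"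
  shows "D R"
  unfolding D_def
proof (rule bexI[OF _ assms(1)], rule allI, rule iffI)
  fix e assume "\<exists>u. c (mix e u)"
  then obtain u where "c (mix e u)" by (rule exE)
  then show "R e" by (rule assms(3))
qed (rule assms(2))

lemma D_E:
  assumes "D R"
  obtains b where "b \<in> B" "\<forall>e. R e = (\<exists>u. b (mix e u))"
  using assms unfolding D_def by (elim bexE)

lemma D_base: "b \<in> B \<Longrightarrow> D b"
  unfolding D_def
  by (rule bexI[of _ "\<lambda>e. b (\<lambda>i. e (2 * i))"]) (simp, rule B_rename)

lemma D_rename:
  assumes "D R"
  shows "D (\<lambda>e. R (\<lambda>i. e (\<sigma> i)))"
proof -
  from assms obtain b where b: "b \<in> B" "\<forall>e. R e = (\<exists>u. b (mix e u))" by (rule D_E)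
  define c where "c = (\<lambda>e. b (\<lambda>i. e (mix (\<lambda>i. 2 * \<sigma> i) (\<lambda>i. Suc (2 * i)) i)))"
  have c: "c (mix e u) = b (mix (\<lambda>i. e (\<sigma> i)) u)" for e u
    unfolding c_def mix_comp by (simp only: mix_simps)
  have "c \<in> B" unfolding c_def by (rule B_rename[OF b(1)])
  then show ?thesis
    by (rule D_I) (unfold b(2)[rule_format] c, assumption, rule exI)
qed

text \<open>The witnesses of the conjuncts are themselves interleaved, so they cannot clash. A
  disjunction may share its witnesses.\<close>

lemma D_conj [intro]:
  assumes "D R" "D S"
  shows "D (\<lambda>e. R e \<and> S e)"
proof -
  from assms(1) obtain b where b: "b \<in> B" "\<forall>e. R e = (\<exists>u. b (mix e u))" by (rule D_E)
  from assms(2) obtain c where c: "c \<in> B" "\<forall>e. S e = (\<exists>u. c (mix e u))" by (rule D_E)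
  define d where "d = (\<lambda>e. b (\<lambda>i. e (mix (\<lambda>i. 2 * i) (\<lambda>i. Suc (2 * (2 * i))) i)) \<and>
    c (\<lambda>i. e (mix (\<lambda>i. 2 * i) (\<lambda>i. Suc (2 * Suc (2 * i))) i)))"
  have d: "d (mix e u) = (b (mix e (\<lambda>i. u (2 * i))) \<and> c (mix e (\<lambda>i. u (Suc (2 * i)))))" for e u
    unfolding d_def mix_comp by (simp only: mix_simps)
  have "d \<in> B" unfolding d_def by (rule B_conj[OF B_rename[OF b(1)] B_rename[OF c(1)]])
  then show ?thesis
  proof (rule D_I)
    fix e assume "R e \<and> S e"
    then obtain u v where uv: "b (mix e u)" "c (mix e v)" unfolding b(2)[rule_format] c(2)[rule_format] by (elim conjE exE)
    show "\<exists>w. d (mix e w)"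
      by (rule exI[of _ "mix u v"], unfold d) (simp only: mix_simps uv simp_thms)
  next
    fix e u assume "d (mix e u)"
    then show "R e \<and> S e" unfolding d b(2)[rule_format] c(2)[rule_format] by (elim conjE) (intro conjI exI)
  qed
qed

lemma D_disj [intro]:
  assumes "D R" "D S"
  shows "D (\<lambda>e. R e \<or> S e)"
proof -
  from assms(1) obtain b where b: "b \<in> B" "\<forall>e. R e = (\<exists>u. b (mix e u))" by (rule D_E)
  from assms(2) obtain c where c: "c \<in> B" "\<forall>e. S e = (\<exists>u. c (mix e u))" by (rule D_E)
  have "(\<lambda>e. b e \<or> c e) \<in> B" by (intro B_disj b c)
  then show ?thesis
    by (rule D_I) (unfold b(2)[rule_format] c(2)[rule_format] ex_disj_distrib, assumption, erule disj_forward, (rule exI, assumption)+)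
qed

lemma D_ex [intro]:
  assumes "D (\<lambda>e. R (e 0) (\<lambda>i. e (Suc i)))"
  shows "D (\<lambda>e. \<exists>v. R v e)"
proof -
  from assms obtain b where b: "b \<in> B" "\<forall>e. R (e 0) (\<lambda>i. e (Suc i)) = (\<exists>u. b (mix e u))" by (rule D_E)
  \<comment> \<open>Index 1 is the first witness slot. It receives the quantified variable, and the
    old witnesses move up by one.\<close>
  define c where "c = (\<lambda>e. b (\<lambda>i. e (mix (case_nat 1 (\<lambda>i. 2 * i)) (\<lambda>i. Suc (2 * Suc i)) i)))"
  have c: "c (mix e u) = b (mix (case_nat (u 0) e) (\<lambda>i. u (Suc i)))" for e u
  proof -
    have "(\<lambda>i. mix e u (case_nat 1 (\<lambda>i. 2 * i) i)) = case_nat (u 0) e"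
      by (rule ext) (simp add: mix_def split: nat.split)
    then show ?thesis unfolding c_def mix_comp by (simp only: mix_simps)
  qed
  have R: "R v e = (\<exists>u. b (mix (case_nat v e) u))" for v e
    using b(2)[THEN spec, of "case_nat v e"] by (simp only: nat.case)
  have "c \<in> B" unfolding c_def by (rule B_rename[OF b(1)])
  then show ?thesis
  proof (rule D_I)
    fix e assume "\<exists>v. R v e"
    then obtain v u where u: "b (mix (case_nat v e) u)" unfolding R by (elim exE)
    show "\<exists>u. c (mix e u)"
      by (rule exI[of _ "case_nat v u"], unfold c) (simp only: nat.case u)
  next
    fix e u assume "c (mix e u)"
    then show "\<exists>v. R v e" unfolding c R by (intro exI)
  qed
qed

text \<open>Functions with definable graph, value in variable 0. Closure under composition lets
  \<open>intro\<close> decide definability by the shape of a formula.\<close>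

definition F :: "((nat \<Rightarrow> nat) \<Rightarrow> nat) \<Rightarrow> bool" where
  "F t \<longleftrightarrow> D (\<lambda>e. e 0 = t (\<lambda>i. e (Suc i)))"

lemma D_eq_var: "D (\<lambda>e. e i = e j)"
  using D_rename[OF D_base[OF B_eq], of "case_nat i (\<lambda>_. j)"] by simp

lemma F_var [intro]: "F (\<lambda>e. e i)"
  unfolding F_def by (rule D_eq_var)

lemma F_rename: "F t \<Longrightarrow> F (\<lambda>e. t (\<lambda>i. e (\<sigma> i)))"
  unfolding F_def using D_rename[of "\<lambda>e. e 0 = t (\<lambda>i. e (Suc i))" "case_nat 0 (\<lambda>i. Suc (\<sigma> i))"] by simp

lemma D_graph: "F a \<Longrightarrow> D (\<lambda>e. e i = a (\<lambda>k. e (\<sigma> k)))"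
  unfolding F_def using D_rename[of "\<lambda>e. e 0 = a (\<lambda>i. e (Suc i))" "case_nat i \<sigma>"] by simp

lemma D_comp2:
  assumes R: "D (\<lambda>e. R (e 0) (e 1))" and a: "F a" and b: "F b"
  shows "D (\<lambda>e. R (a e) (b e))"
proof -
  have "D (\<lambda>e. \<exists>v w. w = a e \<and> v = b e \<and> R w v)"
    by (intro D_ex D_conj D_graph[OF a] D_graph[OF b]) (use R in simp)
  then show ?thesis by simp
qed

lemma D_comp3:
  assumes R: "D (\<lambda>e. R (e 0) (e 1) (e 2))" and a: "F a" and b: "F b" and c: "F c"
  shows "D (\<lambda>e. R (a e) (b e) (c e))"
proof -
  have R': "D (\<lambda>e. R (e 0) (e (Suc 0)) (e (Suc (Suc 0))))"
    using R by (simp add: numeral_2_eq_2)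
  have "D (\<lambda>e. \<exists>x v w. w = a e \<and> v = b e \<and> x = c e \<and> R w v x)"
    by (intro D_ex D_conj D_graph[OF a] D_graph[OF b] D_graph[OF c]) (rule R')
  then show ?thesis by simp
qed

lemma F_comp1:
  assumes R: "D (\<lambda>e. e 0 = G (e 1))" and a: "F a"
  shows "F (\<lambda>e. G (a e))"
  unfolding F_def
  by (rule D_comp2[of "\<lambda>x y. x = G y", OF R F_var F_rename[OF a]])

lemma F_comp2:
  assumes R: "D (\<lambda>e. e 0 = G (e 1) (e 2))" and a: "F a" and b: "F b"
  shows "F (\<lambda>e. G (a e) (b e))"
  unfolding F_def
  by (rule D_comp3[of "\<lambda>x y z. x = G y z", OF R F_var F_rename[OF a] F_rename[OF b]])

lemma D_eq [intro]: "F a \<Longrightarrow> F b \<Longrightarrow> D (\<lambda>e. a e = b e)"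
  by (rule D_comp2[of "(=)"]) (rule D_eq_var)

lemma F_plus [intro]: "F a \<Longrightarrow> F b \<Longrightarrow> F (\<lambda>e. a e + b e)"
  by (rule F_comp2[of "(+)"]) (rule D_base[OF B_plus])

lemma D_le [intro]: "F a \<Longrightarrow> F b \<Longrightarrow> D (\<lambda>e. a e \<le> b e)"
proof (rule D_comp2[of "(\<le>)"])
  show "D (\<lambda>e. e 0 \<le> e 1)"
    unfolding le_iff_add by (intro D_ex D_eq F_var F_plus)
qed

text \<open>There are no constants in the class, but 0 is the only solution of x = x + x.\<close>

lemma F_0 [intro]: "F (\<lambda>e. 0)"
proof -
  have "D (\<lambda>e. e 0 = e 0 + e 0)" by (intro D_eq F_var F_plus)
  then show ?thesis unfolding F_def by simp
qed

end

locale ex_class_one = ex_class +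
  assumes F_1 [intro]: "F (\<lambda>e. 1)"
begin

lemma F_const [intro]: "F (\<lambda>e. c)"
proof (induction c)
  case (Suc c)
  then have "F (\<lambda>e. c + 1)" by (intro F_plus F_1)
  then show ?case by simp
qed (rule F_0)

lemma F_Suc [intro]: "F a \<Longrightarrow> F (\<lambda>e. Suc (a e))"
  unfolding Suc_eq_plus1 by (intro F_plus F_1)

lemma D_less [intro]: "F a \<Longrightarrow> F b \<Longrightarrow> D (\<lambda>e. a e < b e)"
  unfolding Suc_le_eq[symmetric] by (intro D_le F_Suc)

lemma D_const [intro]: "D (\<lambda>e. P)"
proof -
  have "D (\<lambda>e. (0::nat) = (if P then 0 else 1))" by (intro D_eq F_const)
  then show ?thesis by (simp split: if_splits)
qed

lemma D_Bex_const:
  assumes "\<And>c. c \<in> A \<Longrightarrow> D (\<lambda>e. R c e)" "finite A"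
  shows "D (\<lambda>e. \<exists>c\<in>A. R c e)"
  using assms(2,1)
proof (induction A rule: finite_induct)
  case (insert c A)
  have "D (\<lambda>e. R c e \<or> (\<exists>c\<in>A. R c e))"
    by (rule D_disj) (rule insert.prems, simp, rule insert.IH, rule insert.prems, simp)
  then show ?case by (simp only: bex_simps)
qed (simp only: bex_simps, rule D_const)

end

locale ex_class_mult = ex_class_one +
  assumes D_times_var: "D (\<lambda>e. e 0 = e 1 * e 2)"
begin

lemma F_times [intro]: "F a \<Longrightarrow> F b \<Longrightarrow> F (\<lambda>e. a e * b e)"
  by (rule F_comp2[of "(*)"]) (rule D_times_var)

lemma F_power_const [intro]: "F a \<Longrightarrow> F (\<lambda>e. a e ^ n)"
  by (induction n) (simp_all only: power_0 power_Suc F_const F_times)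

lemma F_minus [intro]: "F a \<Longrightarrow> F b \<Longrightarrow> F (\<lambda>e. a e - b e)"
proof (rule F_comp2[of "(-)"])
  have "D (\<lambda>e. (e 1 = e 2 + e 0) \<or> (e 1 < e 2 \<and> e 0 = 0))"
    by (intro D_disj D_conj D_eq D_less F_var F_plus F_const)
  moreover have "(x = y - z) = ((y = z + x) \<or> (y < z \<and> x = 0))" for x y z :: nat by linarith
  ultimately show "D (\<lambda>e. e 0 = e 1 - e 2)" by (simp only:)
qed

lemma F_mod [intro]: "F a \<Longrightarrow> F b \<Longrightarrow> F (\<lambda>e. a e mod b e)"
proof (rule F_comp2[of "(mod)"])
  have "D (\<lambda>e. \<exists>q. e 1 = q * e 2 + e 0 \<and> (e 0 < e 2 \<or> e 2 = 0))"
    by (intro D_ex D_disj D_conj D_eq D_less F_var F_plus F_times F_const)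
  moreover have "(x = y mod z) = (\<exists>q. y = q * z + x \<and> (x < z \<or> z = 0))" for x y z :: nat
  proof
    assume "x = y mod z"
    then show "\<exists>q. y = q * z + x \<and> (x < z \<or> z = 0)" by (intro exI[of _ "y div z"]) auto
  next
    assume "\<exists>q. y = q * z + x \<and> (x < z \<or> z = 0)"
    then obtain q where "y = q * z + x" "x < z \<or> z = 0" by (elim exE conjE)
    then show "x = y mod z" by (elim disjE) simp_all
  qed
  ultimately show "D (\<lambda>e. e 0 = e 1 mod e 2)" by (simp only:)
qed

lemma F_div [intro]: "F a \<Longrightarrow> F b \<Longrightarrow> F (\<lambda>e. a e div b e)"
proof (rule F_comp2[of "(div)"])
  have "D (\<lambda>e. \<exists>r. (e 1 = e 0 * e 2 + r \<and> r < e 2) \<or> (e 2 = 0 \<and> e 0 = 0))"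
    by (intro D_ex D_disj D_conj D_eq D_less F_var F_plus F_times F_const)
  moreover have "(x = y div z) = (\<exists>r. (y = x * z + r \<and> r < z) \<or> (z = 0 \<and> x = 0))" for x y z :: nat
  proof
    assume "x = y div z"
    then show "\<exists>r. (y = x * z + r \<and> r < z) \<or> (z = 0 \<and> x = 0)"
      by (intro exI[of _ "y mod z"]) (cases "z = 0", simp_all)
  next
    assume "\<exists>r. (y = x * z + r \<and> r < z) \<or> (z = 0 \<and> x = 0)"
    then obtain r where "(y = x * z + r \<and> r < z) \<or> (z = 0 \<and> x = 0)" ..
    then show "x = y div z" by (elim disjE conjE) simp_all
  qed
  ultimately show "D (\<lambda>e. e 0 = e 1 div e 2)" by (simp only:)
qed

lemma D_dvd [intro]: "F a \<Longrightarrow> F b \<Longrightarrow> D (\<lambda>e. a e dvd b e)"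
  unfolding dvd_eq_mod_eq_0 by (intro D_eq F_mod F_const)

lemma D_cong [intro]: "F a \<Longrightarrow> F b \<Longrightarrow> F c \<Longrightarrow> D (\<lambda>e. [a e = b e] (mod c e))"
  unfolding unique_euclidean_semiring_class.cong_def by (intro D_eq F_mod)

end

section \<open>Pell equations and exponentiation\<close>

text \<open>The coefficients of (a + sqrt d)^n = x + y sqrt d for d = a^2 - 1.\<close>

fun pell_x pell_y :: "nat \<Rightarrow> nat \<Rightarrow> nat" where
  "pell_x a 0 = 1"
| "pell_x a (Suc n) = a * pell_x a n + (a * a - 1) * pell_y a n"
| "pell_y a 0 = 0"
| "pell_y a (Suc n) = pell_x a n + a * pell_y a n"

text \<open>Multiplicativity of the norm for the product of x + y sqrt d with the unit a - sqrt
  d.\<close>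

lemma pell_descent_int:
  fixes a x y d :: int
  assumes "d = a * a - 1" "x * x = d * (y * y) + 1"
  shows "(a * x - d * y) * (a * x - d * y) = d * ((a * y - x) * (a * y - x)) + 1"
proof -
  have "(a * x - d * y) * (a * x - d * y) - d * ((a * y - x) * (a * y - x)) =
      (a * a - d) * (x * x - d * (y * y))"
    by (simp add: algebra_simps)
  also have "\<dots> = 1" using assms by simp
  finally show ?thesis by simp
qed

text \<open>Descent: dividing a solution by a + sqrt d replaces y by a y - x. The bounds (a - 1) y <
  x \<le> a y place the new y in [0, y), until y = 0 is reached.\<close>

lemma pell_solution:
  assumes a: "a \<ge> 2"
  shows "x * x = (a * a - 1) * (y * y) + 1 \<Longrightarrow> \<exists>n. x = pell_x a n \<and> y = pell_y a n"
proof (induction y arbitrary: x rule: less_induct)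
  case (less y)
  show ?case
  proof (cases "y = 0")
    case True
    then have "x * x = 1" using less.prems by simp
    then have "x = pell_x a 0 \<and> y = pell_y a 0" using True by simp
    then show ?thesis by (rule exI)
  next
    case False
    define d where "d = a * a - 1"
    have aa: "a * a = d + 1"
    proof -
      have "1 * 1 \<le> a * a" using a by (intro mult_le_mono) auto
      then show ?thesis unfolding d_def by simp
    qed
    have xx: "x * x = d * (y * y) + 1" using less.prems unfolding d_def .
    have "1 * 1 \<le> y * y" using False by (intro mult_le_mono) auto
    then have yy: "1 \<le> y * y" by simp
    have "x * x \<le> (a * y) * (a * y)"
    proof -
      have "(a * y) * (a * y) = (a * a) * (y * y)" by (simp only: mult_ac)
      also have "\<dots> = d * (y * y) + y * y" unfolding aa by (simp only: add_mult_distrib mult_1)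
      finally show ?thesis using xx yy by linarith
    qed
    then have x_le: "x \<le> a * y" unfolding power2_eq_square[symmetric] by (rule power2_le_imp_le) simp
    have x_gr: "(a - 1) * y < x"
    proof (rule ccontr)
      assume "\<not> ?thesis"
      then have "x * x \<le> ((a - 1) * y) * ((a - 1) * y)" by (intro mult_le_mono) auto
      also have "\<dots> = ((a - 1) * (a - 1)) * (y * y)" by (simp only: mult_ac)
      also have "\<dots> \<le> d * (y * y)"
      proof (rule mult_le_mono1)
        have "(a - 1) * (a - 1) \<le> (a - 1) * a" by (rule mult_le_mono2) simp
        also have "\<dots> = a * a - a" by (simp add: diff_mult_distrib)
        also have "\<dots> \<le> d" using a unfolding d_def by linarith
        finally show "(a - 1) * (a - 1) \<le> d" .
      qed
      finally show False using xx by linarith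
    qed
    have dy: "d * y \<le> a * x"
    proof -
      show ?thesis
      proof (rule ccontr)
        assume "\<not> ?thesis"
        then have "a * x \<le> d * y" by linarith
        then have "(a * x) * (a * x) \<le> (d * y) * (d * y)" by (intro mult_le_mono[of "a * x" "d * y" "a * x" "d * y"])
        moreover have "(a * x) * (a * x) = (d + 1) * (d * (y * y) + 1)"
          unfolding aa[symmetric] xx[symmetric] by (simp only: mult_ac)
        moreover have "(d + 1) * (d * (y * y) + 1) = (d * y) * (d * y) + d + d * (y * y) + 1"
          by (simp add: algebra_simps)
        ultimately show False by linarith
      qed
    qed
    define x' y' where "x' = a * x - d * y" and "y' = a * y - x"
    have ix: "int x' = int a * int x - int d * int y" and iy: "int y' = int a * int y - int x"
      using dy x_le unfolding x'_def y'_def by (simp_all add: of_nat_diff)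
    have id: "int d = int a * int a - 1" using arg_cong[OF aa, of int] by simp
    have "int x * int x = int d * (int y * int y) + 1" using arg_cong[OF xx, of int] by simp
    from pell_descent_int[OF id this] have "int (x' * x') = int (d * (y' * y') + 1)"
      unfolding ix[symmetric] iy[symmetric] by simp
    then have "x' * x' = (a * a - 1) * (y' * y') + 1" unfolding d_def[symmetric] by (rule of_nat_eq_iff[THEN iffD1])
    moreover have "y' < y"
    proof -
      have "(a - 1) * y = a * y - y" by (simp add: diff_mult_distrib)
      with x_gr x_le False show ?thesis unfolding y'_def by linarith
    qed
    ultimately obtain n where n: "x' = pell_x a n" "y' = pell_y a n" using less.IH by blast
    have "int x = int (a * x' + d * y')" "int y = int (x' + a * y')"
      unfolding of_nat_add of_nat_mult ix iy id by (simp_all add: algebra_simps)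
    then have "x = a * x' + d * y'" "y = x' + a * y'" by (simp_all only: of_nat_eq_iff)
    then have "x = pell_x a (Suc n) \<and> y = pell_y a (Suc n)" unfolding n d_def by (simp only: pell_x.simps pell_y.simps)
    then show ?thesis by (rule exI)
  qed
qed

lemma pell_equation:
  assumes "a \<ge> 2"
  shows "pell_x a n * pell_x a n = (a * a - 1) * (pell_y a n * pell_y a n) + 1"
proof (induction n)
  case (Suc n)
  define d x y where "d = a * a - 1" and "x = pell_x a n" and "y = pell_y a n"
  have IH: "x * x = d * (y * y) + 1" using Suc unfolding d_def x_def y_def .
  have "1 * 1 \<le> a * a" using assms by (intro mult_le_mono) auto
  then have aa: "a * a = d + 1" unfolding d_def by simp
  have "(a * x + d * y) * (a * x + d * y) = (a * a) * (x * x) + 2 * (a * x * d * y) + d * d * (y * y)"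
    by (simp add: algebra_simps)
  also have "\<dots> = d * (x * x + 2 * (a * x * y) + (a * a) * (y * y)) + 1"
    unfolding aa IH by (simp add: algebra_simps)
  also have "\<dots> = d * ((x + a * y) * (x + a * y)) + 1" by (simp add: algebra_simps)
  finally show ?case unfolding d_def x_def y_def by simp
qed simp

text \<open>Since a is 1 modulo a - 1, the recursion leaves x at 1 and adds 1 to y in each step. So
  y reveals an index below a - 1.\<close>

lemma pell_y_cong:
  assumes "a \<ge> 2"
  shows "[pell_x a n = 1] (mod (a - 1))" "[pell_y a n = n] (mod (a - 1))"
proof (induction n)
  case (Suc n)
  have a1: "[a = 1] (mod (a - 1))"
  proof -
    have "[(a - 1) + 1 = 0 + 1] (mod (a - 1))" by (intro cong_add cong_refl) (simp add: cong_0_iff)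
    then show ?thesis using assms by simp
  qed
  have "a * a - 1 = (a - 1) * (a + 1)" using assms by (simp add: algebra_simps diff_mult_distrib2)
  then have d: "[(a * a - 1) * pell_y a n = 0] (mod (a - 1))"
    by (simp add: cong_0_iff mult.assoc)
  have "[a * pell_x a n + (a * a - 1) * pell_y a n = 1 * 1 + 0] (mod (a - 1))"
    by (intro cong_add cong_mult a1 d Suc.IH)
  then show "[pell_x a (Suc n) = 1] (mod (a - 1))" by simp
  have "[pell_x a n + a * pell_y a n = 1 + 1 * n] (mod (a - 1))"
    by (intro cong_add cong_mult a1 Suc.IH)
  then show "[pell_y a (Suc n) = Suc n] (mod (a - 1))" by simp
qed simp_all

text \<open>With M the modulus, one step of the recursion sends x - (a - k) y to k (x - (a - k) y) +
  M y, so modulo M it multiplies by k.\<close>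

lemma pell_power_cong:
  assumes k: "1 \<le> k" "k < a"
  shows "[pell_x a n + k * pell_y a n = a * pell_y a n + k ^ n] (mod (2 * a * k - k * k - 1))"
proof -
  define M where "M = 2 * int a * int k - int k * int k - 1"
  have "k * k + 1 \<le> 2 * a * k"
  proof -
    have "k * k + k * 1 \<le> k * k + k * k" using k by (intro add_mono mult_le_mono) auto
    also have "\<dots> \<le> a * k + a * k" using k by (intro add_mono mult_le_mono) auto
    finally show ?thesis using k by simp
  qed
  then have M: "int (2 * a * k - k * k - 1) = M" unfolding M_def by (simp add: of_nat_diff)
  have "1 \<le> a * a" using k mult_le_mono[of 1 a 1 a] by simp
  then have d: "int (a * a - 1) = int a * int a - 1" by (simp add: of_nat_diff)
  have "M dvd int (pell_x a n) - (int a - int k) * int (pell_y a n) - int k ^ n"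
  proof (induction n)
    case (Suc n)
    define x y where "x = int (pell_x a n)" and "y = int (pell_y a n)"
    have "M dvd int k * (x - (int a - int k) * y - int k ^ n) + M * y"
      using Suc unfolding x_def y_def by (rule dvd_add[OF dvd_mult dvd_triv_left])
    also have "int k * (x - (int a - int k) * y - int k ^ n) + M * y =
        int (pell_x a (Suc n)) - (int a - int k) * int (pell_y a (Suc n)) - int k ^ Suc n"
      unfolding pell_x.simps pell_y.simps of_nat_add of_nat_mult d x_def[symmetric] y_def[symmetric] M_def
      by (simp add: algebra_simps)
    finally show ?case .
  qed simp
  moreover have "int (pell_x a n) - (int a - int k) * int (pell_y a n) - int k ^ n =
     int (pell_x a n + k * pell_y a n) - int (a * pell_y a n + k ^ n)"
    by (simp add: algebra_simps)
  ultimately have "[int (pell_x a n + k * pell_y a n) = int (a * pell_y a n + k ^ n)] (mod int (2 * a * k - k * k - 1))"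
    unfolding M by (simp only: cong_iff_dvd_diff)
  then show ?thesis by (simp only: cong_int_iff)
qed

text \<open>The lower estimate excludes large indices in the soundness proof; the upper one lets the
  witness y fit below m.\<close>

lemma pell_growth:
  assumes "a \<ge> 2"
  shows "pell_x a n \<le> (2 * a) ^ n" "a * pell_y a n \<le> (2 * a) ^ n" "a ^ n \<le> pell_x a n"
proof (induction n)
  case (Suc n)
  have 1: "(a * a - 1) * pell_y a n \<le> a * (a * pell_y a n)" by (simp add: diff_mult_distrib)
  have 2: "a * (a * pell_y a n) \<le> a * (2 * a) ^ n" by (rule mult_le_mono2[OF Suc(2)])
  have 3: "a * pell_x a n \<le> a * (2 * a) ^ n" by (rule mult_le_mono2[OF Suc(1)])
  have 4: "a * a ^ n \<le> a * pell_x a n" by (rule mult_le_mono2[OF Suc(3)])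
  have 5: "(2 * a) ^ Suc n = a * (2 * a) ^ n + a * (2 * a) ^ n" by (simp only: power_Suc mult_2 add_mult_distrib)
  show "pell_x a (Suc n) \<le> (2 * a) ^ Suc n"
    unfolding 5 pell_x.simps using 1 2 3 by linarith
  show "a * pell_y a (Suc n) \<le> (2 * a) ^ Suc n"
    unfolding 5 pell_y.simps add_mult_distrib2 using 2 3 by linarith
  show "a ^ Suc n \<le> pell_x a (Suc n)"
    unfolding pell_x.simps power_Suc using 4 by linarith
qed simp_all

lemma pell_y_mono:
  assumes "a \<ge> 2" "m \<le> n"
  shows "pell_y a m \<le> pell_y a n"
  using assms(2)
proof (induction n rule: dec_induct)
  case (step n)
  have "pell_y a n * 1 \<le> pell_y a n * a" using assms by (intro mult_le_mono2) simp
  then have "pell_y a n \<le> pell_y a (Suc n)" unfolding pell_y.simps mult.commute[of a] by linarith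
  with step show ?case by linarith
qed simp


lemma exp_beats_power:
  assumes c: "c \<ge> (1::nat)"
  shows "\<exists>a0::nat. \<forall>a\<ge>a0. 3 * (2 * a) ^ n \<le> 2 ^ (a div c)"
proof -
  have ev: "eventually (\<lambda>q::real. 3 * (K * (q + 1)) powr n \<le> 2 powr q) at_top" if "K > 0" "n \<ge> 0" for K n :: real
    using that by real_asymp
  have "2 * real c > 0" using c by simp
  from ev[OF this of_nat_0_le_iff[of n]]
  have "\<exists>q0. \<forall>q\<ge>q0. 3 * (2 * real c * (q + 1)) powr real n \<le> 2 powr q"
    unfolding eventually_at_top_linorder .
  then obtain q0 where q0: "\<forall>q\<ge>q0. 3 * (2 * real c * (q + 1)) powr real n \<le> 2 powr q" ..
  show ?thesis
  proof (rule exI[of _ "nat \<lceil>q0\<rceil> * c"], intro allI impI)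
    fix a assume a: "nat \<lceil>q0\<rceil> * c \<le> a"
    have "0 < c" using c by linarith
    with a have "nat \<lceil>q0\<rceil> \<le> a div c" by (simp only: less_eq_div_iff_mult_less_eq)
    then have "real (nat \<lceil>q0\<rceil>) \<le> real (a div c)" by (rule of_nat_mono)
    then have "q0 \<le> real (a div c)" using real_nat_ceiling_ge[of q0] by linarith
    then have 1: "3 * (2 * real c * (real (a div c) + 1)) powr real n \<le> 2 powr real (a div c)"
      using q0 by (elim allE impE)
    have "a < c * (a div c + 1)" using c dividend_less_times_div[of c a] by simp
    then have "(2 * a) ^ n \<le> (2 * (c * (a div c + 1))) ^ n" by (intro power_mono mult_le_mono2) auto
    then have "real (3 * (2 * a) ^ n) \<le> real (3 * (2 * (c * (a div c + 1))) ^ n)"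
      by (intro of_nat_mono mult_le_mono2)
    also have "\<dots> = 3 * (2 * real c * (real (a div c) + 1)) powr real n"
    proof -
      have "2 * real c * (real (a div c) + 1) > 0" using c by (intro mult_pos_pos) simp_all
      then show ?thesis by (simp add: powr_realpow algebra_simps)
    qed
    also note 1
    also have "2 powr real (a div c) = real (2 ^ (a div c))" by (subst powr_realpow) simp_all
    finally show "3 * (2 * a) ^ n \<le> 2 ^ (a div c)" by (rule of_nat_le_iff[THEN iffD1])
  qed
qed


text \<open>Julia Robinson's definition of exponentiation from a relation of roughly exponential growth:
  the bound \<open>y \<le> m\<close> forces the index of a Pell solution below \<open>a - 1\<close>, where it is determined by a congruence.\<close>

definition pell_power :: "(nat \<Rightarrow> nat \<Rightarrow> bool) \<Rightarrow> nat \<Rightarrow> nat \<Rightarrow> nat \<Rightarrow> nat \<Rightarrow> bool" where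
  "pell_power H c w k n \<longleftrightarrow> (\<exists>m' k' m a x y. H m' k' \<and> c * (n * k) \<le> k' \<and> H m a \<and>
     3 * m' < a \<and> n + 1 < a \<and> k < a \<and> 16 \<le> a \<and> x * x = (a * a - 1) * (y * y) + 1 \<and>
     y \<le> m \<and> [y = n] (mod (a - 1)) \<and> w < 2 * a * k - k * k - 1 \<and>
     [x + k * y = a * y + w] (mod (2 * a * k - k * k - 1)))"

text \<open>Robinson's growth hypothesis in two-sided form: the upper bound keeps Pell indices
  small, the lower bound leaves room for the intended solution.\<close>

locale rough_exponential =
  fixes H :: "nat \<Rightarrow> nat \<Rightarrow> bool" and c :: nat
  assumes H_upper: "H m k \<Longrightarrow> m \<le> 4 ^ (k + 2)"
    and H_lower: "H m k \<Longrightarrow> c * q \<le> k \<Longrightarrow> 2 ^ q \<le> 3 * m"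
    and H_exists: "\<exists>m k. b \<le> k \<and> H m k"
    and c_pos: "c \<ge> 1"
begin

text \<open>The reason for the pair m', k' in \<open>pell_power\<close>: k^n \<le> 2^(n k) \<le> 3
  m' < a certifies without exponentiation that the modulus exceeds k^n, so the congruence determines
  it.\<close>

lemma power_less_modulus:
  assumes "H m' k'" "c * (n * k) \<le> k'" "3 * m' < a" "k < a" "1 \<le> k"
  shows "k ^ n < 2 * a * k - k * k - 1"
proof -
  have "k \<le> 2 ^ k" using less_exp[of k] by linarith
  then have "k ^ n \<le> (2 ^ k) ^ n" by (intro power_mono) auto
  also have "\<dots> = 2 ^ (n * k)" by (simp only: power_mult[symmetric] mult.commute)
  also have "\<dots> \<le> 3 * m'" by (rule H_lower[OF assms(1,2)])
  finally have "k ^ n < a" using assms(3) by linarith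
  moreover have "k * (k + 1) \<le> k * a" using assms by (intro mult_le_mono2) auto
  moreover have "1 * a \<le> k * a" using assms by (intro mult_le_mono1) auto
  moreover have "2 * a * k = k * a + k * a" "k * (k + 1) = k * k + k" by (simp_all add: algebra_simps)
  ultimately show ?thesis using assms(5) by linarith
qed

lemma pell_power_sound:
  assumes "pell_power H c w k n" "1 \<le> k"
  shows "w = k ^ n"
proof -
  obtain m' k' m a x y where h: "H m' k'" "c * (n * k) \<le> k'" "H m a" "3 * m' < a" "n + 1 < a" "k < a" "16 \<le> a"
    and eq: "x * x = (a * a - 1) * (y * y) + 1" and y: "y \<le> m" "[y = n] (mod (a - 1))"
    and w: "w < 2 * a * k - k * k - 1" "[x + k * y = a * y + w] (mod (2 * a * k - k * k - 1))"
    using assms(1) unfolding pell_power_def by (elim exE conjE)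
  have a2: "a \<ge> 2" using h(7) by linarith
  obtain i where x_i: "x = pell_x a i" and y_i: "y = pell_y a i"
    using pell_solution[OF a2 eq] by (elim exE conjE)
  \<comment> \<open>An index of at least a - 1 would give y \<ge> a^(a - 2). For a \<ge> 16 this
    exceeds 4^(a + 2), an upper bound for m.\<close>
  have "i < a - 1"
  proof (rule ccontr)
    assume "\<not> ?thesis"
    then have "pell_y a (a - 1) \<le> y" unfolding y_i by (intro pell_y_mono a2) linarith
    moreover have "a ^ (a - 2) \<le> pell_y a (a - 1)"
    proof -
      have "a - 1 = Suc (a - 2)" using a2 by linarith
      moreover have "a ^ (a - 2) \<le> pell_x a (a - 2)" by (rule pell_growth(3)[OF a2])
      ultimately show ?thesis using pell_y.simps(2)[of a "a - 2"] by (simp only:)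
    qed
    moreover have "4 ^ (a + 2) < a ^ (a - 2)"
    proof -
      have "(4::nat) ^ (a + 2) < 4 ^ (2 * (a - 2))" using h(7) by (intro power_strict_increasing) auto
      also have "\<dots> = 16 ^ (a - 2)" by (simp add: power_mult)
      also have "\<dots> \<le> a ^ (a - 2)" using h(7) by (intro power_mono) auto
      finally show ?thesis .
    qed
    moreover have "m \<le> 4 ^ (a + 2)" by (rule H_upper[OF h(3)])
    ultimately show False using y(1) by linarith
  qed
  moreover have "n < a - 1" using h(5) by linarith
  moreover have "[i = n] (mod (a - 1))"
    using cong_trans[OF cong_sym[OF pell_y_cong(2)[OF a2, of i]]] y(2) unfolding y_i .
  ultimately have i: "i = n" using cong_less_modulus_unique_nat[of i n "a - 1"] by (simp only:)
  have "[a * y + k ^ n = a * y + w] (mod (2 * a * k - k * k - 1))"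
    using cong_trans[OF cong_sym[OF pell_power_cong[OF assms(2) h(6), of n]]] w(2) unfolding x_i y_i i .
  then have "[k ^ n = w] (mod (2 * a * k - k * k - 1))" by (simp only: cong_add_lcancel_nat)
  from cong_less_modulus_unique_nat[OF this power_less_modulus[OF h(1,2,4,6) assms(2)] w(1)]
  show ?thesis by (rule sym)
qed

lemma pell_power_complete:
  assumes k: "1 \<le> k"
  shows "pell_power H c (k ^ n) k n"
proof -
  obtain m' k' where h': "c * (n * k) \<le> k'" "H m' k'" using H_exists[of "c * (n * k)"] by (elim exE conjE)
  obtain a0 where a0: "\<forall>a\<ge>a0. 3 * (2 * a) ^ n \<le> 2 ^ (a div c)"
    using exp_beats_power[OF c_pos, of n] by (elim exE)
  \<comment> \<open>The summand a0 ensures (2 a)^n \<le> m; the others meet the side conditions of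
    \<open>pell_power\<close>.\<close>
  obtain m a where a: "a0 + 3 * m' + n + k + 18 \<le> a" and h: "H m a"
    using H_exists[of "a0 + 3 * m' + n + k + 18"] by (elim exE conjE)
  have a2: "a \<ge> 2" and ka: "k < a" using a by linarith+
  have "3 * (2 * a) ^ n \<le> 2 ^ (a div c)" by (rule a0[rule_format]) (use a in linarith)
  also have "\<dots> \<le> 3 * m" by (rule H_lower[OF h]) simp
  finally have "(2 * a) ^ n \<le> m" by linarith
  moreover have "1 * pell_y a n \<le> a * pell_y a n" using a2 by (intro mult_le_mono1) linarith
  ultimately have "pell_y a n \<le> m" using pell_growth(2)[OF a2, of n] by linarith
  moreover have "k ^ n < 2 * a * k - k * k - 1"
    by (rule power_less_modulus[OF h'(2,1) _ ka k]) (use a in linarith)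
  moreover have "3 * m' < a" "n + 1 < a" "16 \<le> a" using a by linarith+
  ultimately show ?thesis
    unfolding pell_power_def
    using h'(2,1) h ka pell_equation[OF a2, of n] pell_y_cong(2)[OF a2, of n] pell_power_cong[OF k ka, of n]
    by (intro exI conjI)
qed

lemma power_iff:
  "w = k ^ n \<longleftrightarrow> (k = 0 \<and> n = 0 \<and> w = 1) \<or> (k = 0 \<and> 1 \<le> n \<and> w = 0) \<or> (1 \<le> k \<and> pell_power H c w k n)"
proof (cases "k = 0")
  case True
  then show ?thesis by (cases n) auto
next
  case False
  then have k: "1 \<le> k" by simp
  have "w = k ^ n \<longleftrightarrow> pell_power H c w k n"
    using pell_power_sound[OF _ k] pell_power_complete[OF k] by (intro iffI) (simp_all only:)
  with False k show ?thesis by simp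
qed

end

section \<open>Binomial coefficients and factorials\<close>

lemma digit_of_sum:
  fixes f :: "nat \<Rightarrow> nat"
  assumes "\<And>i. f i < u" "k < N"
  shows "((\<Sum>i<N. f i * u ^ i) div u ^ k) mod u = f k"
proof -
  have u: "u > 0" using assms(1)[of 0] by linarith
  have low: "(\<Sum>i<j. f i * u ^ i) < u ^ j" for j
  proof (induction j)
    case (Suc j)
    have "(f j + 1) * u ^ j \<le> u * u ^ j" using assms(1)[of j] by (intro mult_le_mono1) linarith
    then have "f j * u ^ j + u ^ j \<le> u ^ Suc j" by (simp only: add_mult_distrib mult_1 power_Suc)
    moreover have "(\<Sum>i<Suc j. f i * u ^ i) = (\<Sum>i<j. f i * u ^ i) + f j * u ^ j" by (rule sum.lessThan_Suc)
    ultimately show ?case using Suc by linarith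
  qed simp
  have "\<exists>R. (\<Sum>i<N. f i * u ^ i) = (\<Sum>i<k. f i * u ^ i) + (f k + u * R) * u ^ k"
    using assms(2)
  proof (induction N)
    case (Suc M)
    show ?case
    proof (cases "k = M")
      case True
      then show ?thesis unfolding sum.lessThan_Suc by (intro exI[of _ 0]) simp
    next
      case False
      then have "k < M" using Suc.prems by linarith
      from Suc.IH[OF this] obtain R where R: "(\<Sum>i<M. f i * u ^ i) = (\<Sum>i<k. f i * u ^ i) + (f k + u * R) * u ^ k" ..
      have "M = Suc (M - k - 1) + k" using \<open>k < M\<close> by linarith
      then have "u ^ M = u * u ^ (M - k - 1) * u ^ k" by (metis power_add power_Suc)
      then have "f M * u ^ M = (u * (f M * u ^ (M - k - 1))) * u ^ k" by (simp only: mult_ac)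
      then have "(\<Sum>i<Suc M. f i * u ^ i) = (\<Sum>i<k. f i * u ^ i) + (f k + u * (R + f M * u ^ (M - k - 1))) * u ^ k"
        unfolding sum.lessThan_Suc R by (simp only: add_mult_distrib add_mult_distrib2 add.assoc)
      then show ?thesis by (rule exI)
    qed
  qed simp
  then obtain R where "(\<Sum>i<N. f i * u ^ i) = (\<Sum>i<k. f i * u ^ i) + (f k + u * R) * u ^ k" ..
  moreover have "((\<Sum>i<k. f i * u ^ i) + (f k + u * R) * u ^ k) div u ^ k = f k + u * R"
    using low[of k] u by (simp add: div_mult_self3)
  ultimately show ?thesis using assms(1)[of k] by simp
qed

text \<open>In base u = 2^n + 1 the digits of (u + 1)^n are the binomial coefficients, none of which
  exceeds 2^n.\<close>

lemma binomial_digit: "n choose k = (((2 ^ n + 1 + 1) ^ n) div (2 ^ n + 1) ^ k) mod (2 ^ n + 1)"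
proof -
  define u :: nat where "u = 2 ^ n + 1"
  have "(u + 1) ^ n = (\<Sum>i\<le>n. (n choose i) * u ^ i)"
    by (subst binomial) simp
  \<comment> \<open>Padding with zero digits makes k a valid position even for k > n.\<close>
  also have "\<dots> = (\<Sum>i<n + k + 1. (n choose i) * u ^ i)"
    by (rule sum.mono_neutral_left) auto
  finally have "((u + 1) ^ n div u ^ k) mod u = ((\<Sum>i<n + k + 1. (n choose i) * u ^ i) div u ^ k) mod u" by simp
  also have "\<dots> = n choose k"
  proof (rule digit_of_sum)
    show "n choose i < u" for i
      using binomial_le_pow2[of n i] unfolding u_def by linarith
  qed simp
  finally show ?thesis unfolding u_def by simp
qed

lemma fact_binomial_prod: "fact n * (r choose n) = (\<Prod>i<n. r - i)"
proof (induction n)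
  case (Suc n)
  have "Suc n * (r choose Suc n) = (r - n) * (r choose n)"
    by (simp only: binomial_absorption binomial_absorb_comp)
  then have "fact (Suc n) * (r choose Suc n) = fact n * (r choose n) * (r - n)"
    by (simp only: fact_Suc of_nat_id mult_ac)
  then show ?case unfolding Suc prod.lessThan_Suc .
qed simp

text \<open>The quotient is n! times r^n / (r (r - 1) ... (r - n + 1)), slightly more than n!.
  Bernoulli's inequality (1 - n / r)^n \<ge> 1 - n^2 / r and the size of r keep the excess below
  1.\<close>

lemma fact_quotient:
  assumes r: "n ^ 2 * (n ^ n + 1) < r"
  shows "r ^ n div (r choose n) = fact n"
proof (rule div_nat_eqI)
  have nr: "n \<le> r"
  proof -
    have "n * 1 \<le> n * (n * (n ^ n + 1))" by (cases "n = 0") simp_all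
    also have "\<dots> = n ^ 2 * (n ^ n + 1)" by (simp only: power2_eq_square mult.assoc)
    finally show ?thesis using r by linarith
  qed
  have "(\<Prod>i<n. r - i) \<le> (\<Prod>i<n. r)" by (rule prod_mono) simp
  then show "(r choose n) * fact n \<le> r ^ n"
    unfolding fact_binomial_prod[symmetric] by (simp add: mult.commute)
  show "r ^ n < (r choose n) * Suc (fact n)"
  proof -
    define N where "N = real (fact n)"
    have N: "N \<ge> 1" unfolding N_def by (simp only: of_nat_fact fact_ge_1)
    have rpos: "real r > 0" using r by linarith
    have Nr: "real n ^ 2 * (N + 1) < real r"
    proof -
      have "(fact n :: nat) \<le> n ^ n" using fact_le_power[of n, where 'a = nat] by simp
      then have "n ^ 2 * (fact n + 1) \<le> n ^ 2 * (n ^ n + 1)" by (intro mult_le_mono2 add_le_mono1)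
      with r have "n ^ 2 * (fact n + 1) < r" by linarith
      then have "real (n ^ 2 * (fact n + 1)) < real r" by (simp only: of_nat_less_iff)
      then show ?thesis unfolding N_def by (simp only: of_nat_mult of_nat_add of_nat_power of_nat_1)
    qed
    have "N < (N + 1) * (1 + real n * (- (real n / real r)))"
    proof -
      have "(N + 1) * (real n ^ 2 / real r) < 1"
        using Nr rpos by (simp add: field_simps)
      then show ?thesis by (simp add: algebra_simps power2_eq_square)
    qed
    also have "\<dots> \<le> (N + 1) * (1 + - (real n / real r)) ^ n"
      using N nr rpos by (intro mult_left_mono Bernoulli_inequality) simp_all
    finally have "N * real r ^ n < (N + 1) * (1 + - (real n / real r)) ^ n * real r ^ n"
      using rpos by (intro mult_strict_right_mono) simp_all
    also have "\<dots> = (N + 1) * real (r - n) ^ n"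
    proof -
      have "(1 + - (real n / real r)) * real r = real (r - n)"
        using rpos nr by (simp add: of_nat_diff algebra_simps)
      then show ?thesis by (metis mult.assoc power_mult_distrib)
    qed
    also have "\<dots> \<le> (N + 1) * real (\<Prod>i<n. r - i)"
    proof -
      have "(\<Prod>i<n. r - n) \<le> (\<Prod>i<n. r - i)" by (rule prod_mono) simp
      then have "(r - n) ^ n \<le> (\<Prod>i<n. r - i)" by simp
      then have "real ((r - n) ^ n) \<le> real (\<Prod>i<n. r - i)" by (rule of_nat_mono)
      then show ?thesis using N unfolding of_nat_power by (intro mult_left_mono) simp_all
    qed
    also have "\<dots> = (N + 1) * (N * real (r choose n))"
      unfolding fact_binomial_prod[symmetric] N_def of_nat_mult ..
    also have "\<dots> = N * real ((r choose n) * Suc (fact n))"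
      unfolding of_nat_mult of_nat_Suc N_def by (simp only: mult_ac add.commute)
    finally have "real r ^ n < real ((r choose n) * Suc (fact n))" using N by simp
    then show ?thesis by (simp only: of_nat_power[symmetric] of_nat_less_iff)
  qed
qed

locale ex_class_rough = ex_class_mult + rough_exponential +
  assumes D_H_var: "D (\<lambda>e. H (e 0) (e 1))"
begin

lemma D_H [intro]: "F a \<Longrightarrow> F b \<Longrightarrow> D (\<lambda>e. H (a e) (b e))"
  by (rule D_comp2[of H, OF D_H_var])

lemma F_power [intro]: "F a \<Longrightarrow> F b \<Longrightarrow> F (\<lambda>e. a e ^ b e)"
proof (rule F_comp2[of "(^)"])
  show "D (\<lambda>e. e 0 = e 1 ^ e 2)"
    unfolding power_iff pell_power_def
    by (intro D_ex D_disj D_conj D_H D_eq D_less D_le D_cong F_var F_const F_plus F_times F_minus)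
qed

lemma F_binomial [intro]: "F a \<Longrightarrow> F b \<Longrightarrow> F (\<lambda>e. a e choose b e)"
  unfolding binomial_digit by (intro F_mod F_div F_power F_plus F_const)

lemma F_fact [intro]: "F a \<Longrightarrow> F (\<lambda>e. fact (a e))"
proof -
  have "fact n = (n ^ 2 * (n ^ n + 1) + 1) ^ n div ((n ^ 2 * (n ^ n + 1) + 1) choose n)" for n :: nat
    by (rule fact_quotient[symmetric]) linarith
  then show "F a \<Longrightarrow> F (\<lambda>e. fact (a e))"
    by (simp only:) (intro F_div F_power F_binomial F_plus F_times F_const)
qed

end

section \<open>Elimination of a bounded universal quantifier\<close>

text \<open>Bounded quantification needs terms that respect congruences, which polynomials do and
  the prime function does not. Equations between two polynomials over the naturals replace negative
  coefficients.\<close>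

datatype polyn = PVar nat | PConst nat | PAdd polyn polyn | PMul polyn polyn

primrec peval :: "(nat \<Rightarrow> nat) \<Rightarrow> polyn \<Rightarrow> nat" where
  "peval v (PVar i) = v i"
| "peval v (PConst c) = c"
| "peval v (PAdd s t) = peval v s + peval v t"
| "peval v (PMul s t) = peval v s * peval v t"

primrec psubst :: "(nat \<Rightarrow> nat) \<Rightarrow> polyn \<Rightarrow> polyn" where
  "psubst \<sigma> (PVar i) = PVar (\<sigma> i)"
| "psubst \<sigma> (PConst c) = PConst c"
| "psubst \<sigma> (PAdd s t) = PAdd (psubst \<sigma> s) (psubst \<sigma> t)"
| "psubst \<sigma> (PMul s t) = PMul (psubst \<sigma> s) (psubst \<sigma> t)"

lemma peval_psubst: "peval v (psubst \<sigma> s) = peval (\<lambda>i. v (\<sigma> i)) s"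
  by (induction s) simp_all

lemma peval_cong_mod: "(\<And>i. [v i = w i] (mod m)) \<Longrightarrow> [peval v s = peval w s] (mod m)"
proof (induction s)
  case (PAdd s t)
  show ?case unfolding peval.simps by (rule cong_add) (rule PAdd.IH, rule PAdd.prems)+
next
  case (PMul s t)
  show ?case unfolding peval.simps by (rule cong_mult) (rule PMul.IH, rule PMul.prems)+
qed simp_all

lemma peval_mono: "(\<And>i. v i \<le> w i) \<Longrightarrow> peval v s \<le> peval w s"
  by (induction s) (simp_all add: add_mono mult_le_mono)

lemma peval_finite_support: "\<exists>m. \<forall>v w. (\<forall>i<m. v i = w i) \<longrightarrow> peval v s = peval w s"
proof (induction s)
  case (PVar i)
  show ?case by (rule exI[of _ "Suc i"]) simp
next
  case (PConst c)
  show ?case by simp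
next
  case (PAdd s t)
  then obtain m n where "\<forall>v w. (\<forall>i<m. v i = w i) \<longrightarrow> peval v s = peval w s"
    "\<forall>v w. (\<forall>i<n. v i = w i) \<longrightarrow> peval v t = peval w t" by (elim exE)
  then show ?case by (intro exI[of _ "max m n"]) (simp only: peval.simps less_max_iff_disj, metis)
next
  case (PMul s t)
  then obtain m n where "\<forall>v w. (\<forall>i<m. v i = w i) \<longrightarrow> peval v s = peval w s"
    "\<forall>v w. (\<forall>i<n. v i = w i) \<longrightarrow> peval v t = peval w t" by (elim exE)
  then show ?case by (intro exI[of _ "max m n"]) (simp only: peval.simps less_max_iff_disj, metis)
qed

definition poly_eqs :: "((nat \<Rightarrow> nat) \<Rightarrow> bool) set" where
  "poly_eqs = {\<lambda>e. peval e s = peval e t | s t. True}"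

lemma poly_eqsI: "(\<And>e. b e \<longleftrightarrow> peval e s = peval e t) \<Longrightarrow> b \<in> poly_eqs"
  unfolding poly_eqs_def by (intro CollectI exI[of _ s] exI[of _ t] conjI TrueI ext)

text \<open>This is (a - b)^2 + (c - d)^2 = 0, and the next lemma is (a - b) (c - d) = 0, with
  negative terms moved across.\<close>

lemma sum_of_squares_eq:
  fixes a b c d :: nat
  shows "a = b \<and> c = d \<longleftrightarrow> (a * a + b * b) + (c * c + d * d) = (a * b + a * b) + (c * d + c * d)"
proof -
  have "(a = b \<and> c = d) = ((int a - int b)\<^sup>2 + (int c - int d)\<^sup>2 = 0)"
    by (simp only: sum_power2_eq_zero_iff) simp
  also have "\<dots> = (int ((a * a + b * b) + (c * c + d * d)) = int ((a * b + a * b) + (c * d + c * d)))"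
    unfolding of_nat_add of_nat_mult power2_eq_square by (simp add: algebra_simps)
  finally show ?thesis by (simp only: of_nat_eq_iff)
qed

lemma product_eq_zero:
  fixes a b c d :: nat
  shows "a = b \<or> c = d \<longleftrightarrow> a * c + b * d = a * d + b * c"
proof -
  have "(a = b \<or> c = d) = ((int a - int b) * (int c - int d) = 0)" by simp
  also have "\<dots> = (int (a * c + b * d) = int (a * d + b * c))"
    unfolding of_nat_add of_nat_mult by (simp add: algebra_simps)
  finally show ?thesis by (simp only: of_nat_eq_iff)
qed

lemma poly_eqs_ex_class: "ex_class poly_eqs"
proof
  fix b and \<sigma> :: "nat \<Rightarrow> nat" assume "b \<in> poly_eqs"
  then obtain s t where b: "b = (\<lambda>e. peval e s = peval e t)" unfolding poly_eqs_def by blast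
  show "(\<lambda>e. b (\<lambda>i. e (\<sigma> i))) \<in> poly_eqs"
    unfolding b peval_psubst[symmetric] by (rule poly_eqsI) (rule refl)
next
  fix b c assume "b \<in> poly_eqs" "c \<in> poly_eqs"
  then obtain s t s' t' where b: "b = (\<lambda>e. peval e s = peval e t)" and c: "c = (\<lambda>e. peval e s' = peval e t')"
    unfolding poly_eqs_def by blast
  show "(\<lambda>e. b e \<and> c e) \<in> poly_eqs"
    unfolding b c sum_of_squares_eq peval.simps(3,4)[symmetric] by (rule poly_eqsI) (rule refl)
  show "(\<lambda>e. b e \<or> c e) \<in> poly_eqs"
    unfolding b c product_eq_zero peval.simps(3,4)[symmetric] by (rule poly_eqsI) (rule refl)
next
  show "(\<lambda>e. e 0 = e 1) \<in> poly_eqs"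
    by (rule poly_eqsI[of _ "PVar 0" "PVar 1"]) simp
  show "(\<lambda>e. e 0 = e 1 + e 2) \<in> poly_eqs"
    by (rule poly_eqsI[of _ "PVar 0" "PAdd (PVar 1) (PVar 2)"]) simp
qed

interpretation dio: ex_class poly_eqs
  by (rule poly_eqs_ex_class)

interpretation dio: ex_class_mult poly_eqs
proof
  show "dio.F (\<lambda>e. 1)"
    unfolding dio.F_def by (intro dio.D_base poly_eqsI[of _ "PVar 0" "PConst 1"]) simp
  show "dio.D (\<lambda>e. e 0 = e 1 * e 2)"
    by (intro dio.D_base poly_eqsI[of _ "PVar 0" "PMul (PVar 1) (PVar 2)"]) simp
qed

text \<open>Since \<open>m k\<close> divides \<open>T - (k + 1)\<close>, the single number \<open>T - 1\<close> is congruent to every \<open>k \<le> y\<close> modulo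
  the respective \<open>m k\<close>, and the product of all moduli is a binomial coefficient.\<close>

locale dpr_modulus =
  fixes Q y T M :: nat and m :: "nat \<Rightarrow> nat"
  assumes Q3: "3 \<le> Q" and yQ: "y + 1 \<le> Q"
    and T: "T = (fact Q)\<^sup>2" and M: "M = (T - 1) choose (y + 1)" and m: "m = (\<lambda>k. T div (k + 1) - 1)"
begin

text \<open>The square in T leaves a full factor Q! after division by k + 1.\<close>

lemma T_div: "k \<le> y \<Longrightarrow> T div (k + 1) = fact Q * (fact Q div (k + 1))"
proof -
  assume "k \<le> y"
  then have "k + 1 dvd (fact Q :: nat)" using yQ by (intro dvd_fact) auto
  then show ?thesis unfolding T power2_eq_square by (rule div_mult_swap[symmetric])
qed

lemma modulus_ge: "k \<le> y \<Longrightarrow> 5 \<le> m k"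
proof -
  assume k: "k \<le> y"
  then have "k + 1 dvd (fact Q :: nat)" using yQ by (intro dvd_fact) auto
  then have "k + 1 \<le> fact Q" by (rule dvd_imp_le) simp
  then have "1 \<le> fact Q div (k + 1)" by (simp add: less_eq_div_iff_mult_less_eq)
  moreover have "(6::nat) \<le> fact Q" using fact_mono[OF Q3, where 'a = nat] by (simp add: eval_nat_numeral)
  ultimately have "6 * 1 \<le> fact Q * (fact Q div (k + 1))" by (rule mult_le_mono[rotated])
  then show ?thesis unfolding m T_div[OF k] by simp
qed

lemma modulus_mult: "k \<le> y \<Longrightarrow> m k * (k + 1) = T - 1 - k"
proof -
  assume k: "k \<le> y"
  then have "k + 1 dvd (fact Q :: nat)" using yQ by (intro dvd_fact) auto
  then have "k + 1 dvd T" unfolding T power2_eq_square by (rule dvd_mult2)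
  then have "T div (k + 1) * (k + 1) = T" by (rule dvd_div_mult_self)
  then show ?thesis unfolding m diff_mult_distrib by simp
qed

lemma T_cong:
  assumes k: "k \<le> y"
  shows "[T - 1 = k] (mod m k)"
proof -
  have "5 * 1 \<le> m k * (k + 1)" using modulus_ge[OF k] by (intro mult_le_mono) auto
  then have "T - 1 = m k * (k + 1) + k" using modulus_mult[OF k] by linarith
  moreover have "[m k * (k + 1) + k = 0 + k] (mod m k)"
    by (intro cong_add cong_refl) (simp add: cong_0_iff)
  ultimately show ?thesis by simp
qed

text \<open>A prime up to Q divides Q! and hence m k + 1, so it cannot divide m k.\<close>

lemma prime_modulus:
  assumes k: "k \<le> y" and p: "prime p" "p dvd m k"
  shows "Q < p"
proof (rule ccontr)
  assume "\<not> Q < p"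
  then have "p dvd fact Q" using p(1) by (intro dvd_fact) (auto simp: prime_ge_Suc_0_nat)
  then have "p dvd T div (k + 1)" unfolding T_div[OF k] by (rule dvd_mult2)
  moreover have "T div (k + 1) = m k + 1" using modulus_ge[OF k] unfolding m by linarith
  ultimately have "p dvd 1" using p(2) by (metis dvd_add_right_iff)
  with p(1) show False by simp
qed

text \<open>Modulo a common prime p both k and l would be congruent to T - 1, but k, l < Q <
  p.\<close>

lemma modulus_coprime:
  assumes "k \<le> y" "l \<le> y" "k \<noteq> l"
  shows "coprime (m k) (m l)"
proof (rule ccontr)
  assume "\<not> coprime (m k) (m l)"
  then have "gcd (m k) (m l) \<noteq> 1" by (simp only: coprime_iff_gcd_eq_1 not_False_eq_True)
  then obtain p where p: "prime p" "p dvd gcd (m k) (m l)" using prime_factor_nat by blast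
  then have pk: "p dvd m k" and pl: "p dvd m l" by auto
  have "[k = l] (mod p)"
    using cong_dvd_modulus_nat[OF T_cong[OF assms(1)] pk] cong_dvd_modulus_nat[OF T_cong[OF assms(2)] pl]
    by (metis cong_sym cong_trans)
  moreover have "Q < p" by (rule prime_modulus[OF assms(1) p(1) pk])
  then have "k < p" "l < p" using assms yQ by linarith+
  ultimately show False using assms(3) cong_less_modulus_unique_nat by blast
qed

text \<open>The numerator of the binomial coefficient is the product of the T - 1 - k = m k (k + 1),
  and the factors k + 1 make up the denominator (y + 1)!.\<close>

lemma M_eq: "M = (\<Prod>k\<le>y. m k)"
proof -
  have "fact (y + 1) * M = (\<Prod>k<y + 1. T - 1 - k)"
    unfolding M by (rule fact_binomial_prod)
  also have "\<dots> = (\<Prod>k\<le>y. m k * (k + 1))"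
    using modulus_mult by (intro prod.cong) auto
  also have "\<dots> = (\<Prod>k\<le>y. m k) * (\<Prod>k\<le>y. k + 1)" by (rule prod.distrib)
  also have "(\<Prod>k\<le>y. k + 1) = fact (y + 1)"
    by (induction y) simp_all
  finally show ?thesis by simp
qed

end


text \<open>Each number \<open>a i\<close> codes the i-th witness for all k at once, as its residue
  modulo m k, and T - 1 plays the quantified variable. The divisibility says that M divides a i (a i
  - 1) ... (a i - b), bounding the coded residues by b. The bound Q on polynomial values turns a
  congruence back into an equation.\<close>

definition dpr_witness :: "polyn \<Rightarrow> polyn \<Rightarrow> nat \<Rightarrow> nat \<Rightarrow> (nat \<Rightarrow> nat) \<Rightarrow> nat \<Rightarrow> nat \<Rightarrow> nat \<Rightarrow> nat \<Rightarrow> (nat \<Rightarrow> nat) \<Rightarrow> bool" where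
  "dpr_witness s t n y e b Q T M a \<longleftrightarrow> T = (fact Q)\<^sup>2 \<and> M = ((T - 1) choose (y + 1)) \<and> 3 \<le> Q \<and> y + 1 \<le> Q \<and>
     peval (mix (case_nat y e) (\<lambda>_. b)) s + peval (mix (case_nat y e) (\<lambda>_. b)) t \<le> Q \<and>
     (\<forall>i<n. M dvd fact (b + 1) * (a i choose (b + 1))) \<and>
     [peval (mix (case_nat (T - 1) e) a) s = peval (mix (case_nat (T - 1) e) a) t] (mod M)"

text \<open>One prime divisor p of m k is enough: it divides some factor a i - j with j \<le> b,
  which decodes the witness, and p > Q exceeds both polynomial values.\<close>

lemma dpr_sound:
  assumes wit: "dpr_witness s t n y e b Q T M a" and k: "k \<le> y"
    and supp: "\<And>u v e. (\<And>i. i < n \<Longrightarrow> u i = v i) \<Longrightarrow> peval (mix e u) s = peval (mix e v) s"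
      "\<And>u v e. (\<And>i. i < n \<Longrightarrow> u i = v i) \<Longrightarrow> peval (mix e u) t = peval (mix e v) t"
  shows "\<exists>u. peval (mix (case_nat k e) u) s = peval (mix (case_nat k e) u) t"
proof -
  define m where "m = (\<lambda>k. T div (k + 1) - 1)"
  note W = wit[unfolded dpr_witness_def]
  interpret dpr_modulus Q y T M m
    by unfold_locales (use W in \<open>simp_all only: m_def\<close>)
  have "m k \<noteq> 1" using modulus_ge[OF k] by linarith
  then obtain p where p: "prime p" "p dvd m k" using prime_factor_nat by blast
  have Qp: "Q < p" by (rule prime_modulus[OF k p])
  have "m k dvd M" unfolding M_eq using k by (intro dvd_prodI) auto
  with p have pM: "p dvd M" by (metis dvd_trans)
  have ex: "\<exists>v. (i < n \<longrightarrow> v \<le> b) \<and> [a i = v] (mod p)" for i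
  proof (cases "i < n")
    case True
    then have "M dvd fact (b + 1) * (a i choose (b + 1))" using W by (elim conjE allE impE)
    with pM have "p dvd (\<Prod>j<b + 1. a i - j)" unfolding fact_binomial_prod by (metis dvd_trans)
    then obtain j where j: "j < b + 1" "p dvd a i - j"
      unfolding prime_dvd_prod_iff[OF finite_lessThan p(1)] lessThan_iff by (elim bexE) (simp only: lessThan_iff)
    show ?thesis
    proof (cases "j \<le> a i")
      case True
      have "[(a i - j) + j = 0 + j] (mod p)" using j(2) by (intro cong_add cong_refl) (simp add: cong_0_iff)
      then have "[a i = j] (mod p)" using True by simp
      with j(1) show ?thesis by (intro exI[of _ j]) simp
    next
      \<comment> \<open>Subtraction is truncated here, but then a i < j \<le> b is already a small
        residue.\<close>
      case False
      with j(1) show ?thesis by (intro exI[of _ "a i"]) simp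
    qed
  next
    case False
    then show ?thesis by (intro exI[of _ "a i"]) simp
  qed
  then obtain v where v: "\<And>i. i < n \<Longrightarrow> v i \<le> b" "\<And>i. [a i = v i] (mod p)" by metis
  \<comment> \<open>From n on v is not bounded by b, which would spoil the monotonicity bound
    below.\<close>
  define u where "u i = (if i < n then v i else 0)" for i
  have us: "peval (mix (case_nat k e) v) s = peval (mix (case_nat k e) u) s"
    and ut: "peval (mix (case_nat k e) v) t = peval (mix (case_nat k e) u) t"
    by (rule supp, simp add: u_def)+
  have "[T - 1 = k] (mod p)" by (rule cong_dvd_modulus_nat[OF T_cong[OF k] p(2)])
  then have c: "[mix (case_nat (T - 1) e) a i = mix (case_nat k e) v i] (mod p)" for i
    unfolding mix_def using v(2) by (cases "i div 2") simp_all
  have st: "[peval (mix (case_nat (T - 1) e) a) s = peval (mix (case_nat (T - 1) e) a) t] (mod p)"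
    using W pM by (elim conjE) (rule cong_dvd_modulus_nat)
  have 1: "[peval (mix (case_nat k e) u) s = peval (mix (case_nat k e) u) t] (mod p)"
    unfolding us[symmetric] ut[symmetric]
    by (rule cong_trans[OF cong_trans[OF cong_sym[OF peval_cong_mod[OF c]] st] peval_cong_mod[OF c]])
  have le: "mix (case_nat k e) u i \<le> mix (case_nat y e) (\<lambda>_. b) i" for i
    unfolding mix_def u_def using v(1) k by (cases "i div 2") simp_all
  have "peval (mix (case_nat y e) (\<lambda>_. b)) s + peval (mix (case_nat y e) (\<lambda>_. b)) t \<le> Q"
    using W by (elim conjE)
  moreover have "peval (mix (case_nat k e) u) r \<le> peval (mix (case_nat y e) (\<lambda>_. b)) r" for r
    by (rule peval_mono) (rule le)
  from this[of s] this[of t] have "peval (mix (case_nat k e) u) s \<le> peval (mix (case_nat y e) (\<lambda>_. b)) s"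
    "peval (mix (case_nat k e) u) t \<le> peval (mix (case_nat y e) (\<lambda>_. b)) t" .
  ultimately have "peval (mix (case_nat k e) u) s < p" "peval (mix (case_nat k e) u) t < p"
    using Qp by linarith+
  from cong_less_modulus_unique_nat[OF 1 this] show ?thesis by (rule exI[of _ u])
qed

text \<open>The Chinese remainder theorem merges the witnesses for all k. Then m k divides a i - u k
  i, a factor of the falling product, and coprimality passes from the m k to M.\<close>

lemma dpr_complete:
  assumes ex: "\<And>k. k \<le> y \<Longrightarrow> \<exists>u. peval (mix (case_nat k e) u) s = peval (mix (case_nat k e) u) t"
  shows "\<exists>b Q T M a. dpr_witness s t n y e b Q T M a"
proof -
  obtain u where u: "\<And>k. k \<le> y \<Longrightarrow> peval (mix (case_nat k e) (u k)) s = peval (mix (case_nat k e) (u k)) t"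
    using ex by metis
  define b where "b = (\<Sum>k\<le>y. \<Sum>i<n. u k i)"
  have ub: "u k i \<le> b" if "k \<le> y" "i < n" for k i
  proof -
    have "u k i \<le> (\<Sum>i<n. u k i)" using that by (intro member_le_sum) auto
    also have "\<dots> \<le> b" unfolding b_def using that by (intro member_le_sum) auto
    finally show ?thesis .
  qed
  define Q where "Q = 3 + (y + 1) + (peval (mix (case_nat y e) (\<lambda>_. b)) s + peval (mix (case_nat y e) (\<lambda>_. b)) t)"
  define T :: nat where "T = (fact Q)\<^sup>2"
  define M where "M = (T - 1) choose (y + 1)"
  define m where "m = (\<lambda>k. T div (k + 1) - 1)"
  have Q: "3 \<le> Q" "y + 1 \<le> Q"
    "peval (mix (case_nat y e) (\<lambda>_. b)) s + peval (mix (case_nat y e) (\<lambda>_. b)) t \<le> Q"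
    unfolding Q_def by linarith+
  interpret dpr_modulus Q y T M m
    by unfold_locales (fact Q T_def M_def m_def)+
  have "\<exists>x. \<forall>k\<in>{..y}. [x = u k i] (mod m k)" for i
    by (rule chinese_remainder_nat) (auto intro: modulus_coprime)
  then obtain a where a: "\<And>i k. k \<le> y \<Longrightarrow> [a i = u k i] (mod m k)" by (metis atMost_iff)
  have "M dvd fact (b + 1) * (a i choose (b + 1))" if "i < n" for i
    unfolding M_eq
  proof (rule prod_coprime_dvd)
    fix k assume "k \<in> {..y}"
    then have k: "k \<le> y" by simp
    have "m k dvd a i - u k i"
    proof (cases "u k i \<le> a i")
      case True
      have "[(a i - u k i) + u k i = 0 + u k i] (mod m k)" using a[OF k, of i] True by simp
      then have "[a i - u k i = 0] (mod m k)" by (simp only: cong_add_rcancel_nat)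
      then show ?thesis by (simp only: cong_0_iff)
    qed simp
    also have "a i - u k i dvd (\<Prod>j<b + 1. a i - j)"
      using ub[OF k that] by (intro dvd_prodI) auto
    finally show "m k dvd fact (b + 1) * (a i choose (b + 1))" unfolding fact_binomial_prod .
  qed (auto intro: modulus_coprime)
  moreover have "[peval (mix (case_nat (T - 1) e) a) s = peval (mix (case_nat (T - 1) e) a) t] (mod M)"
    unfolding M_eq
  proof (rule coprime_cong_prod_nat)
    fix k assume "k \<in> {..y}"
    then have k: "k \<le> y" by simp
    have c: "[mix (case_nat (T - 1) e) a i = mix (case_nat k e) (u k) i] (mod m k)" for i
      unfolding mix_def using a[OF k] T_cong[OF k] by (cases "i div 2") simp_all
    show "[peval (mix (case_nat (T - 1) e) a) s = peval (mix (case_nat (T - 1) e) a) t] (mod m k)"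
    proof -
      have cc: "[peval (mix (case_nat (T - 1) e) a) r = peval (mix (case_nat k e) (u k)) r] (mod m k)" for r
        by (rule peval_cong_mod) (rule c)
      from cong_trans[OF cc[of s, unfolded u[OF k]] cong_sym[OF cc[of t]]] show ?thesis .
    qed
  qed (auto intro: modulus_coprime)
  ultimately have "dpr_witness s t n y e b Q T M a"
    unfolding dpr_witness_def using T_def M_def Q by (intro conjI allI impI)
  then show ?thesis by (intro exI)
qed

context ex_class
begin

text \<open>Witnesses form an infinite sequence, so half of them can hold a whole function; this
  covers the sequence a in \<open>dpr_witness\<close>.\<close>

lemma D_ex_fun [intro]:
  assumes "D (\<lambda>e. R (\<lambda>i. e (2 * i)) (\<lambda>i. e (Suc (2 * i))))"
  shows "D (\<lambda>e. \<exists>a. R e a)"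
proof -
  from assms obtain b where b: "b \<in> B" "\<forall>e. R (\<lambda>i. e (2 * i)) (\<lambda>i. e (Suc (2 * i))) = (\<exists>u. b (mix e u))"
    by (rule D_E)
  have R: "R e a = (\<exists>u. b (mix (mix e a) u))" for e a
    using b(2)[THEN spec, of "mix e a"] by (simp only: mix_simps)
  define c where "c = (\<lambda>e. b (\<lambda>i. e (mix (mix (\<lambda>i. 2 * i) (\<lambda>i. Suc (2 * (2 * i)))) (\<lambda>i. Suc (2 * Suc (2 * i))) i)))"
  have c: "c (mix e u) = b (mix (mix e (\<lambda>i. u (2 * i))) (\<lambda>i. u (Suc (2 * i))))" for e u
    unfolding c_def mix_comp by (simp only: mix_simps)
  have "c \<in> B" unfolding c_def by (rule B_rename[OF b(1)])
  then show ?thesis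
  proof (rule D_I)
    fix e assume "\<exists>a. R e a"
    then obtain a u where u: "b (mix (mix e a) u)" unfolding R by (elim exE)
    show "\<exists>u. c (mix e u)"
      by (rule exI[of _ "mix a u"], unfold c) (simp only: mix_simps u)
  next
    fix e u assume "c (mix e u)"
    then show "\<exists>a. R e a" unfolding c R by (intro exI)
  qed
qed

end

context ex_class_mult
begin

lemma F_peval: "(\<And>i. F (\<lambda>e. f e i)) \<Longrightarrow> F (\<lambda>e. peval (f e) p)"
  by (induction p) (simp_all only: peval.simps F_const F_plus F_times)

lemma D_all_less_const:
  assumes "\<And>i. D (\<lambda>e. R i e)"
  shows "D (\<lambda>e. \<forall>i<(n::nat). R i e)"
proof (induction n)
  case (Suc n)
  have "D (\<lambda>e. R n e \<and> (\<forall>i<n. R i e))" by (intro D_conj assms Suc)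
  then show ?case by (simp only: All_less_Suc)
qed (simp add: D_const)

lemma F_mix_case_nat:
  assumes "F k" "\<And>i. F (\<lambda>e. g e i)" "\<And>i. F (\<lambda>e. h e i)"
  shows "F (\<lambda>e. mix (case_nat (k e) (g e)) (h e) i)"
  unfolding mix_def by (cases "even i"; cases "i div 2") (simp_all only: if_True if_False nat.case assms)

end

context ex_class_rough
begin

theorem bounded_forall_poly:
  assumes R: "dio.D R"
  shows "D (\<lambda>e. \<forall>k\<le>e 0. R (case_nat k e))"
proof -
  from R obtain b where "b \<in> poly_eqs" "\<forall>e. R e = (\<exists>u. b (mix e u))" by (rule dio.D_E)
  then obtain s t where st: "\<And>e. R e = (\<exists>u. peval (mix e u) s = peval (mix e u) t)"
    unfolding poly_eqs_def by blast
  obtain n1 n2 where n1: "\<forall>v w. (\<forall>i<n1. v i = w i) \<longrightarrow> peval v s = peval w s"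
    and n2: "\<forall>v w. (\<forall>i<n2. v i = w i) \<longrightarrow> peval v t = peval w t"
    using peval_finite_support by metis
  define n where "n = n1 + n2"
  have s: "peval (mix e u) s = peval (mix e v) s" if "\<And>i. i < n \<Longrightarrow> u i = v i" for e u v
    by (rule n1[rule_format]) (simp add: mix_def that n_def)
  have t: "peval (mix e u) t = peval (mix e v) t" if "\<And>i. i < n \<Longrightarrow> u i = v i" for e u v
    by (rule n2[rule_format]) (simp add: mix_def that n_def)
  have "(\<forall>k\<le>e 0. R (case_nat k e)) = (\<exists>b Q T M a. dpr_witness s t n (e 0) e b Q T M a)" for e
    unfolding st
  proof (rule iffI)
    assume "\<exists>b Q T M a. dpr_witness s t n (e 0) e b Q T M a"
    then obtain b Q T M a where w: "dpr_witness s t n (e 0) e b Q T M a" by (elim exE)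
    show "\<forall>k\<le>e 0. \<exists>u. peval (mix (case_nat k e) u) s = peval (mix (case_nat k e) u) t"
      by (intro allI impI dpr_sound[OF w] s t)
  qed (rule dpr_complete, simp only:)
  moreover have "D (\<lambda>e. \<exists>b Q T M a. dpr_witness s t n (e 0) e b Q T M a)"
    unfolding dpr_witness_def
    by (intro D_ex D_ex_fun D_conj D_all_less_const D_eq D_le D_dvd D_cong F_peval F_mix_case_nat F_fact
        F_binomial F_plus F_minus F_times F_power_const F_const F_var)
  ultimately show ?thesis by (simp only:)
qed

end

section \<open>Graphs of partial recursive functions\<close>

text \<open>Davis normal form.\<close>

definition NF :: "((nat \<Rightarrow> nat) \<Rightarrow> bool) \<Rightarrow> bool" where
  "NF R \<longleftrightarrow> (\<exists>S. dio.D S \<and> (\<forall>e. R e = (\<exists>z. \<forall>k\<le>z. S (case_nat k (case_nat z e)))))"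

lemma (in ex_class_rough) D_of_NF:
  assumes "NF R"
  shows "D R"
proof -
  from assms obtain S where S: "dio.D S" "\<And>e. R e = (\<exists>z. \<forall>k\<le>z. S (case_nat k (case_nat z e)))"
    unfolding NF_def by blast
  have eta: "case_nat (e 0) (\<lambda>i. e (Suc i)) = e" for e :: "nat \<Rightarrow> nat"
    by (rule ext) (simp split: nat.split)
  have "D (\<lambda>e. \<exists>z. \<forall>k\<le>z. S (case_nat k (case_nat z e)))"
    by (rule D_ex) (unfold eta, rule bounded_forall_poly[OF S(1)])
  then show ?thesis unfolding S(2) .
qed

lemma NF_I:
  assumes "dio.D (\<lambda>e. S (e 0) (e (Suc 0)) (\<lambda>i. e (Suc (Suc i))))"
    "\<And>e. R e = (\<exists>z. \<forall>k\<le>z. S k z e)"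
  shows "NF R"
  unfolding NF_def
  by (rule exI, rule conjI[OF assms(1)], unfold nat.case, rule allI, rule assms(2))

text \<open>The matrix of a normal form in a shape that permits definable terms for k and z and
  renaming of the parameters.\<close>

definition dio_ternary :: "(nat \<Rightarrow> nat \<Rightarrow> (nat \<Rightarrow> nat) \<Rightarrow> bool) \<Rightarrow> bool" where
  "dio_ternary S \<longleftrightarrow> (\<forall>f g \<sigma>. dio.F f \<longrightarrow> dio.F g \<longrightarrow> dio.D (\<lambda>e. S (f e) (g e) (\<lambda>i. e (\<sigma> i))))"

lemma dio_ternaryD: "dio_ternary S \<Longrightarrow> dio.F f \<Longrightarrow> dio.F g \<Longrightarrow> dio.D (\<lambda>e. S (f e) (g e) (\<lambda>i. e (\<sigma> i)))"
  unfolding dio_ternary_def by (elim allE impE)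

lemma NF_E:
  assumes "NF R"
  obtains S where "dio_ternary S" "\<forall>e. R e = (\<exists>z. \<forall>k\<le>z. S k z e)"
proof -
  from assms obtain S where S: "dio.D S" "\<forall>e. R e = (\<exists>z. \<forall>k\<le>z. S (case_nat k (case_nat z e)))"
    unfolding NF_def by blast
  show ?thesis
  proof (rule that[of "\<lambda>k z e. S (case_nat k (case_nat z e))"], unfold dio_ternary_def, intro allI impI)
    fix f g and \<sigma> :: "nat \<Rightarrow> nat" assume f: "dio.F f" and g: "dio.F g"
    have "dio.D (\<lambda>e. S (\<lambda>i. e (case_nat 0 (case_nat (Suc 0) (\<lambda>i. Suc (Suc (\<sigma> i)))) i)))"
      by (rule dio.D_rename[OF S(1)])
    also have "(\<lambda>e. S (\<lambda>i. e (case_nat 0 (case_nat (Suc 0) (\<lambda>i. Suc (Suc (\<sigma> i)))) i))) =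
        (\<lambda>e. S (case_nat (e 0) (case_nat (e (Suc 0)) (\<lambda>i. e (Suc (Suc (\<sigma> i)))))))"
      by (intro ext arg_cong[where f = S]) (simp split: nat.split)
    finally have S': "dio.D (\<lambda>e. S (case_nat (e 0) (case_nat (e (Suc 0)) (\<lambda>i. e (Suc (Suc (\<sigma> i)))))))" .
    have "dio.D (\<lambda>e. \<exists>z k. k = f e \<and> z = g e \<and> S (case_nat k (case_nat z (\<lambda>i. e (\<sigma> i)))))"
      by (intro dio.D_ex dio.D_conj dio.D_graph[OF f] dio.D_graph[OF g]) (rule S')
    then show "dio.D (\<lambda>e. S (case_nat (f e) (case_nat (g e) (\<lambda>i. e (\<sigma> i)))))" by simp
  qed (rule S(2))
qed

lemma dio_prod_encode [intro]: "dio.F f \<Longrightarrow> dio.F g \<Longrightarrow> dio.F (\<lambda>e. prod_encode (f e, g e))"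
  unfolding prod_encode_def prod.case triangle_def
  by (intro dio.F_plus dio.F_div dio.F_times dio.F_Suc dio.F_const)

text \<open>The equation z = t e may stand under the quantifier over k, as k = 0 is always in its
  range.\<close>

lemma NF_dio_ball:
  assumes t: "dio.F t" and R: "dio.D (\<lambda>e. R (e 0) (\<lambda>i. e (Suc i)))"
  shows "NF (\<lambda>e. \<forall>k\<le>t e. R k e)"
proof (rule NF_I[where S = "\<lambda>k z e. z = t e \<and> R k e"])
  show "dio.D (\<lambda>e. e (Suc 0) = t (\<lambda>i. e (Suc (Suc i))) \<and> R (e 0) (\<lambda>i. e (Suc (Suc i))))"
    using dio.D_rename[OF R, of "case_nat 0 (\<lambda>i. Suc (Suc i))"]
    by (intro dio.D_conj dio.D_graph[OF t]) (simp only: nat.case)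
  show "(\<forall>k\<le>t e. R k e) = (\<exists>z. \<forall>k\<le>z. z = t e \<and> R k e)" for e
    by (metis order_refl)
qed

lemma NF_dio: "dio.D R \<Longrightarrow> NF R"
proof -
  assume R: "dio.D R"
  have "NF (\<lambda>e. \<forall>k\<le>0::nat. R e)"
    by (rule NF_dio_ball[OF dio.F_0]) (rule dio.D_rename[OF R, of Suc])
  moreover have "(\<forall>k\<le>0::nat. R e) = R e" for e by blast
  ultimately show ?thesis by (simp only:)
qed

lemma NF_rename:
  assumes "NF R"
  shows "NF (\<lambda>e. R (\<lambda>i. e (\<sigma> i)))"
proof -
  from assms obtain S where S0: "dio_ternary S" "\<forall>e. R e = (\<exists>z. \<forall>k\<le>z. S k z e)" by (rule NF_E)
  note S = dio_ternaryD[OF S0(1)] S0(2)[rule_format]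
  show ?thesis
    by (rule NF_I[where S = "\<lambda>k z e. S k z (\<lambda>i. e (\<sigma> i))"]) (intro S(1) dio.F_var, rule S(2))
qed

text \<open>Both existential values v and x are packed into one z. As x \<le> z, the bound on k can
  be raised from x to z when k > x is exempted.\<close>

lemma NF_ex [intro]:
  assumes "NF (\<lambda>e. R (e 0) (\<lambda>i. e (Suc i)))"
  shows "NF (\<lambda>e. \<exists>v. R v e)"
proof -
  from assms obtain S where S0: "dio_ternary S" "\<forall>e. R (e 0) (\<lambda>i. e (Suc i)) = (\<exists>z. \<forall>k\<le>z. S k z e)" by (rule NF_E)
  note S = dio_ternaryD[OF S0(1)] S0(2)[rule_format]
  have R: "R v e = (\<exists>z. \<forall>k\<le>z. S k z (case_nat v e))" for v e
    using S(2)[of "case_nat v e"] by (simp only: nat.case)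
  have "dio.D (\<lambda>e. \<exists>v x. e (Suc 0) = prod_encode (v, x) \<and> (x < e 0 \<or> S (e 0) x (case_nat v (\<lambda>i. e (Suc (Suc i))))))"
  proof -
    have "dio.D (\<lambda>e. S (e (Suc (Suc 0))) (e 0) (\<lambda>i. e (case_nat (Suc 0) (\<lambda>i. Suc (Suc (Suc (Suc i)))) i)))"
      by (intro S(1) dio.F_var)
    also have "(\<lambda>e. S (e (Suc (Suc 0))) (e 0) (\<lambda>i. e (case_nat (Suc 0) (\<lambda>i. Suc (Suc (Suc (Suc i)))) i))) =
       (\<lambda>e. S (e (Suc (Suc 0))) (e 0) (case_nat (e (Suc 0)) (\<lambda>i. e (Suc (Suc (Suc (Suc i)))))))"
      by (intro ext arg_cong[where f = "S (_ :: nat) (_ :: nat)"]) (simp split: nat.split)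
    finally show ?thesis
      by (intro dio.D_ex dio.D_conj dio.D_disj dio.D_eq dio.D_less dio_prod_encode dio.F_var)
  qed
  then show ?thesis
  proof (rule NF_I)
    fix e
    show "(\<exists>v. R v e) = (\<exists>z. \<forall>k\<le>z. \<exists>v x. z = prod_encode (v, x) \<and> (x < k \<or> S k x (case_nat v e)))"
    proof
      assume "\<exists>v. R v e"
      then obtain v x where x: "\<forall>k\<le>x. S k x (case_nat v e)" unfolding R by (elim exE)
      show "\<exists>z. \<forall>k\<le>z. \<exists>v x. z = prod_encode (v, x) \<and> (x < k \<or> S k x (case_nat v e))"
      proof (rule exI, intro allI impI exI conjI)
        fix k show "x < k \<or> S k x (case_nat v e)" using x by (meson not_le)
      qed (rule refl)
    next
      assume "\<exists>z. \<forall>k\<le>z. \<exists>v x. z = prod_encode (v, x) \<and> (x < k \<or> S k x (case_nat v e))"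
      then obtain z where z: "\<forall>k\<le>z. \<exists>v x. z = prod_encode (v, x) \<and> (x < k \<or> S k x (case_nat v e))" ..
      obtain v x where vx: "z = prod_encode (v, x)" by (metis surj_pair prod_decode_inverse)
      have *: "x < k \<or> S k x (case_nat v e)" if k: "k \<le> z" for k
      proof -
        obtain v' x' where "z = prod_encode (v', x')" "x' < k \<or> S k x' (case_nat v' e)"
          using z[rule_format, OF k] by (elim exE conjE)
        then show ?thesis unfolding vx prod_encode_eq by simp
      qed
      have "x \<le> z" unfolding vx by (rule le_prod_encode_2)
      then have "\<forall>k\<le>x. S k x (case_nat v e)" using * by (meson not_le order_trans)
      then show "\<exists>v. R v e" unfolding R by (intro exI)
    qed
  qed
qed

lemma NF_conj [intro]:
  assumes "NF R" "NF R'"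
  shows "NF (\<lambda>e. R e \<and> R' e)"
proof -
  from assms(1) obtain S where S0: "dio_ternary S" "\<forall>e. R e = (\<exists>z. \<forall>k\<le>z. S k z e)" by (rule NF_E)
  note S = dio_ternaryD[OF S0(1)] S0(2)[rule_format]
  from assms(2) obtain S' where S'0: "dio_ternary S'" "\<forall>e. R' e = (\<exists>z. \<forall>k\<le>z. S' k z e)" by (rule NF_E)
  note S' = dio_ternaryD[OF S'0(1)] S'0(2)[rule_format]
  have "NF (\<lambda>e. \<exists>x y. \<forall>k\<le>x + y. (x < k \<or> S k x e) \<and> (y < k \<or> S' k y e))"
    by (intro NF_ex NF_dio_ball dio.D_conj dio.D_disj dio.D_less dio.F_plus dio.F_var S(1) S'(1))
  moreover have "(R e \<and> R' e) = (\<exists>x y. \<forall>k\<le>x + y. (x < k \<or> S k x e) \<and> (y < k \<or> S' k y e))" for e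
  proof
    assume "R e \<and> R' e"
    then obtain x y where "\<forall>k\<le>x. S k x e" "\<forall>k\<le>y. S' k y e" unfolding S(2) S'(2) by (elim conjE exE)
    then show "\<exists>x y. \<forall>k\<le>x + y. (x < k \<or> S k x e) \<and> (y < k \<or> S' k y e)"
      by (intro exI[of _ x] exI[of _ y]) (meson not_le)
  next
    assume "\<exists>x y. \<forall>k\<le>x + y. (x < k \<or> S k x e) \<and> (y < k \<or> S' k y e)"
    then obtain x y where "\<forall>k\<le>x + y. (x < k \<or> S k x e) \<and> (y < k \<or> S' k y e)" by (elim exE)
    then have "\<forall>k\<le>x. S k x e" "\<forall>k\<le>y. S' k y e" by (meson not_le trans_le_add1 trans_le_add2)+
    then show "R e \<and> R' e" unfolding S(2) S'(2) by (intro conjI exI)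
  qed
  ultimately show ?thesis by (simp only:)
qed

text \<open>Goedel's beta function.\<close>

definition beta :: "nat \<Rightarrow> nat \<Rightarrow> nat \<Rightarrow> nat" where
  "beta a b i = a mod (1 + (i + 1) * b)"

lemma dio_beta [intro]: "dio.F f \<Longrightarrow> dio.F g \<Longrightarrow> dio.F h \<Longrightarrow> dio.F (\<lambda>e. beta (f e) (g e) (h e))"
  unfolding beta_def by (intro dio.F_mod dio.F_plus dio.F_times dio.F_const)

text \<open>The factorial b makes the moduli pairwise coprime: a common prime does not divide b, so
  it exceeds N, yet it would identify two indices below n. Since b \<ge> N, all values are smaller
  than the moduli.\<close>

lemma beta_exists: "\<exists>a b. \<forall>i<n. beta a b i = f i"
proof -
  define N where "N = n + (\<Sum>i<n. f i)"
  define b :: nat where "b = fact N"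
  have "\<exists>a. \<forall>i\<in>{..<n}. [a = f i] (mod (1 + (i + 1) * b))"
  proof (rule chinese_remainder_nat)
    show "\<forall>i\<in>{..<n}. \<forall>j\<in>{..<n}. i \<noteq> j \<longrightarrow> coprime (1 + (i + 1) * b) (1 + (j + 1) * b)"
    proof (intro ballI impI)
      fix i j assume ij: "i \<in> {..<n}" "j \<in> {..<n}" "i \<noteq> j"
      show "coprime (1 + (i + 1) * b) (1 + (j + 1) * b)"
      proof (rule ccontr)
        assume "\<not> ?thesis"
        then have "gcd (1 + (i + 1) * b) (1 + (j + 1) * b) \<noteq> 1" by (simp only: coprime_iff_gcd_eq_1 not_False_eq_True)
        then obtain p where p: "prime p" "p dvd gcd (1 + (i + 1) * b) (1 + (j + 1) * b)" using prime_factor_nat by blast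
        then have p_i: "p dvd 1 + (i + 1) * b" and p_j: "p dvd 1 + (j + 1) * b" by (meson dvd_trans gcd_dvd1 gcd_dvd2)+
        have pb: "\<not> p dvd b"
        proof
          assume "p dvd b"
          then have "p dvd (i + 1) * b" by (rule dvd_mult)
          with p_i have "p dvd 1" by (metis dvd_add_left_iff)
          with p(1) show False by simp
        qed
        have "[1 + (i + 1) * b = 1 + (j + 1) * b] (mod p)"
          using p_i p_j by (meson cong_0_iff cong_sym cong_trans)
        then have "[(i + 1) * b = (j + 1) * b] (mod p)" by (simp only: cong_add_lcancel_nat)
        moreover have "coprime b p" using p(1) pb by (metis coprime_commute prime_imp_coprime)
        ultimately have "[i + 1 = j + 1] (mod p)" by (simp only: cong_mult_rcancel_nat)
        then have "[i = j] (mod p)" by (simp only: cong_add_rcancel_nat)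
        moreover have "N < p"
        proof (rule ccontr)
          assume "\<not> N < p"
          then have "p dvd fact N" using p(1) by (intro dvd_fact) (auto simp: prime_ge_Suc_0_nat)
          with pb show False unfolding b_def by (rule notE)
        qed
        then have "i < p" "j < p" using ij unfolding N_def by simp_all
        ultimately show False using ij(3) cong_less_modulus_unique_nat by blast
      qed
    qed
  qed simp
  then obtain a where a: "\<forall>i\<in>{..<n}. [a = f i] (mod (1 + (i + 1) * b))" ..
  have "beta a b i = f i" if i: "i < n" for i
  proof -
    have "f i \<le> (\<Sum>i<n. f i)" using i by (intro member_le_sum) auto
    also have "\<dots> \<le> N" by (simp add: N_def)
    also have "N \<le> b" unfolding b_def by (rule fact_ge_self)
    also have "b \<le> (i + 1) * b" by simp
    finally have "f i < 1 + (i + 1) * b" by linarith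
    then show ?thesis using a i unfolding beta_def unique_euclidean_semiring_class.cong_def by simp
  qed
  then show ?thesis by (intro exI allI impI)
qed

text \<open>The bounds z belonging to the single i are collected in a beta sequence with common
  bound Z, which exchanges the quantifiers. The two bounded quantifiers over i and k then merge into
  one over q = i (Z + 1) + k. The last q has i = y and is exempted by
  \<open>y \<le> i\<close>.\<close>

lemma NF_ball [intro]:
  assumes t: "dio.F t" and R: "NF (\<lambda>e. R (e 0) (\<lambda>i. e (Suc i)))"
  shows "NF (\<lambda>e. \<forall>i<t e. R i e)"
proof -
  from R obtain S where S0: "dio_ternary S" "\<forall>e. R (e 0) (\<lambda>i. e (Suc i)) = (\<exists>z. \<forall>k\<le>z. S k z e)" by (rule NF_E)
  note S = dio_ternaryD[OF S0(1)] S0(2)[rule_format]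
  have R: "R v e = (\<exists>z. \<forall>k\<le>z. S k z (case_nat v e))" for v e
    using S(2)[of "case_nat v e"] by (simp only: nat.case)
  define P where "P y a b Z q i k z e \<longleftrightarrow> i = q div (Z + 1) \<and> k = q mod (Z + 1) \<and> z = beta a b i \<and>
    (y \<le> i \<or> (z \<le> Z \<and> (z < k \<or> S k z (case_nat i e))))" for y a b Z q i k z :: nat and e
  have "(\<forall>i<y. R i e) = (\<exists>a b Z. \<forall>q\<le>y * (Z + 1). \<exists>i k z. P y a b Z q i k z e)" for y e
  proof
    assume "\<forall>i<y. R i e"
    then obtain f where f: "\<And>i k. i < y \<Longrightarrow> k \<le> f i \<Longrightarrow> S k (f i) (case_nat i e)" unfolding R by metis
    obtain a b where ab: "\<forall>i<y. beta a b i = f i" using beta_exists[of y f] by (elim exE)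
    define Z where "Z = (\<Sum>i<y. f i)"
    have fZ: "f i \<le> Z" if "i < y" for i unfolding Z_def using that by (intro member_le_sum) auto
    have "P y a b Z q (q div (Z + 1)) (q mod (Z + 1)) (beta a b (q div (Z + 1))) e" for q
    proof (cases "q div (Z + 1) < y")
      case True
      have "f (q div (Z + 1)) < q mod (Z + 1) \<or> S (q mod (Z + 1)) (f (q div (Z + 1))) (case_nat (q div (Z + 1)) e)"
        using f[OF True] by (meson not_le)
      then show ?thesis unfolding P_def ab[rule_format, OF True] using fZ[OF True] by (intro conjI refl) (rule disjI2, rule conjI)
    next
      case False
      then show ?thesis unfolding P_def not_less by (intro conjI disjI1 refl)
    qed
    then show "\<exists>a b Z. \<forall>q\<le>y * (Z + 1). \<exists>i k z. P y a b Z q i k z e" by (intro exI allI impI)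
  next
    assume "\<exists>a b Z. \<forall>q\<le>y * (Z + 1). \<exists>i k z. P y a b Z q i k z e"
    then obtain a b Z where P: "\<forall>q\<le>y * (Z + 1). \<exists>i k z. P y a b Z q i k z e" by (elim exE)
    show "\<forall>i<y. R i e"
    proof (intro allI impI)
      fix i assume i: "i < y"
      have *: "beta a b i \<le> Z \<and> (beta a b i < k \<or> S k (beta a b i) (case_nat i e))" if k: "k \<le> Z" for k
      proof -
        have "i * (Z + 1) + (Z + 1) \<le> y * (Z + 1)" using mult_le_mono1[of "i + 1" y "Z + 1"] i by (simp add: algebra_simps)
        then have "i * (Z + 1) + k \<le> y * (Z + 1)" using k by linarith
        then obtain i' k' z where "P y a b Z (i * (Z + 1) + k) i' k' z e" using P by (elim allE impE exE)
        moreover have "(i * n + k) div n = i" "(i * n + k) mod n = k" if "k < n" for n using that by simp_all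
        from this[of "Z + 1"] have "(i * (Z + 1) + k) div (Z + 1) = i" "(i * (Z + 1) + k) mod (Z + 1) = k"
          using k by linarith+
        ultimately show ?thesis unfolding P_def using i by (elim conjE) (simp only: not_le[symmetric] simp_thms)
      qed
      have "\<forall>k\<le>beta a b i. S k (beta a b i) (case_nat i e)"
        using * by (meson not_le order_trans order_refl zero_le)
      then show "R i e" unfolding R by (rule exI)
    qed
  qed
  moreover have "NF (\<lambda>e. \<exists>a b Z. \<forall>q\<le>t e * (Z + 1). \<exists>i k z. P (t e) a b Z q i k z e)"
  proof -
    have "dio.D (\<lambda>e. S (e (Suc 0)) (e 0) (\<lambda>i. e (case_nat (Suc (Suc 0)) (\<lambda>i. Suc (Suc (Suc (Suc (Suc (Suc (Suc i))))))) i)))"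
      by (intro S(1) dio.F_var)
    also have "(\<lambda>e. S (e (Suc 0)) (e 0) (\<lambda>i. e (case_nat (Suc (Suc 0)) (\<lambda>i. Suc (Suc (Suc (Suc (Suc (Suc (Suc i))))))) i))) =
       (\<lambda>e. S (e (Suc 0)) (e 0) (case_nat (e (Suc (Suc 0))) (\<lambda>i. e (Suc (Suc (Suc (Suc (Suc (Suc (Suc i))))))))))"
      by (intro ext arg_cong[where f = "S (_ :: nat) (_ :: nat)"]) (simp split: nat.split)
    finally have S': "dio.D (\<lambda>e. S (e (Suc 0)) (e 0) (case_nat (e (Suc (Suc 0))) (\<lambda>i. e (Suc (Suc (Suc (Suc (Suc (Suc (Suc i))))))))))" .
    show ?thesis
      unfolding P_def
      by (intro NF_ex NF_dio_ball dio.D_ex dio.D_conj dio.D_disj dio.D_eq dio.D_le dio.D_less dio_beta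
        dio.F_div dio.F_mod dio.F_times dio.F_plus dio.F_const dio.F_var S' dio.F_rename[OF t])
  qed
  ultimately show ?thesis by (simp only:)
qed


lemma NF_all_less_const:
  assumes "\<And>i. NF (\<lambda>e. R i e)"
  shows "NF (\<lambda>e. \<forall>i<(n::nat). R i e)"
proof (induction n)
  case 0
  have "NF (\<lambda>e. True)" by (intro NF_dio dio.D_const)
  then show ?case by simp
next
  case (Suc n)
  have "NF (\<lambda>e. R n e \<and> (\<forall>i<n. R i e))" by (intro NF_conj assms Suc)
  then show ?case by (simp only: All_less_Suc)
qed

lemma NF_ex_list:
  assumes "NF (\<lambda>e. R (map e [0..<n]) (\<lambda>i. e (i + n)))"
  shows "NF (\<lambda>e. \<exists>ys. length ys = n \<and> R ys e)"
  using assms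
proof (induction n arbitrary: R)
  case 0
  then show ?case by simp
next
  case (Suc n)
  have "NF (\<lambda>e. \<exists>y. \<exists>ys. length ys = n \<and> R (ys @ [y]) e)"
  proof (rule NF_ex, rule Suc.IH)
    show "NF (\<lambda>e. R (map e [0..<n] @ [e (0 + n)]) (\<lambda>i. e (Suc i + n)))"
      using Suc.prems by simp
  qed
  moreover have "(\<exists>y ys. length ys = n \<and> R (ys @ [y]) e) = (\<exists>ys. length ys = Suc n \<and> R ys e)" for e
  proof
    assume "\<exists>y ys. length ys = n \<and> R (ys @ [y]) e"
    then obtain y ys where "length ys = n" "R (ys @ [y]) e" by (elim exE conjE)
    then show "\<exists>ys. length ys = Suc n \<and> R ys e" by (intro exI[of _ "ys @ [y]"]) simp
  next
    assume "\<exists>ys. length ys = Suc n \<and> R ys e"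
    then obtain ys where ys: "length ys = Suc n" "R ys e" by (elim exE conjE)
    then have "ys \<noteq> []" by (intro notI) simp
    then have "ys = butlast ys @ [last ys]" by simp
    with ys have "length (butlast ys) = n" "R (butlast ys @ [last ys]) e" by simp_all
    then show "\<exists>y ys. length ys = n \<and> R (ys @ [y]) e" by (intro exI conjI)
  qed
  ultimately show ?case by (simp only:)
qed

section \<open>Evaluation rules as equivalences\<close>

lemma computes_Zero_iff: "computes Zero xs y \<longleftrightarrow> y = 0"
  by (auto elim: computes.cases intro: computes.Zero)

lemma computes_Succ_iff: "computes Succ xs y \<longleftrightarrow> (\<exists>x. xs = [x] \<and> y = Suc x)"
  by (auto elim: computes.cases intro: computes.Succ)

lemma computes_Proj_iff: "computes (Proj i) xs y \<longleftrightarrow> i < length xs \<and> y = xs ! i"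
  by (auto elim: computes.cases intro: computes.Proj)

lemma computes_Comp_iff:
  "computes (Comp f gs) xs z \<longleftrightarrow>
    (\<exists>ys. length ys = length gs \<and> (\<forall>j<length gs. computes (gs ! j) xs (ys ! j)) \<and> computes f ys z)"
proof
  assume "computes (Comp f gs) xs z"
  then obtain ys where "list_all2 (\<lambda>g y. computes g xs y) gs ys" "computes f ys z"
    by (auto elim: computes.cases)
  then show "\<exists>ys. length ys = length gs \<and> (\<forall>j<length gs. computes (gs ! j) xs (ys ! j)) \<and> computes f ys z"
    by (intro exI[of _ ys]) (simp add: list_all2_conv_all_nth)
next
  assume "\<exists>ys. length ys = length gs \<and> (\<forall>j<length gs. computes (gs ! j) xs (ys ! j)) \<and> computes f ys z"
  then obtain ys where ys: "length ys = length gs" "\<forall>j<length gs. computes (gs ! j) xs (ys ! j)" "computes f ys z"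
    by (elim exE conjE)
  then have "list_all2 (\<lambda>g y. computes g xs y) gs ys" by (simp add: list_all2_conv_all_nth)
  then show "computes (Comp f gs) xs z" using ys(3) by (rule computes.Comp)
qed

lemma computes_Mu_iff:
  "computes (Mu f) xs n \<longleftrightarrow> computes f (n # xs) 0 \<and> (\<forall>i<n. \<exists>y. computes f (i # xs) (Suc y))"
  by (auto elim: computes.cases intro: computes.Mu)

lemma computes_PrimRec_Nil: "\<not> computes (PrimRec f g) [] y"
  by (auto elim: computes.cases)

lemma computes_PrimRec_iff:
  "computes (PrimRec f g) (n # xs) y \<longleftrightarrow>
    (\<exists>h. computes f xs (h 0) \<and> (\<forall>i<n. computes g (i # h i # xs) (h (Suc i))) \<and> h n = y)"
proof
  show "\<exists>h. computes f xs (h 0) \<and> (\<forall>i<n. computes g (i # h i # xs) (h (Suc i))) \<and> h n = y"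
    if "computes (PrimRec f g) (n # xs) y"
    using that
  proof (induction n arbitrary: y)
    case 0
    then have "computes f xs y" by (auto elim: computes.cases)
    then show ?case by (intro exI[of _ "\<lambda>_. y"]) simp
  next
    case (Suc n)
    then obtain x where x: "computes (PrimRec f g) (n # xs) x" "computes g (n # x # xs) y"
      by (auto elim: computes.cases)
    from Suc.IH[OF x(1)] obtain h where h: "computes f xs (h 0)" "\<forall>i<n. computes g (i # h i # xs) (h (Suc i))" "h n = x"
      by (elim exE conjE)
    define h' where "h' i = (if i \<le> n then h i else y)" for i
    have "computes g (i # h' i # xs) (h' (Suc i))" if "i < Suc n" for i
      using h x(2) that unfolding h'_def by (cases "i = n") simp_all
    moreover have "h' 0 = h 0" "h' (Suc n) = y" by (simp_all add: h'_def)
    ultimately show ?case using h(1) by (intro exI[of _ h']) simp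
  qed
next
  assume "\<exists>h. computes f xs (h 0) \<and> (\<forall>i<n. computes g (i # h i # xs) (h (Suc i))) \<and> h n = y"
  then obtain h where h: "computes f xs (h 0)" "\<forall>i<n. computes g (i # h i # xs) (h (Suc i))" "h n = y"
    by (elim exE conjE)
  have "computes (PrimRec f g) (i # xs) (h i)" if "i \<le> n" for i
    using that
  proof (induction i)
    case 0
    show ?case by (rule computes.PrimRec_0[OF h(1)])
  next
    case (Suc i)
    show ?case by (rule computes.PrimRec_Suc) (use Suc h(2) in auto)
  qed
  then show "computes (PrimRec f g) (n # xs) y" using h(3) by auto
qed

text \<open>The beta function codes the history of the recursion. Its values are named by v and w
  because the induction hypotheses for subprograms apply to variables only.\<close>

lemma computes_PrimRec_beta:
  "computes (PrimRec f g) (n # xs) y \<longleftrightarrow>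
    (\<exists>a b. (\<exists>v. v = beta a b 0 \<and> computes f xs v) \<and>
      (\<forall>i<n. \<exists>v w. v = beta a b i \<and> w = beta a b (Suc i) \<and> computes g (i # v # xs) w) \<and> beta a b n = y)"
  unfolding computes_PrimRec_iff
proof
  assume "\<exists>h. computes f xs (h 0) \<and> (\<forall>i<n. computes g (i # h i # xs) (h (Suc i))) \<and> h n = y"
  then obtain h where h: "computes f xs (h 0)" "\<forall>i<n. computes g (i # h i # xs) (h (Suc i))" "h n = y"
    by (elim exE conjE)
  obtain a b where ab: "\<forall>i<Suc n. beta a b i = h i" using beta_exists[of "Suc n" h] by (elim exE)
  then have "beta a b 0 = h 0" "beta a b n = h n" "\<And>i. i < n \<Longrightarrow> beta a b i = h i \<and> beta a b (Suc i) = h (Suc i)"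
    by simp_all
  with h show "\<exists>a b. (\<exists>v. v = beta a b 0 \<and> computes f xs v) \<and>
      (\<forall>i<n. \<exists>v w. v = beta a b i \<and> w = beta a b (Suc i) \<and> computes g (i # v # xs) w) \<and> beta a b n = y"
    by (intro exI[of _ a] exI[of _ b]) simp
next
  assume "\<exists>a b. (\<exists>v. v = beta a b 0 \<and> computes f xs v) \<and>
      (\<forall>i<n. \<exists>v w. v = beta a b i \<and> w = beta a b (Suc i) \<and> computes g (i # v # xs) w) \<and> beta a b n = y"
  then obtain a b where "(\<exists>v. v = beta a b 0 \<and> computes f xs v) \<and>
      (\<forall>i<n. \<exists>v w. v = beta a b i \<and> w = beta a b (Suc i) \<and> computes g (i # v # xs) w) \<and> beta a b n = y"
    by (elim exE)
  then show "\<exists>h. computes f xs (h 0) \<and> (\<forall>i<n. computes g (i # h i # xs) (h (Suc i))) \<and> h n = y"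
    by (intro exI[of _ "beta a b"]) simp
qed

lemma NF_args2:
  assumes "NF (\<lambda>e. P (map (\<lambda>i. e (Suc i)) [0..<Suc (Suc n)]) (e 0))"
  shows "NF (\<lambda>e. P (e a # e b # map (\<lambda>i. e (\<sigma> i)) [0..<n]) (e c))"
  using NF_rename[OF assms, of "case_nat c (case_nat a (case_nat b \<sigma>))"] by (simp del: upt_Suc add: map_upt_Suc)

lemma NF_args1:
  assumes "NF (\<lambda>e. P (map (\<lambda>i. e (Suc i)) [0..<Suc n]) (e 0))"
  shows "NF (\<lambda>e. P (e a # map (\<lambda>i. e (\<sigma> i)) [0..<n]) (e c))"
  using NF_rename[OF assms, of "case_nat c (case_nat a \<sigma>)"] by (simp del: upt_Suc add: map_upt_Suc)

lemma NF_args0: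
  assumes "NF (\<lambda>e. P (map (\<lambda>i. e (Suc i)) [0..<n]) (e 0))"
  shows "NF (\<lambda>e. P (map (\<lambda>i. e (\<sigma> i)) [0..<n]) (e c))"
  using NF_rename[OF assms, of "case_nat c \<sigma>"] by simp

text \<open>Variable 0 holds the result and the next n the arguments. The arity n varies in the
  induction, as programs carry none.\<close>

theorem NF_computes: "NF (\<lambda>e. computes f (map (\<lambda>i. e (Suc i)) [0..<n]) (e 0))"
proof (induction f arbitrary: n)
  case Zero
  show ?case unfolding computes_Zero_iff by (intro NF_dio dio.D_eq dio.F_var dio.F_const)
next
  case Succ
  show ?case
  proof (cases "n = 1")
    case True
    have "NF (\<lambda>e. e 0 = Suc (e (Suc 0)))" by (intro NF_dio dio.D_eq dio.F_Suc dio.F_var)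
    then show ?thesis unfolding computes_Succ_iff True by simp
  next
    case False
    then have "(map f [0..<n] = [x]) = False" for f :: "nat \<Rightarrow> nat" and x
      by (metis length_map length_upt diff_zero length_Cons list.size(3) One_nat_def)
    then show ?thesis unfolding computes_Succ_iff by (simp add: NF_dio dio.D_const)
  qed
next
  case (Proj i)
  show ?case
  proof (cases "i < n")
    case True
    have "NF (\<lambda>e. e 0 = e (Suc i))" by (intro NF_dio dio.D_eq dio.F_var)
    then show ?thesis unfolding computes_Proj_iff using True by simp
  next
    case False
    then show ?thesis unfolding computes_Proj_iff by (simp add: NF_dio dio.D_const)
  qed
next
  case (Comp f gs)
  define m where "m = length gs"
  \<comment> \<open>The m intermediate values occupy the first variables, so result and arguments
    are shifted by m.\<close>
  have f: "NF (\<lambda>e. computes f (map e [0..<m]) (e (0 + m)))"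
    using NF_args0[OF Comp.IH(1), of "\<lambda>i. i" m] by simp
  have "NF (\<lambda>e. \<forall>j<m. computes (gs ! j) (map (\<lambda>i. e (Suc i + m)) [0..<n]) (e j))"
  proof -
    have g: "NF (\<lambda>e. j < m \<longrightarrow> computes (gs ! j) (map (\<lambda>i. e (Suc i + m)) [0..<n]) (e j))" for j
    proof (cases "j < m")
      case True
      then have "gs ! j \<in> set gs" by (simp add: m_def)
      from NF_args0[OF Comp.IH(2)[OF this], of "\<lambda>i. Suc i + m" n j] True show ?thesis by simp
    qed (simp add: NF_dio dio.D_const)
    have "NF (\<lambda>e. \<forall>j<m. j < m \<longrightarrow> computes (gs ! j) (map (\<lambda>i. e (Suc i + m)) [0..<n]) (e j))"
      by (rule NF_all_less_const[OF g])
    then show ?thesis by simp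
  qed
  then have "NF (\<lambda>e. (\<forall>j<m. computes (gs ! j) (map (\<lambda>i. e (Suc i + m)) [0..<n]) (map e [0..<m] ! j)) \<and>
     computes f (map e [0..<m]) (e (0 + m)))"
    using f by (intro NF_conj) simp_all
  then have "NF (\<lambda>e. \<exists>ys. length ys = m \<and> (\<forall>j<m. computes (gs ! j) (map (\<lambda>i. e (Suc i)) [0..<n]) (ys ! j)) \<and>
     computes f ys (e 0))"
    by (rule NF_ex_list)
  then show ?case unfolding computes_Comp_iff m_def .
next
  case (PrimRec f g)
  show ?case
  proof (cases n)
    case 0
    then show ?thesis using computes_PrimRec_Nil by (simp add: NF_dio dio.D_const)
  next
    case (Suc k)
    have "NF (\<lambda>e. \<exists>a b. (\<exists>v. v = beta a b 0 \<and> computes f (map (\<lambda>i. e (Suc (Suc i))) [0..<k]) v) \<and>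
      (\<forall>i<e (Suc 0). \<exists>v w. v = beta a b i \<and> w = beta a b (Suc i) \<and>
        computes g (i # v # map (\<lambda>i. e (Suc (Suc i))) [0..<k]) w) \<and> beta a b (e (Suc 0)) = e 0)"
      by (intro NF_ex NF_conj NF_ball NF_args0[OF PrimRec.IH(1)] NF_args2[OF PrimRec.IH(2)])
        (intro NF_dio dio.D_eq dio_beta dio.F_var dio.F_const dio.F_Suc)+
    then show ?thesis unfolding Suc by (simp del: upt_Suc add: map_upt_Suc computes_PrimRec_beta)
  qed
next
  case (Mu f)
  have "NF (\<lambda>e. (\<exists>z. z = 0 \<and> computes f (e 0 # map (\<lambda>i. e (Suc i)) [0..<n]) z) \<and>
     (\<forall>i<e 0. \<exists>y z. z = Suc y \<and> computes f (i # map (\<lambda>i. e (Suc i)) [0..<n]) z))"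
    by (intro NF_ex NF_conj NF_ball NF_args1[OF Mu.IH])
      (intro NF_dio dio.D_eq dio.F_var dio.F_const dio.F_Suc)+
  then show ?case unfolding computes_Mu_iff by simp
qed

section \<open>Diagonalization\<close>

primrec tm_rename :: "(nat \<Rightarrow> nat) \<Rightarrow> tm \<Rightarrow> tm" where
  "tm_rename \<sigma> (Var x) = Var (\<sigma> x)"
| "tm_rename \<sigma> (Add s t) = Add (tm_rename \<sigma> s) (tm_rename \<sigma> t)"
| "tm_rename \<sigma> (PrimeF t) = PrimeF (tm_rename \<sigma> t)"
| "tm_rename \<sigma> (RemF t) = RemF (tm_rename \<sigma> t)"

primrec qf_rename :: "(nat \<Rightarrow> nat) \<Rightarrow> fm \<Rightarrow> fm" where
  "qf_rename \<sigma> (Eq s t) = Eq (tm_rename \<sigma> s) (tm_rename \<sigma> t)"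
| "qf_rename \<sigma> (Neg \<phi>) = Neg (qf_rename \<sigma> \<phi>)"
| "qf_rename \<sigma> (Conj \<phi> \<psi>) = Conj (qf_rename \<sigma> \<phi>) (qf_rename \<sigma> \<psi>)"
| "qf_rename \<sigma> (Disj \<phi> \<psi>) = Disj (qf_rename \<sigma> \<phi>) (qf_rename \<sigma> \<psi>)"
| "qf_rename \<sigma> (Imp \<phi> \<psi>) = Imp (qf_rename \<sigma> \<phi>) (qf_rename \<sigma> \<psi>)"
| "qf_rename \<sigma> (Ex x \<phi>) = Ex x \<phi>"
| "qf_rename \<sigma> (All x \<phi>) = All x \<phi>"

lemma tm_val_rename: "tm_val r0 e (tm_rename \<sigma> t) = tm_val r0 (\<lambda>i. e (\<sigma> i)) t"
  by (induction t) simp_all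

lemma sat_qf_rename: "quantifier_free \<phi> \<Longrightarrow> sat r0 e (qf_rename \<sigma> \<phi>) = sat r0 (\<lambda>i. e (\<sigma> i)) \<phi>"
  by (induction \<phi>) (simp_all add: tm_val_rename)

lemma quantifier_free_rename: "quantifier_free \<phi> \<Longrightarrow> quantifier_free (qf_rename \<sigma> \<phi>)"
  by (induction \<phi>) simp_all

definition qf_rels :: "nat \<Rightarrow> ((nat \<Rightarrow> nat) \<Rightarrow> bool) set" where
  "qf_rels r0 = {\<lambda>e. sat r0 e \<phi> | \<phi>. quantifier_free \<phi>}"

lemma qf_relsI: "quantifier_free \<phi> \<Longrightarrow> (\<And>e. b e = sat r0 e \<phi>) \<Longrightarrow> b \<in> qf_rels r0"
  unfolding qf_rels_def by (intro CollectI exI[of _ \<phi>] conjI ext)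

lemma qf_relsE:
  assumes "b \<in> qf_rels r0"
  obtains \<phi> where "quantifier_free \<phi>" "b = (\<lambda>e. sat r0 e \<phi>)"
  using assms unfolding qf_rels_def by blast

lemma qf_rels_ex_class: "ex_class (qf_rels r0)"
proof
  fix b and \<sigma> :: "nat \<Rightarrow> nat" assume "b \<in> qf_rels r0"
  then obtain \<phi> where "quantifier_free \<phi>" "b = (\<lambda>e. sat r0 e \<phi>)" by (rule qf_relsE)
  then show "(\<lambda>e. b (\<lambda>i. e (\<sigma> i))) \<in> qf_rels r0"
    by (intro qf_relsI[of "qf_rename \<sigma> \<phi>"]) (simp_all add: quantifier_free_rename sat_qf_rename)
next
  fix b c assume "b \<in> qf_rels r0" "c \<in> qf_rels r0"
  then obtain \<phi> \<psi> where "quantifier_free \<phi>" "b = (\<lambda>e. sat r0 e \<phi>)" "quantifier_free \<psi>" "c = (\<lambda>e. sat r0 e \<psi>)"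
    by (elim qf_relsE)
  then show "(\<lambda>e. b e \<and> c e) \<in> qf_rels r0" "(\<lambda>e. b e \<or> c e) \<in> qf_rels r0"
    by (intro qf_relsI[of "Conj \<phi> \<psi>"] qf_relsI[of "Disj \<phi> \<psi>"]; simp)+
next
  show "(\<lambda>e. e 0 = e 1) \<in> qf_rels r0"
    by (intro qf_relsI[of "Eq (Var 0) (Var 1)"]) simp_all
  show "(\<lambda>e. e 0 = e 1 + e 2) \<in> qf_rels r0"
    by (intro qf_relsI[of "Eq (Var 0) (Add (Var 1) (Var 2))"]) simp_all
qed

locale prime_structure =
  fixes r0 :: nat
begin

sublocale ex_class "qf_rels r0"
  by (rule qf_rels_ex_class)

lemma F_nth_prime [intro]: "F a \<Longrightarrow> F (\<lambda>e. nth_prime (a e))"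
  by (rule F_comp1[of nth_prime]) (intro D_base qf_relsI[of "Eq (Var 0) (PrimeF (Var 1))"], simp_all)

lemma F_prime_rem [intro]: "F a \<Longrightarrow> F (\<lambda>e. prime_rem r0 (a e))"
  by (rule F_comp1[of "prime_rem r0"]) (intro D_base qf_relsI[of "Eq (Var 0) (RemF (Var 1))"], simp_all)

sublocale ex_class_one "qf_rels r0"
proof
  \<comment> \<open>The prime with index 0 is 2 = 1 + 1, which defines 1 without constants.\<close>
  have "D (\<lambda>e. \<exists>z. z = z + z \<and> e 0 + e 0 = nth_prime z)"
    by (intro D_ex D_conj D_eq F_plus F_nth_prime F_var)
  moreover have "(\<exists>z::nat. z = z + z \<and> x + x = nth_prime z) = (x = 1)" for x
    by auto
  ultimately show "F (\<lambda>e. 1)" unfolding F_def by (simp only:)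
qed

lemma F_const_times [intro]: "F a \<Longrightarrow> F (\<lambda>e. c * a e)"
  by (induction c) (simp_all only: mult_0 mult_Suc F_0 F_plus)

lemma D_same_quot [intro]: "F m \<Longrightarrow> F t \<Longrightarrow> F y \<Longrightarrow> D (\<lambda>e. same_quot m0 (m e) (t e) (y e))"
proof -
  \<comment> \<open>Since 1 \<le> m, both remainders have positive arguments and the arbitrary value
    r0 never enters.\<close>
  have *: "same_quot m0 m t y \<longleftrightarrow> m0 \<le> m \<and> 1 \<le> m \<and> nth_prime (nth_prime t) \<le> m \<and> y < m \<and>
    nth_prime (m + t) + prime_rem r0 m = nth_prime m + prime_rem r0 (m + t) + y" for m t y
    unfolding same_quot_def prime_rem_def by auto
  show "F m \<Longrightarrow> F t \<Longrightarrow> F y \<Longrightarrow> D (\<lambda>e. same_quot m0 (m e) (t e) (y e))"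
    unfolding * by (intro D_conj D_le D_less D_eq F_plus F_nth_prime F_prime_rem F_const)
qed

lemma D_has_quot: "D (\<lambda>e. has_quot m0 (e 0) (e 1))"
  unfolding has_quot_def
  by (rule D_Bex_const) (intro D_same_quot F_var F_const F_const_times, rule finite_atLeastAtMost)

lemma D_quot_times: "D (\<lambda>e. quot_times m0 (e 0) (e 1) (e 2))"
  unfolding quot_times_def
  by (rule D_ex, rule D_Bex_const, rule D_Bex_const)
    (intro D_conj D_same_quot F_var F_const F_const_times, rule finite_atLeastAtMost, rule finite_atLeastAtMost)

lemma D_quot_times' [intro]: "F a \<Longrightarrow> F b \<Longrightarrow> F c \<Longrightarrow> D (\<lambda>e. quot_times m0 (a e) (b e) (c e))"
  by (rule D_comp3[of "quot_times m0", OF D_quot_times])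

lemma D_weak_times: "D (\<lambda>e. weak_times m0 (e 0) (e 1) (e 2))"
  unfolding weak_times_def
  by (intro D_ex D_disj D_conj D_eq D_quot_times' F_var F_plus F_const)

lemma D_weak_times' [intro]: "F a \<Longrightarrow> F b \<Longrightarrow> F c \<Longrightarrow> D (\<lambda>e. weak_times m0 (a e) (b e) (c e))"
  by (rule D_comp3[of "weak_times m0", OF D_weak_times])

lemma D_large_square: "D (\<lambda>e. large_square m0 (e 0) (e 1))"
  unfolding large_square_def
  by (intro D_ex D_conj D_eq D_le D_less D_weak_times' F_var F_plus)

end

text \<open>Shifting the argument by z0 reduces all squares to large ones; the cross term is only a
  multiplication by a constant.\<close>

lemma square_by_large_square:
  assumes "\<And>z y. large_square m0 z y \<Longrightarrow> y = z * z" "\<And>z. z0 \<le> z \<Longrightarrow> large_square m0 z (z * z)"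
  shows "(y::nat) = z * z \<longleftrightarrow> large_square m0 (z + z0) (y + 2 * z0 * z + z0 * z0)"
proof -
  have eq: "(z + z0) * (z + z0) = z * z + 2 * z0 * z + z0 * z0" by (simp add: algebra_simps)
  show ?thesis
  proof
    assume "y = z * z"
    then show "large_square m0 (z + z0) (y + 2 * z0 * z + z0 * z0)"
      using assms(2)[of "z + z0"] unfolding eq by simp
  next
    assume "large_square m0 (z + z0) (y + 2 * z0 * z + z0 * z0)"
    from assms(1)[OF this] show "y = z * z" unfolding eq by simp
  qed
qed

text \<open>Polarization, with each square named by a variable so that only the graph of squaring is
  used.\<close>

lemma product_by_squares: "(x::nat) = y * w \<longleftrightarrow> (\<exists>p q r. p = (y + w) * (y + w) \<and> q = y * y \<and> r = w * w \<and> p = q + r + x + x)"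
proof -
  have "(y + w) * (y + w) = y * y + w * w + y * w + y * w" by (simp add: algebra_simps)
  then show ?thesis by auto
qed

text \<open>Quotients give squares, hence products, and with the growth relation exponentiation and
  bounded quantifiers. The constants m0, z0 and c only have to exist, as a single formula for R is
  wanted.\<close>

theorem existential_of_NF:
  assumes "NF R"
  shows "\<exists>\<phi>. quantifier_free \<phi> \<and> (\<forall>e. R e = (\<exists>u. sat r0 (mix e u) \<phi>))"
proof -
  interpret prime_structure r0 .
  obtain m0 where m0: "\<And>m t. m \<ge> m0 \<Longrightarrow> nth_prime (nth_prime t) \<le> m \<Longrightarrow> quot m * t < m"
    using quot_mult_less by blast
  interpret quot_bound m0 by unfold_locales (rule m0)
  obtain z0 where z0: "\<And>z. z \<ge> z0 \<Longrightarrow> large_square m0 z (z * z)"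
    using large_square_complete by blast
  obtain c where c: "c \<ge> 1" "\<And>m k q. has_quot m0 m k \<Longrightarrow> c * q \<le> k \<Longrightarrow> 2 ^ q \<le> 3 * m"
    using has_quot_lower by blast
  have D_square: "D (\<lambda>e. y e = z e * z e)" if "F y" "F z" for y z
  proof (rule ssubst[of _ _ D])
    show "(\<lambda>e. y e = z e * z e) = (\<lambda>e. large_square m0 (z e + z0) (y e + 2 * z0 * z e + z0 * z0))"
      by (rule ext) (rule square_by_large_square[OF large_square_sound z0])
    show "D (\<lambda>e. large_square m0 (z e + z0) (y e + 2 * z0 * z e + z0 * z0))"
      by (intro D_comp2[of "large_square m0", OF D_large_square] F_plus F_const_times F_const that)
  qed
  interpret ex_class_rough "qf_rels r0" "has_quot m0" c
  proof
    show "D (\<lambda>e. e 0 = e 1 * e 2)"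
    proof (rule ssubst[of _ _ D])
      show "(\<lambda>e :: nat \<Rightarrow> nat. e 0 = e 1 * e 2) = (\<lambda>e. \<exists>p q r. p = (e 1 + e 2) * (e 1 + e 2) \<and> q = e 1 * e 1 \<and>
          r = e 2 * e 2 \<and> p = q + r + e 0 + e 0)"
        by (rule ext) (rule product_by_squares)
      show "D (\<lambda>e. \<exists>p q r. p = (e 1 + e 2) * (e 1 + e 2) \<and> q = e 1 * e 1 \<and>
          r = e 2 * e 2 \<and> p = q + r + e 0 + e 0)"
        by (intro D_ex D_conj D_square) (intro D_eq F_plus F_var)+
    qed
    show "D (\<lambda>e. has_quot m0 (e 0) (e 1))" by (rule D_has_quot)
    show "m \<le> 4 ^ (k + 2)" if "has_quot m0 m k" for m k
      using that by (rule has_quot_upper)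
    show "2 ^ q \<le> 3 * m" if "has_quot m0 m k" "c * q \<le> k" for m k q
      using that by (rule c(2))
    show "\<exists>m k. b \<le> k \<and> has_quot m0 m k" for b by (rule has_quot_exists)
    show "1 \<le> c" by (rule c(1))
  qed
  from D_of_NF[OF assms] obtain b where "b \<in> qf_rels r0" and b: "\<forall>e. R e = (\<exists>u. b (mix e u))" by (rule D_E)
  then obtain \<phi> where "quantifier_free \<phi>" "b = (\<lambda>e. sat r0 e \<phi>)" by (elim qf_relsE)
  with b show ?thesis by (intro exI[of _ \<phi>]) simp
qed

text \<open>The even variables 4 and 6 are parameters 2 and 3 under \<open>mix\<close>, which the
  formula itself forces to be 0 and 1.\<close>

primrec num_tm :: "nat \<Rightarrow> tm" where
  "num_tm 0 = Var 4"
| "num_tm (Suc n) = Add (num_tm n) (Var 6)"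

primrec exs :: "nat \<Rightarrow> fm \<Rightarrow> fm" where
  "exs 0 \<phi> = \<phi>"
| "exs (Suc k) \<phi> = Ex k (exs k \<phi>)"

lemma tm_val_num: "tm_val r0 e (num_tm n) = e 4 + n * e 6"
  by (induction n) simp_all

lemma sat_exs: "sat r0 e (exs k \<phi>) = (\<exists>v. sat r0 (\<lambda>i. if i < k then v i else e i) \<phi>)"
proof (induction k arbitrary: e)
  case (Suc k)
  have *: "(\<lambda>i. if i < k then v i else (e(k := n)) i) = (\<lambda>i. if i < Suc k then (v(k := n)) i else e i)" for v n
    by (rule ext) (simp add: less_Suc_eq)
  have "sat r0 e (exs (Suc k) \<phi>) = (\<exists>n v. sat r0 (\<lambda>i. if i < Suc k then (v(k := n)) i else e i) \<phi>)"
    unfolding exs.simps sat.simps Suc * ..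
  also have "\<dots> = (\<exists>v. sat r0 (\<lambda>i. if i < Suc k then v i else e i) \<phi>)"
  proof (intro iffI; elim exE)
    fix n v assume "sat r0 (\<lambda>i. if i < Suc k then (v(k := n)) i else e i) \<phi>"
    then show "\<exists>v. sat r0 (\<lambda>i. if i < Suc k then v i else e i) \<phi>" by (intro exI)
  next
    fix v assume "sat r0 (\<lambda>i. if i < Suc k then v i else e i) \<phi>"
    then have "sat r0 (\<lambda>i. if i < Suc k then (v(k := v k)) i else e i) \<phi>" by (simp only: fun_upd_triv)
    then show "\<exists>n v. sat r0 (\<lambda>i. if i < Suc k then (v(k := n)) i else e i) \<phi>" by (intro exI)
  qed
  finally show ?case .
qed simp

lemma free_vars_exs: "free_vars (exs k \<phi>) = free_vars \<phi> - {..<k}"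
  by (induction k) (auto simp: lessThan_Suc)

lemma existential_exs: "quantifier_free \<phi> \<Longrightarrow> existential (exs k \<phi>)"
  by (induction k) (auto intro: existential.intros)

lemma tm_val_agree: "(\<And>i. i \<in> tm_vars t \<Longrightarrow> v i = w i) \<Longrightarrow> tm_val r0 v t = tm_val r0 w t"
  by (induction t) simp_all

lemma sat_agree: "quantifier_free \<phi> \<Longrightarrow> (\<And>i. i \<in> free_vars \<phi> \<Longrightarrow> v i = w i) \<Longrightarrow> sat r0 v \<phi> = sat r0 w \<phi>"
proof (induction \<phi>)
  case (Eq s t)
  then show ?case using tm_val_agree[of s v w r0] tm_val_agree[of t v w r0] by simp
qed simp_all

lemma finite_tm_vars: "finite (tm_vars t)"
  by (induction t) simp_all

lemma finite_free_vars: "finite (free_vars \<phi>)"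
  by (induction \<phi>) (simp_all add: finite_tm_vars)

text \<open>The diagonal sentence for \<open>\<chi>\<close>: the variables 0 and 2 receive numerals for the number of variables
  and for the code of \<open>\<chi>\<close>; the variables 4 and 6 stand for zero and one.\<close>

definition diag_sentence :: "nat \<Rightarrow> fm \<Rightarrow> fm" where
  "diag_sentence k \<chi> = exs k (Conj (Eq (Var 0) (num_tm k)) (Conj (Eq (Var 2) (num_tm (fm_code \<chi>))) \<chi>))"

fun num_code :: "nat \<Rightarrow> nat" where
  "num_code 0 = prod_encode (0, 4)"
| "num_code (Suc n) = prod_encode (1, prod_encode (num_code n, prod_encode (0, 6)))"

fun exs_code :: "nat \<Rightarrow> nat \<Rightarrow> nat" where
  "exs_code 0 c = c"
| "exs_code (Suc k) c = prod_encode (5, prod_encode (k, exs_code k c))"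

lemma tm_code_num: "tm_code (num_tm n) = num_code n"
  by (induction n) simp_all

lemma fm_code_exs: "fm_code (exs k \<phi>) = exs_code k (fm_code \<phi>)"
  by (induction k) simp_all

section \<open>Programs computing the code of the diagonal sentence\<close>

primrec const_recf :: "nat \<Rightarrow> recf" where
  "const_recf 0 = Zero"
| "const_recf (Suc c) = Comp Succ [const_recf c]"

definition "add_recf = PrimRec (Proj 0) (Comp Succ [Proj 1])"
definition "triangle_recf = PrimRec Zero (Comp add_recf [Comp Succ [Proj 0], Proj 1])"
definition "pair_recf = Comp add_recf [Comp triangle_recf [add_recf], Proj 0]"
definition "num_recf = PrimRec (const_recf (prod_encode (0, 4)))
  (Comp pair_recf [const_recf 1, Comp pair_recf [Proj 1, const_recf (prod_encode (0, 6))]])"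
definition "exs_recf = PrimRec (Proj 0) (Comp pair_recf [const_recf 5, Comp pair_recf [Proj 0, Proj 1]])"
text \<open>The constants 2 and 0 are the tags of \<open>Conj\<close> and \<open>Eq\<close>; the
  encoded pairs (0, 0) and (0, 2) are the codes of the variables 0 and 2.\<close>

definition "diag_recf = Comp exs_recf [Proj 0,
  Comp pair_recf [const_recf 2, Comp pair_recf [
    Comp pair_recf [const_recf 0, Comp pair_recf [const_recf (prod_encode (0, 0)), Comp num_recf [Proj 0]]],
    Comp pair_recf [const_recf 2, Comp pair_recf [
      Comp pair_recf [const_recf 0, Comp pair_recf [const_recf (prod_encode (0, 2)), Comp num_recf [Proj 1]]],
      Proj 1]]]]]"

lemma computes_Comp1: "computes g xs a \<Longrightarrow> computes f [a] z \<Longrightarrow> computes (Comp f [g]) xs z"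
  by (rule computes.Comp[of _ _ "[a]"]) simp_all

lemma computes_Comp2:
  "computes g xs a \<Longrightarrow> computes h xs b \<Longrightarrow> computes f [a, b] z \<Longrightarrow> computes (Comp f [g, h]) xs z"
  by (rule computes.Comp[of _ _ "[a, b]"]) simp_all

lemma computes_Proj_0: "computes (Proj 0) (x # xs) x"
  using computes.Proj[of 0 "x # xs"] by simp

lemma computes_Proj_1: "computes (Proj 1) (y # x # xs) x"
  using computes.Proj[of 1 "y # x # xs"] by simp

lemma computes_const: "computes (const_recf c) xs c"
  by (induction c) (auto intro: computes.Zero computes_Comp1 computes.Succ)

lemma computes_add: "computes add_recf [m, n] (m + n)"
  unfolding add_recf_def
proof (induction m)
  case 0
  show ?case using computes.PrimRec_0[OF computes_Proj_0] by simp
next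
  case (Suc m)
  have "computes (Comp Succ [Proj 1]) [m, m + n, n] (Suc (m + n))"
    by (rule computes_Comp1[OF computes_Proj_1 computes.Succ])
  from computes.PrimRec_Suc[OF Suc this] show ?case by simp
qed

lemma computes_triangle: "computes triangle_recf [n] (triangle n)"
  unfolding triangle_recf_def
proof (induction n)
  case 0
  show ?case using computes.PrimRec_0[OF computes.Zero] by simp
next
  case (Suc n)
  have "computes (Comp add_recf [Comp Succ [Proj 0], Proj 1]) [n, triangle n] (Suc n + triangle n)"
    by (rule computes_Comp2[OF computes_Comp1[OF computes_Proj_0 computes.Succ] computes_Proj_1 computes_add])
  from computes.PrimRec_Suc[OF Suc this] show ?case by (simp add: add.commute)
qed

lemma computes_pair: "computes pair_recf [m, n] (prod_encode (m, n))"
  unfolding pair_recf_def prod_encode_def prod.case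
  by (rule computes_Comp2[OF computes_Comp1[OF computes_add computes_triangle] computes_Proj_0 computes_add])

lemma computes_pair_Comp:
  "computes g xs a \<Longrightarrow> computes h xs b \<Longrightarrow> computes (Comp pair_recf [g, h]) xs (prod_encode (a, b))"
  by (rule computes_Comp2[OF _ _ computes_pair])

lemma computes_num: "computes num_recf [n] (num_code n)"
  unfolding num_recf_def
proof (induction n)
  case 0
  show ?case using computes.PrimRec_0[OF computes_const] by simp
next
  case (Suc n)
  show ?case unfolding num_code.simps
    by (rule computes.PrimRec_Suc[OF Suc]) (intro computes_pair_Comp computes_const computes_Proj_1)
qed

lemma computes_exs: "computes exs_recf [k, c] (exs_code k c)"
  unfolding exs_recf_def
proof (induction k)
  case 0
  show ?case using computes.PrimRec_0[OF computes_Proj_0] by simp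
next
  case (Suc k)
  show ?case unfolding exs_code.simps
    by (rule computes.PrimRec_Suc[OF Suc]) (intro computes_pair_Comp computes_const computes_Proj_0 computes_Proj_1)
qed

lemma computes_diag: "computes diag_recf [k, fm_code \<chi>] (fm_code (diag_sentence k \<chi>))"
  unfolding diag_recf_def diag_sentence_def fm_code_exs fm_code.simps tm_code.simps tm_code_num
  by (rule computes_Comp2[OF _ _ computes_exs])
    (intro computes_pair_Comp computes_const computes_Proj_0 computes_Proj_1
      computes_Comp1[OF computes_Proj_0 computes_num] computes_Comp1[OF computes_Proj_1 computes_num])+

text \<open>The self-reference: the numerals feed k and the code of \<chi> into \<chi> itself. The
  bound 7 puts the variables 0, 2, 4 and 6 under the quantifiers, so the result is closed.\<close>

lemma diag_sentence_in_Th_ex: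
  assumes \<chi>: "quantifier_free \<chi>" and k: "free_vars \<chi> \<subseteq> {..<k}" "7 \<le> k"
    and sem: "\<And>e. (\<exists>u. sat r0 (mix e u) \<chi>) \<longleftrightarrow> R (e 0) (e 1) \<and> e 2 = 0 \<and> e 3 = 1"
  shows "diag_sentence k \<chi> \<in> existential_sentences"
    and "diag_sentence k \<chi> \<in> Th_ex r0 \<longleftrightarrow> R k (fm_code \<chi>)"
proof -
  define \<psi> where "\<psi> = Conj (Eq (Var 0) (num_tm k)) (Conj (Eq (Var 2) (num_tm (fm_code \<chi>))) \<chi>)"
  have S: "diag_sentence k \<chi> = exs k \<psi>" by (simp only: diag_sentence_def \<psi>_def)
  have qf: "quantifier_free \<psi>" using \<chi> by (simp add: \<psi>_def)
  have "tm_vars (num_tm n) \<subseteq> {4, 6}" for n by (induction n) auto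
  moreover have "{4, 6} \<subseteq> {..<k}" "0 \<in> {..<k}" "2 \<in> {..<k}" using k(2) by auto
  ultimately have fv: "free_vars \<psi> \<subseteq> {..<k}" using k(1) unfolding \<psi>_def by auto
  show S_sent: "diag_sentence k \<chi> \<in> existential_sentences"
    unfolding existential_sentences_def S using existential_exs[OF qf] fv by (auto simp: free_vars_exs)
  have "sat r0 (\<lambda>i. if i < k then v i else e i) \<psi> = sat r0 v \<psi>" for v e
    using fv by (intro sat_agree[OF qf]) auto
  then have "sat r0 e (exs k \<psi>) = (\<exists>v. sat r0 v \<psi>)" for e
    by (simp only: sat_exs)
  then have "diag_sentence k \<chi> \<in> Th_ex r0 \<longleftrightarrow> (\<exists>v. sat r0 v \<psi>)"
    using S_sent by (simp only: Th_ex_def S mem_Collect_eq simp_thms)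
  also have "\<dots> \<longleftrightarrow> R k (fm_code \<chi>)"
  proof
    assume "\<exists>v. sat r0 v \<psi>"
    then obtain v where "sat r0 v \<psi>" ..
    then have v: "v 0 = v 4 + k * v 6" "v 2 = v 4 + fm_code \<chi> * v 6" "sat r0 v \<chi>"
      unfolding \<psi>_def by (simp_all add: tm_val_num)
    have "\<exists>u. sat r0 (mix (\<lambda>i. v (2 * i)) u) \<chi>"
      by (rule exI[of _ "\<lambda>i. v (Suc (2 * i))"]) (simp only: mix_collapse v(3))
    with sem[of "\<lambda>i. v (2 * i)"] have "R (v 0) (v 2) \<and> v 4 = 0 \<and> v 6 = 1" by simp
    with v show "R k (fm_code \<chi>)" by simp
  next
    assume R: "R k (fm_code \<chi>)"
    define e where "e i = (if i = 0 then k else if i = 1 then fm_code \<chi> else if i = 2 then 0 else 1)" for i :: nat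
    have "R (e 0) (e 1) \<and> e 2 = 0 \<and> e 3 = 1" using R by (simp add: e_def)
    then obtain u where u: "sat r0 (mix e u) \<chi>" using sem by blast
    have "sat r0 (mix e u) \<psi>" unfolding \<psi>_def using u by (simp add: tm_val_num) (simp add: mix_def e_def)
    then show "\<exists>v. sat r0 v \<psi>" by (intro exI)
  qed
  finally show "diag_sentence k \<chi> \<in> Th_ex r0 \<longleftrightarrow> R k (fm_code \<chi>)" .
qed

theorem corollary1:
  fixes r0 :: nat
  shows "\<not> decidable_among existential_sentences (Th_ex r0)"
proof
  assume "decidable_among existential_sentences (Th_ex r0)"
  then obtain f where f: "\<And>\<phi>. \<phi> \<in> existential_sentences \<Longrightarrow> computes f [fm_code \<phi>] (if \<phi> \<in> Th_ex r0 then 1 else 0)"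
    unfolding decidable_among_def by blast
  define g where "g = Comp f [diag_recf]"
  \<comment> \<open>The relation says that the supposed decider, run on the diagonal sentence built
    from its two arguments, answers "false".\<close>
  have "NF (\<lambda>e. (\<exists>z. z = 0 \<and> computes g (map e [0..<2]) z) \<and> e 2 = 0 \<and> e 3 = 1)"
    by (intro NF_conj NF_ex NF_args0[OF NF_computes]) (intro NF_dio dio.D_eq dio.F_var dio.F_const)+
  from existential_of_NF[OF this, of r0] obtain \<chi> where \<chi>: "quantifier_free \<chi>"
    and sem: "\<And>e. (\<exists>u. sat r0 (mix e u) \<chi>) \<longleftrightarrow> computes g [e 0, e 1] 0 \<and> e 2 = 0 \<and> e 3 = 1"
    by (auto simp: upt_rec numeral_2_eq_2)
  obtain k0 where "free_vars \<chi> \<subseteq> {..<k0}" using finite_nat_bounded[OF finite_free_vars] by blast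
  then have k: "free_vars \<chi> \<subseteq> {..<k0 + 7}" "7 \<le> k0 + 7" by auto
  note diag = diag_sentence_in_Th_ex[OF \<chi> k, of r0 "\<lambda>a b. computes g [a, b] 0", OF sem]
  have "computes g [k0 + 7, fm_code \<chi>] (if diag_sentence (k0 + 7) \<chi> \<in> Th_ex r0 then 1 else 0)"
    unfolding g_def by (rule computes_Comp1[OF computes_diag f[OF diag(1)]])
  then show False
    \<comment> \<open>The diagonal sentence is true exactly if the decider answers 0 on it, whereas
      a correct decider answers 1 exactly on true sentences.\<close>
    using diag(2) computes_unique by (cases "diag_sentence (k0 + 7) \<chi> \<in> Th_ex r0") fastforce+
qed

end
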